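(* Let $(Y,\mathcal{F})$ be a nonsingular Legendrian foliation on a closed, orientable coisotropic submanifold $Y^{n+1}$ of a contact manifold $(M^{2n+1},\xi)$. Then the infinitesimal deformations of $(Y,\mathcal{F})$ modulo gauge equivalence are modeled by $H^1_{tw}(\mathcal{F})$; that is, the space of infinitesimal deformations of $(Y,\mathcal{F})$ modulo the infinitesimal deformations induced by gauge equivalences (ambient isotopies of $Y$) is the twisted tangential cohomology group $H^1_{tw}(\mathcal{F})$.
   Context: Write $\xi=\ker\alpha_M$, $\lambda=\alpha_M|_Y$, $\mathcal{F}=\ker\lambda$; $\lambda$ is nowhere zero, and coisotropy of the $(n+1)$-dimensional $Y$ means $\lambda\wedge d\lambda=0$, so $\mathcal{F}$ is a codimension one foliation. Fix a line field $L$ on $Y$ transverse to $\mathcal{F}$. Tangential forms: $\Omega^\bullet(\mathcal{F})=\Gamma(\wedge^\bullet T^*\mathcal{F})$ with leafwise exterior differential $d_\mathcal{F}$; $\pi:\Omega^\bullet(Y)\to\Omega^\bullet(\mathcal{F})$ is restriction. For $\zeta\in\Omega^1(\mathcal{F})$, $\overline{\zeta}\in\Omega^1(Y)$ equals $\zeta$ on $T\mathcal{F}$ and vanishes on $L$. Write $d\lambda=\delta\wedge\lambda$ with $\delta\in\Omega^1(Y)$; $\pi(\delta)$ is uniquely determined by $\lambda$ and $d_\mathcal{F}$-closed. The twisted tangential differential is $d^\lambda_\mathcal{F}\omega=d_\mathcal{F}\omega-\pi(\delta)\wedge\omega$, and $H^\bullet_{tw}(\mathcal{F})=H^\bullet(\Omega^\bullet(\mathcal{F}),d^\lambda_\mathcal{F})$.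 Infinitesimal deformations: the graph of $s\in\Omega^1(\mathcal{F})$ in the standard contact neighborhood of $Y$ (a neighborhood of the zero section of $T^*\mathcal{F}$ with contact form $\pi^*\lambda-\eta$, $\eta_{(y,e)}(v)=\langle e,\Pi(\pi_*v)\rangle$, with $\pi:T^*\mathcal{F}\to Y$ here the bundle projection and $\Pi:TY=L\oplus T\mathcal{F}\to T\mathcal{F}$ the projection) is coisotropic iff the contact master equations $\overline{s}\wedge d\overline{s}=\overline{s}\wedge d\lambda+d\overline{s}\wedge\lambda$ on $Y$ and $s\wedge d_\mathcal{F}s=0$ hold. An infinitesimal deformation is a $\zeta\in\Omega^1(\mathcal{F})$ solving the linearization at $s=0$ of these equations. Gauge equivalence of coisotropic deformations (by $C^1$-small ambient contact isotopies) corresponds, via $s\mapsto\ker(\overline{s}-\lambda)$, to gauge equivalence of foliations on $Y$ by ambient isotopies of $Y$. The infinitesimal deformation induced by an ambient isotopy $\psi_t:Y\to Y$, $\psi_0=\mathrm{id}$, is the $\mu\in\Omega^1(\mathcal{F})$ defined by $(\psi_t^{-1})^*\lambda=g_t(\lambda+t\overline{\mu}+O(t^2))$, where $g_t$ is a nonvanishing function on $Y$ with $g_0=1$. *)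

theory Defs
  imports "HOL-Analysis.Analysis" "HOL-Library.Landau_Symbols"
begin

section \<open>Smooth manifolds\<close>

text \<open>
  A manifold is a whole type, second countable and Hausdorff, together with a smooth atlas; an
  atlas need not be maximal.  A submanifold is given by a smooth embedding of one such manifold
  into another.  All manifolds are without boundary.
\<close>

primrec Ck_on :: "nat \<Rightarrow> 'a::euclidean_space set \<Rightarrow> ('a \<Rightarrow> 'b::real_normed_vector) \<Rightarrow> bool" where
  "Ck_on 0 S f = continuous_on S f"
| "Ck_on (Suc k) S f =
     ((\<forall>x\<in>S. f differentiable (at x)) \<and> (\<forall>v. Ck_on k S (\<lambda>x. frechet_derivative f (at x) v)))"

text \<open>Only used for open sets \<open>S\<close>.\<close>

definition smooth_on :: "'a::euclidean_space set \<Rightarrow> ('a \<Rightarrow> 'b::real_normed_vector) \<Rightarrow> bool" where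
  "smooth_on S f \<longleftrightarrow> (\<forall>k. Ck_on k S f)"

type_synonym ('a, 'n) atlas = "('a set \<times> ('a \<Rightarrow> real ^ 'n)) set"

definition is_chart :: "'a::topological_space set \<Rightarrow> ('a \<Rightarrow> real ^ 'n) \<Rightarrow> bool" where
  "is_chart U \<phi> \<longleftrightarrow> open U \<and> open (\<phi> ` U) \<and> (\<exists>\<theta>. homeomorphism U (\<phi> ` U) \<phi> \<theta>)"

definition transition ::
  "'a set \<Rightarrow> ('a \<Rightarrow> real ^ 'n) \<Rightarrow> ('a \<Rightarrow> real ^ 'n) \<Rightarrow> real ^ 'n \<Rightarrow> real ^ 'n" where
  "transition U \<phi> \<psi> x = \<psi> (inv_into U \<phi> x)"

definition smooth_atlas :: "('a::topological_space, 'n::finite) atlas \<Rightarrow> bool" where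
  "smooth_atlas A \<longleftrightarrow>
     (\<forall>(U, \<phi>)\<in>A. is_chart U \<phi>) \<and>
     (\<Union>(U, \<phi>)\<in>A. U) = UNIV \<and>
     (\<forall>(U, \<phi>)\<in>A. \<forall>(V, \<psi>)\<in>A. smooth_on (\<phi> ` (U \<inter> V)) (transition U \<phi> \<psi>))"

text \<open>Orientability: the smooth structure admits an atlas all of whose transition maps have
  positive Jacobian determinant.\<close>

definition orientable :: "('a::topological_space, 'n::finite) atlas \<Rightarrow> bool" where
  "orientable A \<longleftrightarrow>
     (\<exists>B. smooth_atlas B \<and> smooth_atlas (A \<union> B) \<and>
        (\<forall>(U, \<phi>)\<in>B. \<forall>(V, \<psi>)\<in>B. \<forall>x\<in>\<phi> ` (U \<inter> V).
           det (matrix (frechet_derivative (transition U \<phi> \<psi>) (at x))) > 0))"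

definition smooth_fun :: "('a, 'n::finite) atlas \<Rightarrow> ('a \<Rightarrow> real) \<Rightarrow> bool" where
  "smooth_fun A f \<longleftrightarrow> (\<forall>(U, \<phi>)\<in>A. smooth_on (\<phi> ` U) (\<lambda>x. f (inv_into U \<phi> x)))"

definition smooth_map ::
  "('a::topological_space, 'n::finite) atlas \<Rightarrow> ('b::topological_space, 'm::finite) atlas \<Rightarrow>
   ('a \<Rightarrow> 'b) \<Rightarrow> bool" where
  "smooth_map A B F \<longleftrightarrow> continuous_on UNIV F \<and>
     (\<forall>(U, \<phi>)\<in>A. \<forall>(V, \<psi>)\<in>B.
        smooth_on (\<phi> ` (U \<inter> F -` V)) (\<lambda>x. \<psi> (F (inv_into U \<phi> x))))"

definition diffeo :: "('a::topological_space, 'n::finite) atlas \<Rightarrow> ('a \<Rightarrow> 'a) \<Rightarrow> bool" where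
  "diffeo A F \<longleftrightarrow> bij F \<and> smooth_map A A F \<and> smooth_map A A (inv F)"

text \<open>Smooth dependence on a parameter \<open>t\<close> in an open set \<open>J\<close>, jointly with the point.\<close>

definition smooth_family_fun ::
  "('a, 'n::finite) atlas \<Rightarrow> real set \<Rightarrow> (real \<Rightarrow> 'a \<Rightarrow> real) \<Rightarrow> bool" where
  "smooth_family_fun A J g \<longleftrightarrow>
     (\<forall>(U, \<phi>)\<in>A. smooth_on (J \<times> \<phi> ` U) (\<lambda>(t, x). g t (inv_into U \<phi> x)))"

definition smooth_family_map ::
  "('a::topological_space, 'n::finite) atlas \<Rightarrow> real set \<Rightarrow> (real \<Rightarrow> 'a \<Rightarrow> 'a) \<Rightarrow> bool" where
  "smooth_family_map A J \<Psi> \<longleftrightarrow>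
     continuous_on (J \<times> UNIV) (\<lambda>(t, p). \<Psi> t p) \<and>
     (\<forall>(U, \<phi>)\<in>A. \<forall>(V, \<psi>)\<in>A.
        smooth_on {(t, x). t \<in> J \<and> x \<in> \<phi> ` U \<and> \<Psi> t (inv_into U \<phi> x) \<in> V}
          (\<lambda>(t, x). \<psi> (\<Psi> t (inv_into U \<phi> x))))"


section \<open>Tangent vectors and vector fields\<close>

text \<open>
  Tangent vectors at \<open>p\<close> are the derivations at \<open>p\<close> of the algebra of smooth functions.  A
  derivation is a total HOL function on all real functions; it is required to be \<open>0\<close> on non-smooth
  functions, so that equality of derivations is HOL equality.
\<close>

type_synonym 'a tvec = "('a \<Rightarrow> real) \<Rightarrow> real"
type_synonym 'a dist = "'a \<Rightarrow> 'a tvec set"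

definition tangent_space :: "('a, 'n::finite) atlas \<Rightarrow> 'a dist" where
  "tangent_space A p =
     {v. (\<forall>f g a b. smooth_fun A f \<longrightarrow> smooth_fun A g \<longrightarrow>
            v (\<lambda>q. a * f q + b * g q) = a * v f + b * v g) \<and>
         (\<forall>f g. smooth_fun A f \<longrightarrow> smooth_fun A g \<longrightarrow>
            v (\<lambda>q. f q * g q) = f p * v g + g p * v f) \<and>
         (\<forall>f. \<not> smooth_fun A f \<longrightarrow> v f = 0)}"

text \<open>\<open>\<Gamma>(D)\<close>: smooth vector fields with values in the distribution \<open>D\<close>; vector fields on the
  manifold are the case \<open>D = tangent_space A\<close>.\<close>

definition sections :: "('a, 'n::finite) atlas \<Rightarrow> 'a dist \<Rightarrow> ('a \<Rightarrow> 'a tvec) set" where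
  "sections A D = {X. (\<forall>p. X p \<in> tangent_space A p \<inter> D p) \<and>
                      (\<forall>f. smooth_fun A f \<longrightarrow> smooth_fun A (\<lambda>p. X p f))}"

definition lie_bracket :: "('a \<Rightarrow> 'a tvec) \<Rightarrow> ('a \<Rightarrow> 'a tvec) \<Rightarrow> 'a \<Rightarrow> 'a tvec" where
  "lie_bracket X Y p f = X p (\<lambda>q. Y q f) - Y p (\<lambda>q. X q f)"

definition differential ::
  "('b, 'm::finite) atlas \<Rightarrow> ('a \<Rightarrow> 'b) \<Rightarrow> 'a tvec \<Rightarrow> 'b tvec" where
  "differential B F v = (\<lambda>f. if smooth_fun B f then v (\<lambda>q. f (F q)) else 0)"

definition smooth_embedding ::
  "('a::topological_space, 'n::finite) atlas \<Rightarrow> ('b::topological_space, 'm::finite) atlas \<Rightarrow>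
   ('a \<Rightarrow> 'b) \<Rightarrow> bool" where
  "smooth_embedding A B F \<longleftrightarrow> smooth_map A B F \<and>
     (\<forall>p. inj_on (differential B F) (tangent_space A p)) \<and>
     (\<exists>G. homeomorphism UNIV (range F) F G)"


section \<open>Differential forms along a distribution\<close>

text \<open>
  \<open>forms1 A D\<close> is \<open>\<Gamma>(D\<^sup>*)\<close>.  For \<open>D = tangent_space A\<close> it is the space of ordinary 1-forms, for
  \<open>D = T\<F>\<close> that of tangential 1-forms.  Forms of degree 1, 2, 3 on \<open>D\<close> are functions of a point
  and of 1, 2, 3 tangent vectors, equal to \<open>0\<close> when some argument is outside \<open>D p\<close>, so that
  equality of forms is HOL equality.  Forms of degree 0 are smooth functions.
\<close>

type_synonym 'a form1 = "'a \<Rightarrow> 'a tvec \<Rightarrow> real"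
type_synonym 'a form2 = "'a \<Rightarrow> 'a tvec \<Rightarrow> 'a tvec \<Rightarrow> real"
type_synonym 'a form3 = "'a \<Rightarrow> 'a tvec \<Rightarrow> 'a tvec \<Rightarrow> 'a tvec \<Rightarrow> real"

definition forms1 :: "('a, 'n::finite) atlas \<Rightarrow> 'a dist \<Rightarrow> 'a form1 set" where
  "forms1 A D =
     {\<omega>. (\<forall>p. \<forall>v\<in>D p. \<forall>w\<in>D p. \<forall>a b. \<omega> p (\<lambda>f. a * v f + b * w f) = a * \<omega> p v + b * \<omega> p w) \<and>
         (\<forall>p v. v \<notin> D p \<longrightarrow> \<omega> p v = 0) \<and>
         (\<forall>X\<in>sections A D. smooth_fun A (\<lambda>p. \<omega> p (X p)))}"

text \<open>
  The exterior differential along an involutive distribution \<open>D\<close>, by the Koszul formula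
  \<open>d\<omega>(X,Y) = X(\<omega>(Y)) - Y(\<omega>(X)) - \<omega>([X,Y])\<close> for \<open>X, Y \<in> \<Gamma>(D)\<close>, the value at a point being
  independent of the sections extending the two given vectors.  It is the de Rham differential for
  \<open>D = tangent_space A\<close> and the leafwise differential for \<open>D = T\<F>\<close>.
\<close>

definition ext_d0 :: "'a dist \<Rightarrow> ('a \<Rightarrow> real) \<Rightarrow> 'a form1" where
  "ext_d0 D f p v = (if v \<in> D p then v f else 0)"

definition ext_d1 :: "('a, 'n::finite) atlas \<Rightarrow> 'a dist \<Rightarrow> 'a form1 \<Rightarrow> 'a form2" where
  "ext_d1 A D \<omega> p v w =
     (if v \<in> D p \<and> w \<in> D p
      then (THE c. \<exists>X\<in>sections A D. \<exists>Y\<in>sections A D. X p = v \<and> Y p = w \<and>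
              c = X p (\<lambda>q. \<omega> q (Y q)) - Y p (\<lambda>q. \<omega> q (X q)) - \<omega> p (lie_bracket X Y p))
      else 0)"

definition wedge11 :: "'a form1 \<Rightarrow> 'a form1 \<Rightarrow> 'a form2" where
  "wedge11 \<alpha> \<beta> p v w = \<alpha> p v * \<beta> p w - \<alpha> p w * \<beta> p v"

definition wedge12 :: "'a form1 \<Rightarrow> 'a form2 \<Rightarrow> 'a form3" where
  "wedge12 \<alpha> \<beta> p u v w = \<alpha> p u * \<beta> p v w - \<alpha> p v * \<beta> p u w + \<alpha> p w * \<beta> p u v"

definition wedge21 :: "'a form2 \<Rightarrow> 'a form1 \<Rightarrow> 'a form3" where
  "wedge21 \<beta> \<alpha> p u v w = \<beta> p u v * \<alpha> p w - \<beta> p u w * \<alpha> p v + \<beta> p v w * \<alpha> p u"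

definition restrict1 :: "'a dist \<Rightarrow> 'a form1 \<Rightarrow> 'a form1" where
  "restrict1 D \<omega> p v = (if v \<in> D p then \<omega> p v else 0)"

definition pullback1 ::
  "('a, 'n::finite) atlas \<Rightarrow> ('b, 'm::finite) atlas \<Rightarrow> ('a \<Rightarrow> 'b) \<Rightarrow> 'b form1 \<Rightarrow> 'a form1" where
  "pullback1 A B F \<omega> p v =
     (if v \<in> tangent_space A p then \<omega> (F p) (differential B F v) else 0)"

definition ker_form :: "('a, 'n::finite) atlas \<Rightarrow> 'a form1 \<Rightarrow> 'a dist" where
  "ker_form A \<omega> p = {v \<in> tangent_space A p. \<omega> p v = 0}"

definition nowhere_zero :: "('a, 'n::finite) atlas \<Rightarrow> 'a form1 \<Rightarrow> bool" where
  "nowhere_zero A \<omega> \<longleftrightarrow> (\<forall>p. \<exists>v\<in>tangent_space A p. \<omega> p v \<noteq> 0)"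


section \<open>Contact forms and coisotropic submanifolds\<close>

text \<open>\<open>\<xi> = ker \<alpha>\<close> is a hyperplane field on which \<open>d\<alpha>\<close> is nondegenerate.\<close>

definition contact_form :: "('a, 'n::finite) atlas \<Rightarrow> 'a form1 \<Rightarrow> bool" where
  "contact_form A \<alpha> \<longleftrightarrow>
     \<alpha> \<in> forms1 A (tangent_space A) \<and> nowhere_zero A \<alpha> \<and>
     (\<forall>p. \<forall>v\<in>ker_form A \<alpha> p.
        (\<forall>w\<in>ker_form A \<alpha> p. ext_d1 A (tangent_space A) \<alpha> p v w = 0) \<longrightarrow> v = (\<lambda>f. 0))"

text \<open>
  Coisotropy of an \<open>(n+1)\<close>-dimensional submanifold of a \<open>(2n+1)\<close>-dimensional contact manifold
  means \<open>\<lambda> \<and> d\<lambda> = 0\<close> for the restriction \<open>\<lambda>\<close> of the contact form.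
\<close>

definition coisotropic :: "('a, 'n::finite) atlas \<Rightarrow> 'a form1 \<Rightarrow> bool" where
  "coisotropic A lam \<longleftrightarrow>
     wedge12 lam (ext_d1 A (tangent_space A) lam) = (\<lambda>p u v w. 0)"


section \<open>The transverse line field and the extension of tangential forms\<close>

definition line_field :: "('a::topological_space, 'n::finite) atlas \<Rightarrow> 'a dist \<Rightarrow> bool" where
  "line_field A L \<longleftrightarrow>
     (\<forall>p. \<exists>U. open U \<and> p \<in> U \<and>
        (\<exists>X\<in>sections A (tangent_space A).
           \<forall>q\<in>U. X q \<noteq> (\<lambda>f. 0) \<and> L q = {(\<lambda>f. c * X q f) | c. True}))"

definition transverse :: "('a, 'n::finite) atlas \<Rightarrow> 'a dist \<Rightarrow> 'a dist \<Rightarrow> bool" where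
  "transverse A L D \<longleftrightarrow>
     (\<forall>p. tangent_space A p = {(\<lambda>f. l f + w f) | l w. l \<in> L p \<and> w \<in> D p})"

text \<open>The projection \<open>\<Pi> : TY = L \<oplus> D \<rightarrow> D\<close>.\<close>

definition proj_along :: "'a dist \<Rightarrow> 'a dist \<Rightarrow> 'a \<Rightarrow> 'a tvec \<Rightarrow> 'a tvec" where
  "proj_along L D p v = (THE w. w \<in> D p \<and> (\<lambda>f. v f - w f) \<in> L p)"

definition extend1 ::
  "('a, 'n::finite) atlas \<Rightarrow> 'a dist \<Rightarrow> 'a dist \<Rightarrow> 'a form1 \<Rightarrow> 'a form1" where
  "extend1 A L D \<zeta> p v = (if v \<in> tangent_space A p then \<zeta> p (proj_along L D p v) else 0)"


section \<open>Quotients of spaces of 1-forms\<close>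

definition form_subspace :: "'a form1 set \<Rightarrow> bool" where
  "form_subspace V \<longleftrightarrow> (\<lambda>p v. 0) \<in> V \<and>
     (\<forall>\<omega>\<in>V. \<forall>\<eta>\<in>V. \<forall>a b. (\<lambda>p v. a * \<omega> p v + b * \<eta> p v) \<in> V)"

text \<open>The set of cosets \<open>\<omega> + W\<close> with \<open>\<omega> \<in> V\<close>, for subspaces \<open>W \<subseteq> V\<close>.\<close>

definition form_quotient :: "'a form1 set \<Rightarrow> 'a form1 set \<Rightarrow> 'a form1 set set" where
  "form_quotient V W = V // {(\<omega>, \<eta>). \<omega> \<in> V \<and> \<eta> \<in> V \<and> (\<lambda>p v. \<omega> p v - \<eta> p v) \<in> W}"


section \<open>Twisted tangential cohomology in degree one\<close>

text \<open>In this and the next section \<open>\<F> = ker \<lambda>\<close>.  The form \<open>\<pi>(\<delta>)\<close>, where \<open>d\<lambda> = \<delta> \<and> \<lambda>\<close>, is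
  uniquely determined by \<open>\<lambda>\<close> although \<open>\<delta>\<close> is not.\<close>

definition twist_form :: "('a, 'n::finite) atlas \<Rightarrow> 'a form1 \<Rightarrow> 'a form1" where
  "twist_form A lam =
     (THE \<theta>. \<exists>\<delta>\<in>forms1 A (tangent_space A).
        ext_d1 A (tangent_space A) lam = wedge11 \<delta> lam \<and> \<theta> = restrict1 (ker_form A lam) \<delta>)"

definition twisted_d0 :: "('a, 'n::finite) atlas \<Rightarrow> 'a form1 \<Rightarrow> ('a \<Rightarrow> real) \<Rightarrow> 'a form1" where
  "twisted_d0 A lam f p v = ext_d0 (ker_form A lam) f p v - twist_form A lam p v * f p"

definition twisted_d1 :: "('a, 'n::finite) atlas \<Rightarrow> 'a form1 \<Rightarrow> 'a form1 \<Rightarrow> 'a form2" where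
  "twisted_d1 A lam \<omega> p v w =
     ext_d1 A (ker_form A lam) \<omega> p v w - wedge11 (twist_form A lam) \<omega> p v w"

definition H1_tw :: "('a, 'n::finite) atlas \<Rightarrow> 'a form1 \<Rightarrow> 'a form1 set set" where
  "H1_tw A lam =
     form_quotient {\<omega> \<in> forms1 A (ker_form A lam). twisted_d1 A lam \<omega> = (\<lambda>p v w. 0)}
                   {twisted_d0 A lam f | f. smooth_fun A f}"


section \<open>Infinitesimal deformations and gauge equivalences\<close>

text \<open>The contact master equations for \<open>s \<in> \<Omega>\<^sup>1(\<F>)\<close> are \<open>master1 A \<lambda> L s = 0\<close> and
  \<open>master2 A \<lambda> s = 0\<close>; \<open>master1\<close> is the left side minus the right side of
  \<open>s' \<and> ds' = s' \<and> d\<lambda> + ds' \<and> \<lambda>\<close>, where \<open>s'\<close> extends \<open>s\<close> by \<open>0\<close> on \<open>L\<close>.\<close>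

definition master1 ::
  "('a, 'n::finite) atlas \<Rightarrow> 'a form1 \<Rightarrow> 'a dist \<Rightarrow> 'a form1 \<Rightarrow> 'a form3" where
  "master1 A lam L s p u v w =
     (let s' = extend1 A L (ker_form A lam) s; d = ext_d1 A (tangent_space A) in
        wedge12 s' (d s') p u v w - (wedge12 s' (d lam) p u v w + wedge21 (d s') lam p u v w))"

definition master2 :: "('a, 'n::finite) atlas \<Rightarrow> 'a form1 \<Rightarrow> 'a form1 \<Rightarrow> 'a form3" where
  "master2 A lam s = wedge12 s (ext_d1 A (ker_form A lam) s)"

text \<open>Solutions of the linearization at \<open>s = 0\<close>: the derivatives at \<open>0\<close> of both master maps in the
  direction \<open>\<zeta>\<close> vanish.\<close>

definition infinitesimal_deformations ::
  "('a, 'n::finite) atlas \<Rightarrow> 'a form1 \<Rightarrow> 'a dist \<Rightarrow> 'a form1 set" where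
  "infinitesimal_deformations A lam L =
     {\<zeta> \<in> forms1 A (ker_form A lam).
        \<forall>p u v w.
          ((\<lambda>t. master1 A lam L (\<lambda>q x. t * \<zeta> q x) p u v w) has_real_derivative 0) (at 0) \<and>
          ((\<lambda>t. master2 A lam (\<lambda>q x. t * \<zeta> q x) p u v w) has_real_derivative 0) (at 0)}"

text \<open>Isotopies are parametrized by \<open>[0,1]\<close>; smoothness on \<open>[0,1]\<close> means smoothness on an open
  neighbourhood of it.\<close>

definition ambient_isotopy ::
  "('a::topological_space, 'n::finite) atlas \<Rightarrow> (real \<Rightarrow> 'a \<Rightarrow> 'a) \<Rightarrow> bool" where
  "ambient_isotopy A \<psi> \<longleftrightarrow> \<psi> 0 = id \<and> (\<forall>t\<in>{0..1}. diffeo A (\<psi> t)) \<and>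
     (\<exists>J. open J \<and> {0..1} \<subseteq> J \<and> smooth_family_map A J \<psi>)"

text \<open>
  The relation \<open>(\<psi>\<^sub>t\<inverse>)\<^sup>* \<lambda> = g\<^sub>t (\<lambda> + t \<mu>' + O(t\<^sup>2))\<close> with \<open>\<mu>'\<close> the extension of \<open>\<mu>\<close> by \<open>0\<close> on \<open>L\<close>.
  The remainder \<open>r\<^sub>t\<close> is \<open>O(t\<^sup>2)\<close> on each tangent vector as \<open>t \<rightarrow> 0\<close> from the right; as all terms
  are smooth in \<open>(t, p)\<close> and the manifold is compact, this is the same as a uniform bound.
\<close>

definition gauge_deformations ::
  "('a::topological_space, 'n::finite) atlas \<Rightarrow> 'a form1 \<Rightarrow> 'a dist \<Rightarrow> 'a form1 set" where
  "gauge_deformations A lam L =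
     {\<mu> \<in> forms1 A (ker_form A lam).
        \<exists>\<psi> g r. ambient_isotopy A \<psi> \<and>
          (\<exists>J. open J \<and> {0..1} \<subseteq> J \<and> smooth_family_fun A J g) \<and>
          g 0 = (\<lambda>p. 1) \<and> (\<forall>t\<in>{0..1}. \<forall>p. g t p \<noteq> 0) \<and>
          (\<forall>t\<in>{0..1}. \<forall>p. \<forall>v\<in>tangent_space A p.
             pullback1 A A (inv (\<psi> t)) lam p v =
               g t p * (lam p v + t * extend1 A L (ker_form A lam) \<mu> p v + r t p v)) \<and>
          (\<forall>p. \<forall>v\<in>tangent_space A p. (\<lambda>t. r t p v) \<in> O[at_right 0](\<lambda>t. t\<^sup>2))}"

end

theory Submission
  imports Defs
begin

text \<open>
  Let \<open>\<nu>\<close> be the section of \<open>L\<close> with \<open>\<lambda>(\<nu>) = 1\<close>.  Coisotropy gives \<open>d\<lambda> = \<delta> \<and> \<lambda>\<close> with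
  \<open>\<delta>(v) = d\<lambda>(v, \<nu>)\<close>, and the linearization of the master equations reads
  \<open>(d\<zeta>' - \<delta> \<and> \<zeta>') \<and> \<lambda> = 0\<close> for the extension \<open>\<zeta>'\<close> of \<open>\<zeta>\<close>; this holds iff \<open>d\<zeta>' - \<delta> \<and> \<zeta>'\<close>
  vanishes on the leaves, i.e. iff \<open>\<zeta>\<close> is closed for the twisted differential.

  An isotopy \<open>\<psi>\<close> with initial velocity \<open>X\<close> satisfies
  \<open>(\<psi>\<^sub>t\<inverse>)\<^sup>* \<lambda> = \<lambda> - t L\<^sub>X \<lambda> + O(t\<^sup>2)\<close>, and by Cartan's formula the restriction of \<open>- L\<^sub>X \<lambda>\<close> to the
  leaves is the twisted differential of \<open>- \<lambda>(X)\<close>.  Conversely, to realize the twisted differential of \<open>f\<close> take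
  \<open>X = - f \<nu>\<close>.  No flow is needed for this: only the initial velocity of the isotopy matters, so
  a composition of finitely many perturbations of the identity supported in charts will do.
\<close>

section \<open>Calculus of smooth functions on open sets\<close>

text \<open>Both sides are computed as sets of forms: infinitesimal deformations are exactly the
  twisted cocycles, gauge deformations exactly the twisted coboundaries, so the two quotients
  coincide literally. The factor \<open>g\<close> is essential for the second identity: to first
  order an isotopy changes \<lambda> by -L_X \<lambda>, whose value on \<nu> need not vanish,
  whereas the extension of \<mu> kills \<nu>; \<open>g\<close> absorbs that value, and g_t = exp(t
  k) does so when a coboundary is realized. Three features of the encoding shape the work. Tangent
  vectors act on global smooth functions only, hence bump functions, extensions and Hadamard's lemma
  before a local frame is available. Exterior differentials are definite descriptions over extending
  sections, hence the proof of tensoriality. An isotopy is smooth in (t, p), but the gauge relation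
  involves its inverses, assumed smooth for each fixed t only; their O(t^2) expansions come from
  estimates. Compactness controls these inverses as t tends to 0 and splits a vector field into
  finitely many pieces supported in charts.\<close>

lemma Ck_on_cong:
  assumes "open S" "\<And>x. x \<in> S \<Longrightarrow> f x = g x" "Ck_on k S f"
  shows "Ck_on k S g"
  using assms(2,3)
proof (induction k arbitrary: f g)
  case 0 then show ?case using continuous_on_cong by (metis Ck_on.simps(1))
next
  case (Suc k)
  have d: "(g has_derivative frechet_derivative f (at x)) (at x)" if "x \<in> S" for x
    using Suc.prems that assms(1)
    by (metis Ck_on.simps(2) frechet_derivative_works has_derivative_transform_within_open)
  then have "g differentiable (at x)" if "x \<in> S" for x
    using that unfolding differentiable_def by blast
  moreover have "Ck_on k S (\<lambda>x. frechet_derivative g (at x) v)" for v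
  proof (rule Suc.IH)
    show "frechet_derivative f (at x) v = frechet_derivative g (at x) v" if "x \<in> S" for x
      using frechet_derivative_at[OF d[OF that]] by simp
    show "Ck_on k S (\<lambda>x. frechet_derivative f (at x) v)" using Suc.prems by simp
  qed
  ultimately show ?case by simp
qed

lemma Ck_on_subset: "Ck_on k S f \<Longrightarrow> T \<subseteq> S \<Longrightarrow> Ck_on k T f"
  by (induction k arbitrary: f) (auto intro: continuous_on_subset)

lemma Ck_on_SucD: "Ck_on (Suc k) S f \<Longrightarrow> Ck_on k S f"
proof (induction k arbitrary: f)
  case 0
  then show ?case
    by (auto intro!: continuous_at_imp_continuous_on differentiable_imp_continuous_within)
next
  case (Suc k)
  then show ?case by simp
qed

text \<open>Lets any convenient formula for the derivative stand in for
  \<open>frechet_derivative\<close>, as long as it is C^k in each fixed direction.\<close>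

lemma Ck_on_SucI:
  assumes "open S" "\<And>x. x \<in> S \<Longrightarrow> (f has_derivative f' x) (at x)" "\<And>v. Ck_on k S (\<lambda>x. f' x v)"
  shows "Ck_on (Suc k) S f"
proof -
  have "Ck_on k S (\<lambda>x. frechet_derivative f (at x) v)" for v
    by (rule Ck_on_cong[OF assms(1) _ assms(3)[of v]])
      (use frechet_derivative_at[OF assms(2)] in auto)
  then show ?thesis using assms(2) by (auto simp: differentiable_def)
qed

lemma Ck_on_has_derivative:
  "Ck_on (Suc k) S f \<Longrightarrow> x \<in> S \<Longrightarrow> (f has_derivative frechet_derivative f (at x)) (at x)"
  by (simp add: frechet_derivative_works[symmetric])

lemma Ck_on_const [simp, intro]: "Ck_on k S (\<lambda>x. c)"
  by (induction k arbitrary: c) auto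

lemma Ck_on_add:
  assumes "open S" "Ck_on k S f" "Ck_on k S g" shows "Ck_on k S (\<lambda>x. f x + g x)"
  using assms(2,3)
proof (induction k arbitrary: f g)
  case 0 then show ?case by (auto intro: continuous_intros)
next
  case (Suc k)
  show ?case
    by (rule Ck_on_SucI[OF assms(1), where f'="\<lambda>x v. frechet_derivative f (at x) v + frechet_derivative g (at x) v"])
      (use Suc in \<open>auto intro!: has_derivative_add simp: frechet_derivative_works[symmetric]\<close>)
qed

lemma Ck_on_bounded_bilinear:
  assumes "bounded_bilinear h" "open S" "Ck_on k S f" "Ck_on k S g"
  shows "Ck_on k S (\<lambda>x. h (f x) (g x))"
  using assms(3,4)
proof (induction k arbitrary: f g)
  case 0 then show ?case using bounded_bilinear.continuous_on[OF assms(1)] by auto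
next
  case (Suc k)
  show ?case
  proof (rule Ck_on_SucI[OF assms(2)])
    show "((\<lambda>x. h (f x) (g x)) has_derivative
       (\<lambda>v. h (f x) (frechet_derivative g (at x) v) + h (frechet_derivative f (at x) v) (g x))) (at x)"
      if "x \<in> S" for x
      by (rule bounded_bilinear.FDERIV[OF assms(1)])
        (use Suc.prems that in \<open>auto simp: frechet_derivative_works[symmetric]\<close>)
    show "Ck_on k S (\<lambda>x. h (f x) (frechet_derivative g (at x) v) + h (frechet_derivative f (at x) v) (g x))" for v
      by (intro Ck_on_add[OF assms(2)] Suc.IH)
        (use Suc.prems Ck_on_SucD in \<open>auto simp del: Ck_on.simps(2)\<close>, (simp)+)
  qed
qed

lemma Ck_on_bounded_linear:
  assumes "bounded_linear h" "open S" "Ck_on k S f" shows "Ck_on k S (\<lambda>x. h (f x))"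
  using assms(3)
proof (induction k arbitrary: f)
  case 0 then show ?case using bounded_linear.continuous_on[OF assms(1)] by auto
next
  case (Suc k)
  show ?case
    by (rule Ck_on_SucI[OF assms(2), where f'="\<lambda>x v. h (frechet_derivative f (at x) v)"])
      (use Suc in \<open>auto intro!: bounded_linear.has_derivative[OF assms(1)]
        simp: frechet_derivative_works[symmetric]\<close>)
qed

lemma Ck_on_id: "open S \<Longrightarrow> Ck_on k S (\<lambda>x. x)"
  by (cases k) (auto intro!: Ck_on_SucI[where f'="\<lambda>x v. v"] derivative_eq_intros simp del: Ck_on.simps(2))

lemma Ck_on_sum:
  assumes "open S" "\<And>i. i \<in> I \<Longrightarrow> Ck_on k S (f i)" shows "Ck_on k S (\<lambda>x. \<Sum>i\<in>I. f i x)"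
  using assms(2) by (induction I rule: infinite_finite_induct) (auto intro: Ck_on_add[OF assms(1)])

lemma Ck_on_local:
  assumes "\<And>x. x \<in> S \<Longrightarrow> \<exists>U. open U \<and> x \<in> U \<and> Ck_on k U f" shows "Ck_on k S f"
  using assms
proof (induction k arbitrary: f)
  case 0
  show ?case
    unfolding Ck_on.simps
  proof (rule continuous_at_imp_continuous_on, rule ballI)
    fix x assume "x \<in> S"
    then show "isCont f x" using 0 by (metis Ck_on.simps(1) continuous_on_eq_continuous_at)
  qed
next
  case (Suc k)
  show ?case unfolding Ck_on.simps
  proof (intro conjI ballI allI)
    show "f differentiable at x" if "x \<in> S" for x using Suc.prems[OF that] by auto
    show "Ck_on k S (\<lambda>x. frechet_derivative f (at x) v)" for v
      by (rule Suc.IH) (use Suc.prems in fastforce)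
  qed
qed

text \<open>The derivative of the composite pairs two functions of x, Dg(f x) and Df(x) v. Expanding
  Df(x) v in \<open>Basis\<close> turns it into a sum of products with directional derivatives of g
  along fixed basis vectors, to which the induction hypothesis and the product rule apply.\<close>

lemma Ck_on_compose:
  fixes f :: "'a::euclidean_space \<Rightarrow> 'b::euclidean_space" and g :: "'b \<Rightarrow> 'c::real_normed_vector"
  assumes "open S" "open T" "Ck_on k S f" "Ck_on k T g" "f ` S \<subseteq> T"
  shows "Ck_on k S (\<lambda>x. g (f x))"
  using assms(3,4,5)
proof (induction k arbitrary: g)
  case 0 then show ?case using continuous_on_compose2 by auto
next
  case (Suc k)
  have lin: "frechet_derivative g (at (f x)) w =
     (\<Sum>b\<in>Basis. (w \<bullet> b) *\<^sub>R frechet_derivative g (at (f x)) b)" if "x \<in> S" for x w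
  proof -
    have "g differentiable at (f x)" using Suc.prems that by auto
    then have "linear (frechet_derivative g (at (f x)))"
      by (simp add: linear_frechet_derivative)
    then have "(\<Sum>b\<in>Basis. (w \<bullet> b) *\<^sub>R frechet_derivative g (at (f x)) b)
       = frechet_derivative g (at (f x)) (\<Sum>b\<in>Basis. (w \<bullet> b) *\<^sub>R b)"
      by (simp add: linear_sum linear_cmul)
    then show ?thesis by (simp add: euclidean_representation)
  qed
  show ?case
  proof (rule Ck_on_SucI[OF assms(1)])
    show "((\<lambda>x. g (f x)) has_derivative
      (\<lambda>v. \<Sum>b\<in>Basis. (frechet_derivative f (at x) v \<bullet> b) *\<^sub>R frechet_derivative g (at (f x)) b)) (at x)"
      if "x \<in> S" for x
      unfolding lin[OF that, symmetric]
      by (rule has_derivative_compose[where f=f and g=g])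
        (use Suc.prems that in \<open>auto simp: frechet_derivative_works[symmetric]\<close>)
    show "Ck_on k S (\<lambda>x. \<Sum>b\<in>Basis. (frechet_derivative f (at x) v \<bullet> b) *\<^sub>R frechet_derivative g (at (f x)) b)" for v
    proof (intro Ck_on_sum[OF assms(1)] Ck_on_bounded_bilinear[OF bounded_bilinear_scaleR assms(1)])
      fix b :: 'b
      show "Ck_on k S (\<lambda>x. frechet_derivative f (at x) v \<bullet> b)"
        by (rule Ck_on_bounded_linear[OF bounded_linear_inner_left assms(1)]) (use Suc.prems in auto)
      show "Ck_on k S (\<lambda>x. frechet_derivative g (at (f x)) b)"
        by (rule Suc.IH) (use Suc.prems Ck_on_SucD[OF Suc.prems(1)] in auto)
    qed
  qed
qed

section \<open>Smooth functions as functions that are C^k for every k\<close>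

lemma smooth_onD: "smooth_on S f \<Longrightarrow> Ck_on k S f"
  by (simp add: smooth_on_def)

lemma smooth_on_cong:
  "open S \<Longrightarrow> (\<And>x. x \<in> S \<Longrightarrow> f x = g x) \<Longrightarrow> smooth_on S f \<Longrightarrow> smooth_on S g"
  unfolding smooth_on_def using Ck_on_cong by blast

lemma smooth_on_subset: "smooth_on S f \<Longrightarrow> T \<subseteq> S \<Longrightarrow> smooth_on T f"
  unfolding smooth_on_def using Ck_on_subset by blast

lemma smooth_on_local:
  "(\<And>x. x \<in> S \<Longrightarrow> \<exists>U. open U \<and> x \<in> U \<and> smooth_on U f) \<Longrightarrow> smooth_on S f"
  unfolding smooth_on_def using Ck_on_local by metis

lemma smooth_on_const [simp, intro]: "smooth_on S (\<lambda>x. c)"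
  by (simp add: smooth_on_def)

lemma smooth_on_id: "open S \<Longrightarrow> smooth_on S (\<lambda>x. x)"
  by (simp add: smooth_on_def Ck_on_id)

lemma smooth_on_add: "open S \<Longrightarrow> smooth_on S f \<Longrightarrow> smooth_on S g \<Longrightarrow> smooth_on S (\<lambda>x. f x + g x)"
  by (simp add: smooth_on_def Ck_on_add)

lemma smooth_on_bounded_bilinear:
  "bounded_bilinear h \<Longrightarrow> open S \<Longrightarrow> smooth_on S f \<Longrightarrow> smooth_on S g \<Longrightarrow> smooth_on S (\<lambda>x. h (f x) (g x))"
  by (simp add: smooth_on_def Ck_on_bounded_bilinear)

lemma smooth_on_bounded_linear:
  "bounded_linear h \<Longrightarrow> open S \<Longrightarrow> smooth_on S f \<Longrightarrow> smooth_on S (\<lambda>x. h (f x))"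
  by (simp add: smooth_on_def Ck_on_bounded_linear)

lemmas smooth_on_scaleR = smooth_on_bounded_bilinear[OF bounded_bilinear_scaleR]
lemmas smooth_on_inner = smooth_on_bounded_bilinear[OF bounded_bilinear_inner]

lemma smooth_on_mult:
  fixes f :: "_ \<Rightarrow> real"
  shows "open S \<Longrightarrow> smooth_on S f \<Longrightarrow> smooth_on S g \<Longrightarrow> smooth_on S (\<lambda>x. f x * g x)"
  by (rule smooth_on_bounded_bilinear[OF bounded_bilinear_mult])

lemma smooth_on_minus: "open S \<Longrightarrow> smooth_on S f \<Longrightarrow> smooth_on S (\<lambda>x. - f x)"
  by (rule smooth_on_bounded_linear[OF bounded_linear_minus[OF bounded_linear_ident]])

lemma smooth_on_diff:
  assumes "open S" "smooth_on S f" "smooth_on S g" shows "smooth_on S (\<lambda>x. f x - g x)"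
  using smooth_on_add[OF assms(1,2) smooth_on_minus[OF assms(1,3)]] by simp

lemma smooth_on_sum:
  "open S \<Longrightarrow> (\<And>i. i \<in> I \<Longrightarrow> smooth_on S (f i)) \<Longrightarrow> smooth_on S (\<lambda>x. \<Sum>i\<in>I. f i x)"
  by (simp add: smooth_on_def Ck_on_sum)

lemma smooth_on_compose:
  fixes f :: "'a::euclidean_space \<Rightarrow> 'b::euclidean_space" and g :: "'b \<Rightarrow> 'c::real_normed_vector"
  assumes "open S" "open T" "smooth_on S f" "smooth_on T g" "\<And>x. x \<in> S \<Longrightarrow> f x \<in> T"
  shows "smooth_on S (\<lambda>x. g (f x))"
  unfolding smooth_on_def
proof
  fix k
  have "Ck_on k S f" "Ck_on k T g" using assms(3,4) by (auto simp: smooth_on_def)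
  then show "Ck_on k S (\<lambda>x. g (f x))"
    by (rule Ck_on_compose[OF assms(1,2)]) (use assms(5) in auto)
qed

lemma smooth_on_Pair:
  fixes f :: "_ \<Rightarrow> 'b::real_normed_vector" and g :: "_ \<Rightarrow> 'c::real_normed_vector"
  assumes "open S" "smooth_on S f" "smooth_on S g" shows "smooth_on S (\<lambda>x. (f x, g x))"
proof -
  have "bounded_linear (\<lambda>x::'b. (x, 0::'c))" "bounded_linear (\<lambda>x::'c. (0::'b, x))"
    by (auto intro: bounded_linear_Pair)
  from smooth_on_add[OF assms(1) smooth_on_bounded_linear[OF this(1) assms(1,2)] smooth_on_bounded_linear[OF this(2) assms(1,3)]]
  show ?thesis by simp
qed

lemmas smooth_on_fst = smooth_on_bounded_linear[OF bounded_linear_fst]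
lemmas smooth_on_snd = smooth_on_bounded_linear[OF bounded_linear_snd]
lemmas smooth_on_vec_nth = smooth_on_bounded_linear[OF bounded_linear_vec_nth]

lemmas smooth_on_intros = smooth_on_const smooth_on_id smooth_on_add smooth_on_scaleR smooth_on_inner
  smooth_on_mult smooth_on_minus smooth_on_diff smooth_on_sum smooth_on_Pair smooth_on_fst smooth_on_snd
  smooth_on_vec_nth

lemma smooth_on_vec_lambda:
  assumes "open S" "\<And>i. smooth_on S (\<lambda>x. f x $ i)" shows "smooth_on S (f :: _ \<Rightarrow> real ^ 'n)"
proof -
  have "smooth_on S (\<lambda>x. \<Sum>i\<in>UNIV. (f x $ i) *\<^sub>R axis i (1::real))"
    by (rule smooth_on_sum[OF assms(1)], rule smooth_on_scaleR[OF assms(1)]) (use assms in auto)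
  moreover have "(\<lambda>x. \<Sum>i\<in>UNIV. (f x $ i) *\<^sub>R axis i (1::real)) = f"
    using basis_expansion[of "f _"] by (simp add: scalar_mult_eq_scaleR)
  ultimately show ?thesis by (simp only:)
qed

lemma smooth_on_has_derivative:
  "smooth_on S f \<Longrightarrow> x \<in> S \<Longrightarrow> (f has_derivative frechet_derivative f (at x)) (at x)"
  unfolding smooth_on_def using Ck_on_has_derivative by blast

lemma smooth_on_frechet_derivative:
  "smooth_on S f \<Longrightarrow> smooth_on S (\<lambda>x. frechet_derivative f (at x) v)"
  unfolding smooth_on_def by (metis Ck_on.simps(2))

lemma smooth_on_imp_continuous_on: "smooth_on S f \<Longrightarrow> continuous_on S f"
  using smooth_onD[of S f 0] by simp

text \<open>The derivative is a polynomial in \<open>inverse\<close> itself, so the induction on k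
  closes.\<close>

lemma smooth_on_inverse_real: "smooth_on (- {0}) (inverse :: real \<Rightarrow> real)"
  unfolding smooth_on_def
proof
  fix k show "Ck_on k (- {0}) (inverse :: real \<Rightarrow> real)"
  proof (induction k)
    case 0 show ?case by (auto intro!: continuous_intros)
  next
    case (Suc k)
    show ?case
    proof (rule Ck_on_SucI)
      show "(inverse has_derivative (\<lambda>v. - v * (inverse x * inverse x))) (at x)" if "x \<in> - {0}" for x :: real
        using that by (auto intro!: derivative_eq_intros simp: power2_eq_square)
      show "Ck_on k (- {0}) (\<lambda>x::real. - v * (inverse x * inverse x))" for v
        by (intro Ck_on_bounded_bilinear[OF bounded_bilinear_mult] Suc Ck_on_const) auto
    qed auto
  qed
qed

lemma smooth_on_divide:
  fixes f g :: "'a::euclidean_space \<Rightarrow> real"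
  assumes "open S" "smooth_on S f" "smooth_on S g" "\<And>x. x \<in> S \<Longrightarrow> g x \<noteq> 0"
  shows "smooth_on S (\<lambda>x. f x / g x)"
proof -
  have "smooth_on S (\<lambda>x. inverse (g x))"
    by (rule smooth_on_compose[OF assms(1) _ assms(3) smooth_on_inverse_real]) (use assms in auto)
  from smooth_on_mult[OF assms(1,2) this] show ?thesis by (simp add: field_simps)
qed

lemma smooth_on_exp: "smooth_on UNIV (exp :: real \<Rightarrow> real)"
  unfolding smooth_on_def
proof
  fix k show "Ck_on k UNIV (exp :: real \<Rightarrow> real)"
  proof (induction k)
    case 0 show ?case by (auto intro!: continuous_intros)
  next
    case (Suc k)
    show ?case
    proof (rule Ck_on_SucI)
      show "(exp has_derivative (\<lambda>v. v * exp x)) (at x)" for x :: real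
        by (auto intro!: derivative_eq_intros)
      show "Ck_on k UNIV (\<lambda>x::real. v * exp x)" for v
        by (intro Ck_on_bounded_bilinear[OF bounded_bilinear_mult] Suc Ck_on_const) auto
    qed auto
  qed
qed

subsection \<open>Cutoff functions\<close>

text \<open>The function exp(-1/x) / x^m for x > 0, extended by 0. The exponent m is carried along
  because differentiation leaves m = 0 but stays within linear combinations of this family.\<close>

definition flat_exp :: "nat \<Rightarrow> real \<Rightarrow> real" where
  "flat_exp m x = (if x > 0 then exp (- inverse x) * inverse x ^ m else 0)"

text \<open>Keeping only the term of index m + 2 in the series of exp(1/x) gives x^-(m+2) <= (m+2)!
  exp(1/x). A quadratic bound is chosen since it makes the difference quotient at 0 tend to
  0.\<close>

lemma flat_exp_le: "\<bar>flat_exp m x\<bar> \<le> fact (m + 2) * x\<^sup>2"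
proof (cases "x > 0")
  case True
  have "(\<Sum>n\<in>{m+2}. inverse x ^ n /\<^sub>R fact n) \<le> (\<Sum>n. inverse x ^ n /\<^sub>R fact n)"
    by (rule sum_le_suminf[OF summable_exp_generic]) (use True in auto)
  then have "inverse x ^ (m + 2) /\<^sub>R fact (m + 2) \<le> exp (inverse x)"
    by (simp add: exp_def del: fact_Suc power_Suc)
  then have "inverse x ^ (m + 2) \<le> fact (m + 2) * exp (inverse x)"
    by (simp add: divide_inverse_commute[symmetric] pos_divide_le_eq mult.commute del: fact_Suc power_Suc)
  then have "inverse x ^ (m + 2) * exp (- inverse x) \<le> fact (m + 2) * exp (inverse x) * exp (- inverse x)"
    by (rule mult_right_mono) simp
  also have "\<dots> = fact (m + 2)" by (simp add: mult.assoc exp_add[symmetric] del: fact_Suc)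
  finally have "inverse x ^ m * inverse x ^ 2 * exp (- inverse x) \<le> fact (m + 2)"
    by (simp only: power_add)
  then have "inverse x ^ m * inverse x ^ 2 * exp (- inverse x) * x\<^sup>2 \<le> fact (m + 2) * x\<^sup>2"
    by (rule mult_right_mono) simp
  moreover have "inverse x ^ m * inverse x ^ 2 * exp (- inverse x) * x\<^sup>2 = inverse x ^ m * exp (- inverse x)"
    using True by (simp add: field_simps)
  ultimately have "inverse x ^ m * exp (- inverse x) \<le> fact (m + 2) * x\<^sup>2" by simp
  then show ?thesis using True by (simp add: flat_exp_def mult.commute)
qed (simp add: flat_exp_def)

lemma flat_exp_has_derivative:
  "(flat_exp m has_derivative (\<lambda>v. v * (flat_exp (m + 2) x - of_nat m * flat_exp (m + 1) x))) (at x)"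
proof -
  consider "x > 0" | "x < 0" | "x = 0" by linarith
  then show ?thesis
  proof cases
    case 1
    have "((\<lambda>x. exp (- inverse x) * inverse x ^ m) has_derivative
       (\<lambda>v. v * (flat_exp (m + 2) x - of_nat m * flat_exp (m + 1) x))) (at x)"
      using 1 by (auto intro!: derivative_eq_intros ext simp: flat_exp_def)
        (cases m; simp add: algebra_simps power2_eq_square)
    then show ?thesis
      by (rule has_derivative_transform_within_open[OF _ open_greaterThan]) (use 1 in \<open>auto simp: flat_exp_def\<close>)
  next
    case 2
    have "((\<lambda>x. 0) has_derivative (\<lambda>v. v * (flat_exp (m + 2) x - of_nat m * flat_exp (m + 1) x))) (at x)"
      using 2 by (simp add: flat_exp_def)
    then show ?thesis
      by (rule has_derivative_transform_within_open[OF _ open_lessThan]) (use 2 in \<open>auto simp: flat_exp_def\<close>)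
  next
    case 3
    have "((\<lambda>h. flat_exp m h / h) \<longlongrightarrow> 0) (at 0)"
    proof (rule Lim_null_comparison)
      have "norm (flat_exp m h / h) \<le> fact (m + 2) * \<bar>h\<bar>" for h
      proof (cases "h = 0")
        case False
        have "norm (flat_exp m h / h) = \<bar>flat_exp m h\<bar> / \<bar>h\<bar>" by simp
        also have "\<dots> \<le> fact (m + 2) * h\<^sup>2 / \<bar>h\<bar>" by (rule divide_right_mono[OF flat_exp_le]) simp
        also have "\<dots> = fact (m + 2) * (h\<^sup>2 / \<bar>h\<bar>)" by simp
        also have "h\<^sup>2 / \<bar>h\<bar> = \<bar>h\<bar>" using False by (cases "h > 0") (auto simp: power2_eq_square)
        finally show ?thesis .
      qed simp
      then show "\<forall>\<^sub>F h in at 0. norm (flat_exp m h / h) \<le> fact (m + 2) * \<bar>h\<bar>" by simp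
      show "((\<lambda>h. fact (m + 2) * \<bar>h\<bar>) \<longlongrightarrow> (0::real)) (at 0)"
        by (auto intro!: tendsto_eq_intros)
    qed
    then have "(flat_exp m has_real_derivative 0) (at 0)"
      by (simp add: has_field_derivative_iff flat_exp_def)
    moreover have "(*) (0::real) = (\<lambda>v. 0)" by auto
    ultimately show ?thesis using 3 by (simp add: has_field_derivative_def flat_exp_def)
  qed
qed

lemma smooth_on_flat_exp: "smooth_on UNIV (flat_exp m)"
  unfolding smooth_on_def
proof
  fix k show "Ck_on k UNIV (flat_exp m)"
  proof (induction k arbitrary: m)
    case 0
    show ?case
      by (auto intro!: continuous_at_imp_continuous_on has_derivative_continuous flat_exp_has_derivative)
  next
    case (Suc k)
    have c: "Ck_on k UNIV (\<lambda>x::real. c * f x)" if "Ck_on k UNIV f" for f and c :: real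
      by (rule Ck_on_bounded_linear[OF bounded_linear_mult_right _ that]) auto
    have "Ck_on k UNIV (\<lambda>x. v * (flat_exp (m + 2) x - of_nat m * flat_exp (m + 1) x))" for v
      using c[OF Ck_on_add[OF _ Suc.IH c[OF Suc.IH]], of v "m + 2" "- of_nat m" "m + 1"] by simp
    then show ?case
      by (intro Ck_on_SucI[OF open_UNIV flat_exp_has_derivative])
  qed
qed

definition cutoff :: "real \<Rightarrow> real" where
  "cutoff x = flat_exp 0 x / (flat_exp 0 x + flat_exp 0 (1 - x))"

lemma cutoff_denominator: "flat_exp 0 x + flat_exp 0 (1 - x) > 0"
  by (cases "x > 0"; cases "x < 1") (auto simp: flat_exp_def add_pos_pos)

lemma cutoff_bounds: "0 \<le> cutoff x" "x \<le> 0 \<Longrightarrow> cutoff x = 0" "x \<ge> 1 \<Longrightarrow> cutoff x = 1"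
  using cutoff_denominator[of x] by (auto simp: cutoff_def flat_exp_def)

lemma smooth_on_cutoff: "smooth_on UNIV cutoff"
  unfolding cutoff_def
proof (rule smooth_on_divide)
  have *: "smooth_on UNIV (\<lambda>x. flat_exp 0 (1 - x))"
    by (rule smooth_on_compose[OF _ _ _ smooth_on_flat_exp]) (auto intro!: smooth_on_diff smooth_on_id)
  show "smooth_on UNIV (\<lambda>x. flat_exp 0 x + flat_exp 0 (1 - x))"
    by (rule smooth_on_add[OF _ smooth_on_flat_exp *]) simp
qed (use cutoff_denominator in \<open>auto simp: smooth_on_flat_exp less_imp_neq[THEN not_sym]\<close>)

lemma bump_function_exists:
  fixes a :: "'a::euclidean_space"
  assumes "r > 0"
  shows "\<exists>b. smooth_on UNIV b \<and> (\<forall>x. 0 \<le> b x) \<and> (\<forall>x\<in>ball a r. b x = 1) \<and>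
    (\<forall>x. x \<notin> cball a (2 * r) \<longrightarrow> b x = (0::real))"
proof -
  \<comment> \<open>Scaled so that the argument of \<open>cutoff\<close> is 1 on the sphere of
    radius r, as (4 r^2 - r^2) / (3 r^2) = 1, and 0 on the sphere of radius 2 r. The squared norm
    keeps the function smooth at the centre.\<close>
  let ?b = "\<lambda>x::'a. cutoff ((4 * r\<^sup>2 - (x - a) \<bullet> (x - a)) * inverse (3 * r\<^sup>2))"
  have b1: "smooth_on UNIV ?b"
    by (rule smooth_on_compose[OF _ _ _ smooth_on_cutoff]) (intro smooth_on_intros open_UNIV UNIV_I)+
  have b2: "0 \<le> ?b x" for x by (rule cutoff_bounds)
  have b3: "?b x = 1" if "x \<in> ball a r" for x
  proof (rule cutoff_bounds(3))
    have "norm (x - a) < r" using that by (simp add: dist_norm norm_minus_commute)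
    then have "(norm (x - a))\<^sup>2 \<le> r\<^sup>2" by (intro power_mono) auto
    then show "1 \<le> (4 * r\<^sup>2 - (x - a) \<bullet> (x - a)) * inverse (3 * r\<^sup>2)"
      using assms by (simp add: power2_norm_eq_inner field_simps)
  qed
  have b4: "?b x = 0" if "x \<notin> cball a (2 * r)" for x
  proof (rule cutoff_bounds(2))
    have "norm (x - a) > 2 * r" using that by (simp add: dist_norm norm_minus_commute)
    then have "(norm (x - a))\<^sup>2 \<ge> (2 * r)\<^sup>2" using assms by (intro power_mono) auto
    then show "(4 * r\<^sup>2 - (x - a) \<bullet> (x - a)) * inverse (3 * r\<^sup>2) \<le> 0"
      using assms by (simp add: power2_norm_eq_inner mult_nonpos_nonneg)
  qed
  show ?thesis using b1 b2 b3 b4 by (intro exI[of _ ?b] conjI allI ballI impI)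
qed

subsection \<open>Parametric integrals and Hadamard's lemma\<close>

text \<open>Differentiating under the integral sign yields an integral of the same shape, with F
  replaced by its derivative in the direction (0, v); hence the induction on k with F
  arbitrary.\<close>

lemma smooth_on_integral:
  fixes F :: "real \<times> 'a::euclidean_space \<Rightarrow> real"
  assumes "open V" "open U" "{0..1} \<times> U \<subseteq> V" "smooth_on V F"
  shows "smooth_on U (\<lambda>z. integral {0..1} (\<lambda>s. F (s, z)))"
  unfolding smooth_on_def
proof
  fix k show "Ck_on k U (\<lambda>z. integral {0..1} (\<lambda>s. F (s, z)))"
    using assms(4)
  proof (induction k arbitrary: F)
    case 0
    have "continuous_on (U \<times> cbox 0 1) (\<lambda>(z, s). F (s, z))"
      unfolding case_prod_unfold
      by (rule continuous_on_compose2[OF smooth_on_imp_continuous_on[OF 0]])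
        (use assms(3) in \<open>auto intro!: continuous_intros\<close>)
    from integral_continuous_on_param[OF this] show ?case by simp
  next
    case (Suc k)
    define D where "D z s v = frechet_derivative F (at (s, z)) (0, v)" for z s v
    have dF: "(F has_derivative frechet_derivative F (at (s, z))) (at (s, z))"
      if "z \<in> U" "s \<in> {0..1}" for s z
      by (rule smooth_on_has_derivative[OF Suc.prems]) (use assms(3) that in auto)
    have bl: "bounded_linear (D z s)" if "z \<in> U" "s \<in> {0..1}" for s z
      unfolding D_def
      by (intro bounded_linear_compose[OF has_derivative_bounded_linear[OF dF[OF that]]]
          bounded_linear_Pair bounded_linear_zero bounded_linear_ident)
    have dD: "((\<lambda>z. F (s, z)) has_derivative D z s) (at z)" if "z \<in> U" "s \<in> {0..1}" for s z
      unfolding D_def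
      by (rule has_derivative_compose[where g=F and f="\<lambda>z. (s, z)", OF _ dF[OF that]]) (auto intro!: derivative_eq_intros)
    have contF: "continuous_on {0..1} (\<lambda>s. F (s, z))" if "z \<in> U" for z
      by (rule continuous_on_compose2[OF smooth_on_imp_continuous_on[OF Suc.prems]])
        (use assms(3) that in \<open>auto intro!: continuous_intros\<close>)
    have contD: "continuous_on (U \<times> {0..1}) (\<lambda>(z, s). D z s v)" for v
      unfolding D_def case_prod_unfold
      by (rule continuous_on_compose2[OF smooth_on_imp_continuous_on[OF smooth_on_frechet_derivative[OF Suc.prems]]])
        (use assms(3) in \<open>auto intro!: continuous_intros\<close>)
    \<comment> \<open>The rule \<open>leibniz_rule\<close> asks for a derivative that is continuous
      in operator norm. In finite dimension this can be checked on basis vectors.\<close>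
    define B where "B z s = Blinfun (D z s)" for z s
    have B: "blinfun_apply (B z s) = D z s" if "z \<in> U" "s \<in> {0..1}" for s z
      unfolding B_def by (rule bounded_linear_Blinfun_apply[OF bl[OF that]])
    have contB: "continuous_on (U \<times> {0..1}) (\<lambda>(z, s). B z s)"
    proof (rule continuous_on_blinfun_componentwise)
      fix i :: 'a
      show "continuous_on (U \<times> {0..1}) (\<lambda>x. blinfun_apply (case x of (z, s) \<Rightarrow> B z s) i)"
        using contD[of i] by (rule continuous_on_eq) (auto simp: B)
    qed
    show ?case
    proof (rule Ck_on_SucI[OF assms(2)])
      fix z assume z: "z \<in> U"
      obtain e where e: "e > 0" "ball z e \<subseteq> U" using assms(2) z openE by blast
      have "((\<lambda>z. integral (cbox 0 1) (\<lambda>s. F (s, z))) has_derivative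
          blinfun_apply (integral (cbox 0 1) (B z))) (at z within ball z e)"
      proof (rule leibniz_rule)
        show "((\<lambda>x. F (t, x)) has_derivative blinfun_apply (B x t)) (at x within ball z e)"
          if "x \<in> ball z e" "t \<in> cbox 0 1" for x t
        proof (rule has_derivative_at_withinI)
          have "x \<in> U" "t \<in> {0..1}" using that e by auto
          then show "((\<lambda>x. F (t, x)) has_derivative blinfun_apply (B x t)) (at x)"
            using dD B by simp
        qed
        show "(\<lambda>s. F (s, x)) integrable_on cbox 0 1" if "x \<in> ball z e" for x
          using that e contF[of x] by (auto intro!: integrable_continuous_real)
        show "continuous_on (ball z e \<times> cbox 0 1) (\<lambda>(x, t). B x t)"
          by (rule continuous_on_subset[OF contB]) (use e in auto)
      qed (use e in auto)
      then have d: "((\<lambda>z. integral {0..1} (\<lambda>s. F (s, z))) has_derivative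
          blinfun_apply (integral {0..1} (B z))) (at z)"
        using at_within_open[of z "ball z e"] e(1) by (simp only: box_real centre_in_ball open_ball)
      have "continuous_on {0..1} (\<lambda>s. case (z, s) of (z, s) \<Rightarrow> B z s)"
        by (rule continuous_on_compose2[OF contB]) (use z in \<open>auto intro!: continuous_intros\<close>)
      then have intB: "B z integrable_on {0..1}" by (intro integrable_continuous_real) simp
      have "blinfun_apply (integral {0..1} (B z)) v = integral {0..1} (\<lambda>s. D z s v)" for v
      proof -
        have "integral {0..1} (\<lambda>s. D z s v) = integral {0..1} (\<lambda>s. blinfun_apply (B z s) v)"
          by (rule integral_cong) (simp add: B[OF z])
        then show ?thesis
          using integral_linear[OF intB blinfun.bounded_linear_left, of v] by (simp only: o_def)
      qed
      then have "blinfun_apply (integral {0..1} (B z)) = (\<lambda>v. integral {0..1} (\<lambda>s. D z s v))" by auto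
      with d show "((\<lambda>z. integral {0..1} (\<lambda>s. F (s, z))) has_derivative
          (\<lambda>v. integral {0..1} (\<lambda>s. D z s v))) (at z)" by simp
    next
      show "Ck_on k U (\<lambda>z. integral {0..1} (\<lambda>s. D z s v))" for v
        unfolding D_def
        by (rule Suc.IH[of "\<lambda>y. frechet_derivative F (at y) (0, v)"])
          (rule smooth_on_frechet_derivative[OF Suc.prems])
    qed
  qed
qed

lemma segment_integral:
  fixes f :: "'a::euclidean_space \<Rightarrow> real"
  assumes "smooth_on V f" "\<And>s. s \<in> {0..1} \<Longrightarrow> p + s *\<^sub>R d \<in> V"
  shows "f (p + d) - f p = integral {0..1} (\<lambda>s. frechet_derivative f (at (p + s *\<^sub>R d)) d)"
proof -
  have "((\<lambda>s. frechet_derivative f (at (p + s *\<^sub>R d)) d) has_integral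
      (f (p + 1 *\<^sub>R d) - f (p + 0 *\<^sub>R d))) {0..1}"
  proof (rule fundamental_theorem_of_calculus)
    fix s :: real assume s: "s \<in> {0..1}"
    have df: "(f has_derivative frechet_derivative f (at (p + s *\<^sub>R d))) (at (p + s *\<^sub>R d))"
      by (rule smooth_on_has_derivative[OF assms(1) assms(2)[OF s]])
    have "((\<lambda>s. f (p + s *\<^sub>R d)) has_derivative (\<lambda>h. frechet_derivative f (at (p + s *\<^sub>R d)) (h *\<^sub>R d))) (at s)"
      by (rule has_derivative_compose[where g=f and f="\<lambda>s. p + s *\<^sub>R d", OF _ df]) (auto intro!: derivative_eq_intros)
    then show "((\<lambda>s. f (p + s *\<^sub>R d)) has_vector_derivative frechet_derivative f (at (p + s *\<^sub>R d)) d)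
        (at s within {0..1})"
      unfolding has_vector_derivative_def
      using linear_cmul[OF has_derivative_linear[OF df]]
      by (auto intro: has_derivative_at_withinI)
  qed simp
  then show ?thesis by (simp add: integral_unique)
qed

text \<open>The fundamental theorem along the segment from a to x, with \<open>g b x\<close> the
  integral of the partial derivative over that segment. This is what forces every derivation to be a
  combination of partial derivatives.\<close>

lemma Hadamard_space:
  fixes f :: "'a::euclidean_space \<Rightarrow> real"
  assumes "smooth_on (ball a r) f" "r > 0"
  obtains g where "\<And>b. smooth_on (ball a r) (g b)"
    "\<And>x. x \<in> ball a r \<Longrightarrow> f x = f a + (\<Sum>b\<in>Basis. ((x - a) \<bullet> b) * g b x)"
    "\<And>b. g b a = frechet_derivative f (at a) b"
proof
  let ?m = "\<lambda>y::real \<times> 'a. a + fst y *\<^sub>R (snd y - a)"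
  let ?g = "\<lambda>b x. integral {0..1} (\<lambda>s. frechet_derivative f (at (?m (s, x))) b)"
  have m: "smooth_on UNIV ?m" by (auto intro!: smooth_on_intros)
  have oV: "open (?m -` ball a r)"
    by (rule open_vimage[OF open_ball]) (rule smooth_on_imp_continuous_on[OF m])
  have inb: "a + s *\<^sub>R (x - a) \<in> ball a r" if "x \<in> ball a r" "s \<in> {0..1}" for s x
  proof -
    have "\<bar>s\<bar> * norm (x - a) \<le> 1 * norm (x - a)" using that by (intro mult_right_mono) auto
    then show ?thesis using that by (simp add: dist_norm norm_minus_commute)
  qed
  show "smooth_on (ball a r) (?g b)" for b
  proof (rule smooth_on_integral[OF oV])
    show "smooth_on (?m -` ball a r) (\<lambda>y. frechet_derivative f (at (?m y)) b)"
      by (rule smooth_on_compose[OF oV open_ball smooth_on_subset[OF m] smooth_on_frechet_derivative[OF assms(1)]]) auto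
  qed (use inb in auto)
  show "f x = f a + (\<Sum>b\<in>Basis. ((x - a) \<bullet> b) * ?g b x)" if x: "x \<in> ball a r" for x
  proof -
    have "f x - f a = integral {0..1} (\<lambda>s. frechet_derivative f (at (?m (s, x))) (x - a))"
      using segment_integral[OF assms(1), of a "x - a"] inb[OF x] by simp
    also have "\<dots> = integral {0..1} (\<lambda>s. \<Sum>b\<in>Basis. ((x - a) \<bullet> b) * frechet_derivative f (at (?m (s, x))) b)"
    proof (rule integral_cong)
      fix s :: real assume "s \<in> {0..1}"
      then have l: "linear (frechet_derivative f (at (?m (s, x))))"
        using has_derivative_linear[OF smooth_on_has_derivative[OF assms(1) inb[OF x]]] by simp
      show "frechet_derivative f (at (?m (s, x))) (x - a)
          = (\<Sum>b\<in>Basis. ((x - a) \<bullet> b) * frechet_derivative f (at (?m (s, x))) b)"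
        using arg_cong[OF euclidean_representation[of "x - a", symmetric],
            of "frechet_derivative f (at (?m (s, x)))"]
        by (simp only: linear_sum[OF l] linear_cmul[OF l] real_scaleR_def)
    qed
    also have "\<dots> = (\<Sum>b\<in>Basis. ((x - a) \<bullet> b) * ?g b x)"
    proof (subst integral_sum)
      show "(\<lambda>s. ((x - a) \<bullet> b) * frechet_derivative f (at (?m (s, x))) b) integrable_on {0..1}" for b
        by (intro integrable_continuous_real continuous_intros
            continuous_on_compose2[OF smooth_on_imp_continuous_on[OF smooth_on_frechet_derivative[OF assms(1)]]])
          (use inb[OF x] in auto)
    qed auto
    finally show ?thesis by simp
  qed
  show "?g b a = frechet_derivative f (at a) b" for b by simp
qed

text \<open>The value at t = 0 is filled in with the derivative, so that the quotient of a smooth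
  family is again a smooth family. The expansions of isotopies in time rest on the exact identity
  h(t) = h(0) + t H(t) with this H.\<close>

definition time_quotient :: "(real \<Rightarrow> real) \<Rightarrow> real \<Rightarrow> real" where
  "time_quotient h t = (if t = 0 then deriv h 0 else (h t - h 0) / t)"

lemma time_quotient: "h t = h 0 + t * time_quotient h t"
  by (simp add: time_quotient_def)

text \<open>The quotient is the integral over s in [0,1] of the time derivative at (s t, x), a
  formula that is smooth across t = 0. Time runs in a ball around 0 because such a ball is closed
  under scaling by s.\<close>

lemma smooth_on_time_quotient:
  fixes h :: "real \<times> 'a::euclidean_space \<Rightarrow> real"
  assumes "smooth_on (ball 0 e \<times> W) h" "open W"
  shows "smooth_on (ball 0 e \<times> W) (\<lambda>(t, x). time_quotient (\<lambda>t. h (t, x)) t)"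
proof -
  let ?V = "ball 0 e \<times> W"
  let ?m = "\<lambda>y::real \<times> real \<times> 'a. (fst y * fst (snd y), snd (snd y))"
  let ?D = "\<lambda>y. frechet_derivative h (at y) (1, 0)"
  have m: "smooth_on UNIV ?m" by (intro smooth_on_intros open_UNIV)
  have oW: "open ?V" by (rule open_Times[OF open_ball assms(2)])
  have oV: "open (?m -` ?V)"
    by (rule open_vimage[OF oW]) (rule smooth_on_imp_continuous_on[OF m])
  have inb: "(s * t, x) \<in> ?V" if "(t, x) \<in> ?V" "s \<in> {0..1}" for s t :: real and x
  proof -
    have "\<bar>s\<bar> * \<bar>t\<bar> \<le> 1 * \<bar>t\<bar>" using that by (intro mult_right_mono) auto
    then show ?thesis using that by (simp add: abs_mult)
  qed
  have "smooth_on ?V (\<lambda>z. integral {0..1} (\<lambda>s. ?D (?m (s, z))))"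
  proof (rule smooth_on_integral[OF oV])
    show "smooth_on (?m -` ?V) (\<lambda>y. ?D (?m y))"
      by (rule smooth_on_compose[OF oV oW smooth_on_subset[OF m] smooth_on_frechet_derivative[OF assms(1)]]) auto
    show "{0..1} \<times> ?V \<subseteq> ?m -` ?V"
    proof
      fix y :: "real \<times> real \<times> 'a" assume "y \<in> {0..1} \<times> ?V"
      then show "y \<in> ?m -` ?V"
        using inb[of "fst (snd y)" "snd (snd y)" "fst y"] by (auto simp only: mem_Times_iff vimage_eq fst_conv snd_conv)
    qed
  qed (rule oW)
  moreover have "integral {0..1} (\<lambda>s. ?D (?m (s, z))) = (case z of (t, x) \<Rightarrow> time_quotient (\<lambda>t. h (t, x)) t)"
    if z: "z \<in> ?V" for z
  proof -
    obtain t x where tx: "z = (t, x)" by (cases z)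
    have seg: "(0, x) + s *\<^sub>R (t, 0) \<in> ?V" if "s \<in> {0..1}" for s
      using inb[of t x s] z that tx by (simp add: mult.commute)
    have lin: "linear (frechet_derivative h (at (s * t, x)))" if "s \<in> {0..1}" for s
      using has_derivative_linear[OF smooth_on_has_derivative[OF assms(1) inb]] z tx that by auto
    have "h ((0, x) + (t, 0)) - h (0, x)
        = integral {0..1} (\<lambda>s. frechet_derivative h (at ((0, x) + s *\<^sub>R (t, 0))) (t, 0))"
      by (rule segment_integral[OF assms(1) seg])
    also have "\<dots> = integral {0..1} (\<lambda>s. t * ?D (?m (s, z)))"
    proof (rule integral_cong)
      fix s :: real assume s: "s \<in> {0..1}"
      show "frechet_derivative h (at ((0, x) + s *\<^sub>R (t, 0))) (t, 0) = t * ?D (?m (s, z))"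
        using linear_cmul[OF lin[OF s], of t "(1, 0)"] tx by simp
    qed
    finally have eq: "h (t, x) - h (0, x) = t * integral {0..1} (\<lambda>s. ?D (?m (s, z)))" by simp
    show ?thesis
    proof (cases "t = 0")
      case True
      have "(h has_derivative frechet_derivative h (at (0, x))) (at (0, x))"
        by (rule smooth_on_has_derivative[OF assms(1)]) (use z tx True in auto)
      then have "((\<lambda>t. h (t, x)) has_derivative (\<lambda>v. frechet_derivative h (at (0, x)) (v, 0))) (at 0)"
        by (rule has_derivative_compose[where g=h and f="\<lambda>t. (t, x)", rotated]) (auto intro!: derivative_eq_intros)
      moreover have "(\<lambda>v. frechet_derivative h (at (0, x)) (v, 0)) = (*) (?D (0, x))"
      proof
        show "frechet_derivative h (at (0, x)) (v, 0) = ?D (0, x) * v" for v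
          using linear_cmul[OF lin[of 0], of v "(1, 0)"] by simp
      qed
      ultimately have "((\<lambda>t. h (t, x)) has_real_derivative ?D (0, x)) (at 0)"
        by (simp only: has_field_derivative_def)
      then have "deriv (\<lambda>t. h (t, x)) 0 = ?D (0, x)" by (rule DERIV_imp_deriv)
      then show ?thesis using True tx by (simp add: time_quotient_def)
    next
      case False
      then show ?thesis using eq tx by (simp add: time_quotient_def)
    qed
  qed
  ultimately show ?thesis by (rule smooth_on_cong[OF oW, rotated])
qed

section \<open>Smooth functions and families on a manifold\<close>

text \<open>Families are uncurried, as functions of (time, point); a single smooth function counts as a family
  constant in time.\<close>

definition fam_on :: "('a, 'n::finite) atlas \<Rightarrow> (real \<times> 'a) set \<Rightarrow> (real \<times> 'a \<Rightarrow> real) \<Rightarrow> bool" where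
  "fam_on A W g \<longleftrightarrow> (\<forall>(U, \<phi>)\<in>A.
     smooth_on {(t, x). x \<in> \<phi> ` U \<and> (t, inv_into U \<phi> x) \<in> W} (\<lambda>(t, x). g (t, inv_into U \<phi> x)))"

locale manifold =
  fixes A :: "('a::t2_space, 'n::finite) atlas"
  assumes atlas: "smooth_atlas A"
begin

lemma chart:
  assumes "(U, \<phi>) \<in> A"
  shows "open U" "open (\<phi> ` U)" "inj_on \<phi> U" "continuous_on U \<phi>" "continuous_on (\<phi> ` U) (inv_into U \<phi>)"
proof -
  have "is_chart U \<phi>" using assms atlas by (auto simp: smooth_atlas_def)
  then obtain \<theta> where o: "open U" "open (\<phi> ` U)" and h: "homeomorphism U (\<phi> ` U) \<phi> \<theta>"
    by (auto simp: is_chart_def)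
  have inj: "inj_on \<phi> U" by (rule inj_on_inverseI[of _ \<theta>]) (use h in \<open>auto simp: homeomorphism_def\<close>)
  have "\<theta> y = inv_into U \<phi> y" if "y \<in> \<phi> ` U" for y
    using h inj that by (auto simp: homeomorphism_def)
  then have "continuous_on (\<phi> ` U) (inv_into U \<phi>)"
    using h continuous_on_eq by (fastforce simp: homeomorphism_def)
  then show "open U" "open (\<phi> ` U)" "inj_on \<phi> U" "continuous_on U \<phi>" "continuous_on (\<phi> ` U) (inv_into U \<phi>)"
    using o inj h by (auto simp: homeomorphism_def)
qed

lemma chart_inv: "(U, \<phi>) \<in> A \<Longrightarrow> q \<in> U \<Longrightarrow> inv_into U \<phi> (\<phi> q) = q"
  using chart(3) by simp

lemma chart_inv_mem: "x \<in> \<phi> ` U \<Longrightarrow> inv_into U \<phi> x \<in> U"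
  by (rule inv_into_into)

lemma chart_at: obtains U \<phi> where "(U, \<phi>) \<in> A" "p \<in> U"
proof -
  have "p \<in> (\<Union>(U, \<phi>)\<in>A. U)" using atlas by (simp add: smooth_atlas_def)
  then show ?thesis using that by auto
qed

lemma open_chart_image:
  assumes "(U, \<phi>) \<in> A" "open W" shows "open (\<phi> ` (U \<inter> W))"
proof -
  have "\<phi> ` (U \<inter> W) = \<phi> ` U \<inter> inv_into U \<phi> -` W"
    using chart_inv[OF assms(1)] by force
  then show ?thesis
    using continuous_open_preimage[OF chart(5)[OF assms(1)] chart(2)[OF assms(1)] assms(2)] by simp
qed

lemma smooth_on_transition:
  "(U, \<phi>) \<in> A \<Longrightarrow> (V, \<psi>) \<in> A \<Longrightarrow> smooth_on (\<phi> ` (U \<inter> V)) (\<lambda>x. \<psi> (inv_into U \<phi> x))"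
  using atlas unfolding smooth_atlas_def transition_def by fastforce

lemma open_chart_dom:
  assumes "(U, \<phi>) \<in> A" "open W"
  shows "open {(t::real, x). x \<in> \<phi> ` U \<and> (t, inv_into U \<phi> x) \<in> W}"
proof -
  have "continuous_on (UNIV \<times> \<phi> ` U) (\<lambda>z. (fst z :: real, inv_into U \<phi> (snd z)))"
    by (intro continuous_intros continuous_on_compose2[OF chart(5)[OF assms(1)]]) auto
  then have "open ((UNIV \<times> \<phi> ` U) \<inter> (\<lambda>z. (fst z :: real, inv_into U \<phi> (snd z))) -` W)"
    by (rule continuous_open_preimage) (use assms chart(2) in \<open>auto intro: open_Times\<close>)
  moreover have "{(t::real, x). x \<in> \<phi> ` U \<and> (t, inv_into U \<phi> x) \<in> W}
      = (UNIV \<times> \<phi> ` U) \<inter> (\<lambda>z. (fst z, inv_into U \<phi> (snd z))) -` W" by auto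
  ultimately show ?thesis by simp
qed

lemma fam_onD:
  "fam_on A W g \<Longrightarrow> (U, \<phi>) \<in> A \<Longrightarrow>
    smooth_on {(t, x). x \<in> \<phi> ` U \<and> (t, inv_into U \<phi> x) \<in> W} (\<lambda>(t, x). g (t, inv_into U \<phi> x))"
  by (auto simp: fam_on_def)

text \<open>One chart around each point is enough: any other chart expression is the given one
  composed with a transition map.\<close>

lemma fam_onI:
  assumes "\<And>t0 q0. (t0, q0) \<in> W \<Longrightarrow> \<exists>U \<phi> N. (U, \<phi>) \<in> A \<and> q0 \<in> U \<and> open N \<and> (t0, \<phi> q0) \<in> N \<and>
     N \<subseteq> UNIV \<times> \<phi> ` U \<and> smooth_on N (\<lambda>(t, x). g (t, inv_into U \<phi> x))"
  shows "fam_on A W g"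
  unfolding fam_on_def
proof clarify
  fix V \<psi> assume V: "(V, \<psi>) \<in> A"
  show "smooth_on {(t, x). x \<in> \<psi> ` V \<and> (t, inv_into V \<psi> x) \<in> W} (\<lambda>(t, x). g (t, inv_into V \<psi> x))"
  proof (rule smooth_on_local, clarify)
    fix t0 q0 assume q0: "q0 \<in> V" "(t0, inv_into V \<psi> (\<psi> q0)) \<in> W"
    then have "(t0, q0) \<in> W" using chart_inv[OF V] by simp
    from assms[OF this] obtain U \<phi> N where U: "(U, \<phi>) \<in> A" "q0 \<in> U" and N: "open N" "(t0, \<phi> q0) \<in> N"
      "N \<subseteq> UNIV \<times> \<phi> ` U" "smooth_on N (\<lambda>(t, x). g (t, inv_into U \<phi> x))" by blast
    let ?D = "UNIV \<times> \<psi> ` (V \<inter> U)"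
    let ?m = "\<lambda>z. (fst z :: real, \<phi> (inv_into V \<psi> (snd z)))"
    have oD: "open (\<psi> ` (V \<inter> U))" by (rule open_chart_image[OF V chart(1)[OF U(1)]])
    have oD': "open (?D :: (real \<times> _) set)" by (rule open_Times[OF open_UNIV oD])
    have m: "smooth_on ?D ?m"
      by (intro smooth_on_Pair smooth_on_fst smooth_on_id oD'
          smooth_on_compose[OF oD' oD smooth_on_snd[OF oD' smooth_on_id[OF oD']] smooth_on_transition[OF V U(1)]]) auto
    let ?N = "?D \<inter> ?m -` N"
    have oN: "open ?N"
      by (rule continuous_open_preimage[OF smooth_on_imp_continuous_on[OF m] oD' N(1)])
    have "smooth_on ?N (\<lambda>z. (\<lambda>(t, x). g (t, inv_into U \<phi> x)) (?m z))"
      by (rule smooth_on_compose[OF oN N(1) smooth_on_subset[OF m] N(4)]) auto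
    then have "smooth_on ?N (\<lambda>(t, x). g (t, inv_into V \<psi> x))"
      by (rule smooth_on_cong[OF oN, rotated]) (auto simp: chart_inv[OF V] chart_inv[OF U(1)])
    moreover have "(t0, \<psi> q0) \<in> ?N" using q0 U N chart_inv[OF V] by auto
    ultimately show "\<exists>N. open N \<and> (t0, \<psi> q0) \<in> N \<and> smooth_on N (\<lambda>(t, x). g (t, inv_into V \<psi> x))"
      using oN by blast
  qed
qed

lemma fam_on_subset: "fam_on A W g \<Longrightarrow> V \<subseteq> W \<Longrightarrow> fam_on A V g"
  unfolding fam_on_def by (fastforce intro: smooth_on_subset)

lemma fam_on_cong:
  assumes "open W" "\<And>z. z \<in> W \<Longrightarrow> f z = g z" "fam_on A W f" shows "fam_on A W g"
  unfolding fam_on_def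
proof clarify
  fix U \<phi> assume U: "(U, \<phi>) \<in> A"
  show "smooth_on {(t, x). x \<in> \<phi> ` U \<and> (t, inv_into U \<phi> x) \<in> W} (\<lambda>(t, x). g (t, inv_into U \<phi> x))"
    by (rule smooth_on_cong[OF open_chart_dom[OF U assms(1)] _ fam_onD[OF assms(3) U]]) (use assms(2) in auto)
qed

lemma fam_on_local:
  assumes "\<And>z. z \<in> W \<Longrightarrow> \<exists>N. open N \<and> z \<in> N \<and> fam_on A N g" shows "fam_on A W g"
  unfolding fam_on_def
proof clarify
  fix U \<phi> assume U: "(U, \<phi>) \<in> A"
  show "smooth_on {(t, x). x \<in> \<phi> ` U \<and> (t, inv_into U \<phi> x) \<in> W} (\<lambda>(t, x). g (t, inv_into U \<phi> x))"
  proof (rule smooth_on_local)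
    fix z assume z: "z \<in> {(t, x). x \<in> \<phi> ` U \<and> (t, inv_into U \<phi> x) \<in> W}"
    then obtain t x where tx: "z = (t, x)" "x \<in> \<phi> ` U" "(t, inv_into U \<phi> x) \<in> W" by auto
    obtain N where N: "open N" "(t, inv_into U \<phi> x) \<in> N" "fam_on A N g" using assms[OF tx(3)] by blast
    show "\<exists>N. open N \<and> z \<in> N \<and> smooth_on N (\<lambda>(t, x). g (t, inv_into U \<phi> x))"
      using open_chart_dom[OF U N(1)] fam_onD[OF N(3) U] tx N(2) by blast
  qed
qed

lemma fam_on_const [simp, intro]: "fam_on A W (\<lambda>z. c)"
  by (auto simp: fam_on_def case_prod_unfold)

lemma fam_on_time:
  assumes "open W" "smooth_on J k" "open J" "\<And>t q. (t, q) \<in> W \<Longrightarrow> t \<in> J"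
  shows "fam_on A W (\<lambda>z. k (fst z))"
  unfolding fam_on_def
proof clarify
  fix U \<phi> assume U: "(U, \<phi>) \<in> A"
  note o = open_chart_dom[OF U assms(1)]
  show "smooth_on {(t, x). x \<in> \<phi> ` U \<and> (t, inv_into U \<phi> x) \<in> W} (\<lambda>(t, x). k (fst (t, inv_into U \<phi> x)))"
    unfolding case_prod_unfold fst_conv
    by (rule smooth_on_compose[OF o[unfolded case_prod_unfold] assms(3) smooth_on_fst assms(2)])
      (use assms(4) o in \<open>auto simp: case_prod_unfold intro!: smooth_on_id\<close>)
qed

lemma fam_on_add:
  assumes "open W" "fam_on A W f" "fam_on A W g"
  shows "fam_on A W (\<lambda>z. f z + g z)"
  unfolding fam_on_def
proof clarify
  fix U \<phi> assume U: "(U, \<phi>) \<in> A"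
  show "smooth_on {(t, x). x \<in> \<phi> ` U \<and> (t, inv_into U \<phi> x) \<in> W}
      (\<lambda>(t, x). f (t, inv_into U \<phi> x) + g (t, inv_into U \<phi> x))"
    using smooth_on_add[OF open_chart_dom[OF U assms(1)] fam_onD[OF assms(2) U] fam_onD[OF assms(3) U]]
    by (simp add: case_prod_unfold)
qed

lemma fam_on_mult:
  assumes "open W" "fam_on A W f" "fam_on A W g"
  shows "fam_on A W (\<lambda>z. f z * g z)"
  unfolding fam_on_def
proof clarify
  fix U \<phi> assume U: "(U, \<phi>) \<in> A"
  show "smooth_on {(t, x). x \<in> \<phi> ` U \<and> (t, inv_into U \<phi> x) \<in> W}
      (\<lambda>(t, x). f (t, inv_into U \<phi> x) * g (t, inv_into U \<phi> x))"
    using smooth_on_mult[OF open_chart_dom[OF U assms(1)] fam_onD[OF assms(2) U] fam_onD[OF assms(3) U]]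
    by (simp add: case_prod_unfold)
qed

lemma fam_on_diff:
  assumes "open W" "fam_on A W f" "fam_on A W g"
  shows "fam_on A W (\<lambda>z. f z - g z)"
  unfolding fam_on_def
proof clarify
  fix U \<phi> assume U: "(U, \<phi>) \<in> A"
  show "smooth_on {(t, x). x \<in> \<phi> ` U \<and> (t, inv_into U \<phi> x) \<in> W}
      (\<lambda>(t, x). f (t, inv_into U \<phi> x) - g (t, inv_into U \<phi> x))"
    using smooth_on_diff[OF open_chart_dom[OF U assms(1)] fam_onD[OF assms(2) U] fam_onD[OF assms(3) U]]
    by (simp add: case_prod_unfold)
qed

lemma fam_on_divide:
  assumes "open W" "fam_on A W f" "fam_on A W g" "\<And>z. z \<in> W \<Longrightarrow> g z \<noteq> 0"
  shows "fam_on A W (\<lambda>z. f z / g z)"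
  unfolding fam_on_def
proof clarify
  fix U \<phi> assume U: "(U, \<phi>) \<in> A"
  show "smooth_on {(t, x). x \<in> \<phi> ` U \<and> (t, inv_into U \<phi> x) \<in> W}
      (\<lambda>(t, x). f (t, inv_into U \<phi> x) / g (t, inv_into U \<phi> x))"
    using smooth_on_divide[OF open_chart_dom[OF U assms(1)] fam_onD[OF assms(2) U] fam_onD[OF assms(3) U]]
    assms(4) by (fastforce simp: case_prod_unfold)
qed

lemma fam_on_sum:
  assumes "open W" "\<And>i. i \<in> I \<Longrightarrow> fam_on A W (f i)" shows "fam_on A W (\<lambda>z. \<Sum>i\<in>I. f i z)"
  using assms(2) by (induction I rule: infinite_finite_induct) (auto intro: fam_on_add[OF assms(1)])

lemma fam_on_compose_real:
  assumes "open W" "fam_on A W g" "smooth_on S k" "open S" "\<And>z. z \<in> W \<Longrightarrow> g z \<in> S"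
  shows "fam_on A W (\<lambda>z. k (g z))"
  unfolding fam_on_def
proof clarify
  fix U \<phi> assume U: "(U, \<phi>) \<in> A"
  show "smooth_on {(t, x). x \<in> \<phi> ` U \<and> (t, inv_into U \<phi> x) \<in> W} (\<lambda>(t, x). k (g (t, inv_into U \<phi> x)))"
    using smooth_on_compose[OF open_chart_dom[OF U assms(1)] assms(4) fam_onD[OF assms(2) U] assms(3)] assms(5)
    by (fastforce simp: case_prod_unfold)
qed

lemma fam_on_chart:
  assumes "(U, \<phi>) \<in> A" "open N" "N \<subseteq> UNIV \<times> \<phi> ` U" "smooth_on N k"
  shows "fam_on A {(t, q). q \<in> U \<and> (t, \<phi> q) \<in> N} (\<lambda>(t, q). k (t, \<phi> q))"
proof (rule fam_onI)
  fix t0 q0 assume *: "(t0, q0) \<in> {(t, q). q \<in> U \<and> (t, \<phi> q) \<in> N}"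
  have "smooth_on N (\<lambda>(t, x). (\<lambda>(t, q). k (t, \<phi> q)) (t, inv_into U \<phi> x))"
    by (rule smooth_on_cong[OF assms(2) _ assms(4)]) (use assms(3) in \<open>auto simp: f_inv_into_f\<close>)
  then show "\<exists>V \<psi> M. (V, \<psi>) \<in> A \<and> q0 \<in> V \<and> open M \<and> (t0, \<psi> q0) \<in> M \<and> M \<subseteq> UNIV \<times> \<psi> ` V \<and>
      smooth_on M (\<lambda>(t, x). (\<lambda>(t, q). k (t, \<phi> q)) (t, inv_into V \<psi> x))"
    using * assms by blast
qed

lemma fam_on_continuous:
  assumes "open W" "fam_on A W g" shows "continuous_on W g"
proof (rule continuous_at_imp_continuous_on, rule ballI)
  fix z assume z: "z \<in> W"
  obtain U \<phi> where U: "(U, \<phi>) \<in> A" "snd z \<in> U" using chart_at by blast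
  let ?W = "W \<inter> (UNIV \<times> U)"
  have oW: "open ?W" using assms(1) chart(1)[OF U(1)] by (auto intro: open_Int open_Times)
  have "continuous_on ?W (\<lambda>z. (\<lambda>(t, x). g (t, inv_into U \<phi> x)) (fst z, \<phi> (snd z)))"
    by (rule continuous_on_compose2[OF smooth_on_imp_continuous_on[OF fam_onD[OF assms(2) U(1)]]])
      (auto intro!: continuous_intros continuous_on_compose2[OF chart(4)[OF U(1)]] simp: chart_inv[OF U(1)])
  then have "continuous_on ?W g"
    by (rule continuous_on_eq) (auto simp: chart_inv[OF U(1)])
  then show "isCont g z" using oW z U by (auto simp: continuous_on_eq_continuous_at mem_Times_iff)
qed

lemma smooth_fun_iff: "smooth_fun A f \<longleftrightarrow> fam_on A UNIV (\<lambda>z. f (snd z))"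
proof
  assume f: "smooth_fun A f"
  show "fam_on A UNIV (\<lambda>z. f (snd z))" unfolding fam_on_def
  proof clarify
    fix U \<phi> assume U: "(U, \<phi>) \<in> A"
    have o: "open (UNIV \<times> \<phi> ` U :: (real \<times> _) set)" using chart(2)[OF U] by (auto intro: open_Times)
    have "smooth_on (\<phi> ` U) (\<lambda>x. f (inv_into U \<phi> x))" using f U by (auto simp: smooth_fun_def)
    then have "smooth_on (UNIV \<times> \<phi> ` U :: (real \<times> _) set) (\<lambda>z. f (inv_into U \<phi> (snd z)))"
      by (intro smooth_on_compose[OF o chart(2)[OF U] smooth_on_snd[OF o smooth_on_id[OF o]]]) auto
    then show "smooth_on {(t::real, x). x \<in> \<phi> ` U \<and> (t, inv_into U \<phi> x) \<in> UNIV} (\<lambda>(t, x). f (snd (t, inv_into U \<phi> x)))"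
      unfolding case_prod_unfold snd_conv by (rule smooth_on_subset) auto
  qed
next
  assume f: "fam_on A UNIV (\<lambda>z. f (snd z))"
  show "smooth_fun A f" unfolding smooth_fun_def
  proof clarify
    fix U \<phi> assume U: "(U, \<phi>) \<in> A"
    note o = chart(2)[OF U]
    have "smooth_on (\<phi> ` U) (\<lambda>x. (\<lambda>(t::real, x). f (snd (t, inv_into U \<phi> x))) (0, x))"
      by (rule smooth_on_compose[OF o open_chart_dom[OF U open_UNIV] _ fam_onD[OF f U]])
        (use o in \<open>auto intro!: smooth_on_Pair smooth_on_id\<close>)
    then show "smooth_on (\<phi> ` U) (\<lambda>x. f (inv_into U \<phi> x))" by simp
  qed
qed

lemma fam_on_snd: "smooth_fun A f \<Longrightarrow> fam_on A W (\<lambda>z. f (snd z))"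
  using smooth_fun_iff fam_on_subset by blast

lemma fam_on_slice:
  assumes "open J" "fam_on A (J \<times> UNIV) g" "t \<in> J" shows "smooth_fun A (\<lambda>q. g (t, q))"
  unfolding smooth_fun_def
proof clarify
  fix U \<phi> assume U: "(U, \<phi>) \<in> A"
  note o = chart(2)[OF U]
  have "smooth_on (\<phi> ` U) (\<lambda>x. (\<lambda>(t, x). g (t, inv_into U \<phi> x)) (t, x))"
    by (rule smooth_on_compose[OF o open_chart_dom[OF U open_Times[OF assms(1) open_UNIV]] _ fam_onD[OF assms(2) U]])
      (use assms(3) o in \<open>auto intro!: smooth_on_Pair smooth_on_id\<close>)
  then show "smooth_on (\<phi> ` U) (\<lambda>x. g (t, inv_into U \<phi> x))" by simp
qed

lemma smooth_family_fun_iff: "smooth_family_fun A J g \<longleftrightarrow> fam_on A (J \<times> UNIV) (\<lambda>(t, q). g t q)"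
proof -
  have "{(t::real, x). x \<in> \<phi> ` U \<and> (t, inv_into U \<phi> x) \<in> J \<times> UNIV} = J \<times> \<phi> ` U" for U and \<phi> :: "'a \<Rightarrow> real^'n"
    by auto
  then show ?thesis by (simp add: smooth_family_fun_def fam_on_def)
qed

lemma smooth_fun_const [simp, intro]: "smooth_fun A (\<lambda>q. c)"
  by (simp add: smooth_fun_iff)

lemma smooth_fun_add: "smooth_fun A f \<Longrightarrow> smooth_fun A g \<Longrightarrow> smooth_fun A (\<lambda>q. f q + g q)"
  and smooth_fun_mult: "smooth_fun A f \<Longrightarrow> smooth_fun A g \<Longrightarrow> smooth_fun A (\<lambda>q. f q * g q)"
  and smooth_fun_diff: "smooth_fun A f \<Longrightarrow> smooth_fun A g \<Longrightarrow> smooth_fun A (\<lambda>q. f q - g q)"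
  and smooth_fun_divide:
    "smooth_fun A f \<Longrightarrow> smooth_fun A g \<Longrightarrow> (\<And>q. g q \<noteq> 0) \<Longrightarrow> smooth_fun A (\<lambda>q. f q / g q)"
  by (simp_all add: smooth_fun_iff fam_on_add fam_on_mult fam_on_diff fam_on_divide)

lemma smooth_fun_cmult: "smooth_fun A f \<Longrightarrow> smooth_fun A (\<lambda>q. c * f q)"
  by (rule smooth_fun_mult) auto

lemma smooth_fun_minus: "smooth_fun A f \<Longrightarrow> smooth_fun A (\<lambda>q. - f q)"
  using smooth_fun_cmult[of f "-1"] by simp

lemma smooth_fun_sum: "(\<And>i. i \<in> I \<Longrightarrow> smooth_fun A (f i)) \<Longrightarrow> smooth_fun A (\<lambda>q. \<Sum>i\<in>I. f i q)"
  by (simp add: smooth_fun_iff fam_on_sum)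

lemmas smooth_fun_intros = smooth_fun_const smooth_fun_add smooth_fun_mult smooth_fun_diff smooth_fun_minus
  smooth_fun_sum

lemma smooth_fun_local:
  assumes "\<And>p. \<exists>N g. open N \<and> p \<in> N \<and> smooth_fun A g \<and> (\<forall>q\<in>N. f q = g q)"
  shows "smooth_fun A f"
  unfolding smooth_fun_iff
proof (rule fam_on_local)
  fix z :: "real \<times> 'a"
  obtain N g where N: "open N" "snd z \<in> N" "smooth_fun A g" "\<forall>q\<in>N. f q = g q" using assms by metis
  have o: "open (UNIV \<times> N :: (real \<times> 'a) set)" using N(1) by (simp add: open_Times)
  have "fam_on A (UNIV \<times> N) (\<lambda>z. f (snd z))"
    by (rule fam_on_cong[OF o _ fam_on_snd[OF N(3)]]) (use N(4) in auto)
  then show "\<exists>N. open N \<and> z \<in> N \<and> fam_on A N (\<lambda>z. f (snd z))"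
    using o N(2) by (intro exI[of _ "UNIV \<times> N"]) (auto simp: mem_Times_iff)
qed

lemma compact_chart_preimage:
  assumes "(U, \<phi>) \<in> A" "compact K" "K \<subseteq> \<phi> ` U"
  shows "compact (inv_into U \<phi> ` K)" "inv_into U \<phi> ` K \<subseteq> U" "closed (inv_into U \<phi> ` K)"
    "q \<in> U \<Longrightarrow> q \<in> inv_into U \<phi> ` K \<longleftrightarrow> \<phi> q \<in> K"
proof -
  show c: "compact (inv_into U \<phi> ` K)"
    by (rule compact_continuous_image[OF continuous_on_subset[OF chart(5)[OF assms(1)] assms(3)] assms(2)])
  then show "closed (inv_into U \<phi> ` K)" by (rule compact_imp_closed)
  show "inv_into U \<phi> ` K \<subseteq> U" using assms(3) by (auto intro: inv_into_into)
  show "q \<in> inv_into U \<phi> ` K \<longleftrightarrow> \<phi> q \<in> K" if "q \<in> U"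
  proof
    assume "q \<in> inv_into U \<phi> ` K"
    then obtain x where "x \<in> K" "q = inv_into U \<phi> x" by blast
    then show "\<phi> q \<in> K" using assms(3) by (auto simp: f_inv_into_f)
  next
    assume "\<phi> q \<in> K"
    then show "q \<in> inv_into U \<phi> ` K" using chart_inv[OF assms(1) that] by (metis imageI)
  qed
qed

text \<open>The sets J x U and J x (-K) are open and cover the product. That K is closed in the
  whole space, not merely in U, is what prevents a jump at the boundary of U.\<close>

lemma fam_on_glue:
  assumes "open U" "closed K" "K \<subseteq> U" "fam_on A (J \<times> U) g" "fam_on A (J \<times> UNIV) h" "open J"
    "\<And>t q. t \<in> J \<Longrightarrow> q \<in> U - K \<Longrightarrow> g (t, q) = h (t, q)"
  shows "fam_on A (J \<times> UNIV) (\<lambda>(t, q). if q \<in> U then g (t, q) else h (t, q))"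
proof (rule fam_on_local)
  fix z :: "real \<times> 'a" assume z: "z \<in> J \<times> UNIV"
  have o1: "open (J \<times> U)" and o2: "open (J \<times> (- K))" using assms by (auto intro: open_Times)
  have "fam_on A (J \<times> U) (\<lambda>(t, q). if q \<in> U then g (t, q) else h (t, q))"
    by (rule fam_on_cong[OF o1 _ assms(4)]) auto
  moreover have "fam_on A (J \<times> (- K)) (\<lambda>(t, q). if q \<in> U then g (t, q) else h (t, q))"
    by (rule fam_on_cong[OF o2 _ fam_on_subset[OF assms(5)]]) (use assms(7) in auto)
  moreover have "z \<in> J \<times> U \<or> z \<in> J \<times> (- K)" using z assms(3) by (auto simp: mem_Times_iff)
  ultimately show "\<exists>N. open N \<and> z \<in> N \<and> fam_on A N (\<lambda>(t, q). if q \<in> U then g (t, q) else h (t, q))"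
    using o1 o2 by blast
qed

lemma smooth_fun_glue:
  assumes "open U" "closed K" "K \<subseteq> U" "fam_on A (UNIV \<times> U) (\<lambda>z. f (snd z))" "\<And>q. q \<in> U - K \<Longrightarrow> f q = 0"
  shows "smooth_fun A (\<lambda>q. if q \<in> U then f q else 0)"
proof -
  have "fam_on A (UNIV \<times> UNIV) (\<lambda>(t, q). if q \<in> U then f (snd (t, q)) else 0)"
    by (rule fam_on_glue[OF assms(1-4) fam_on_const[of _ 0] open_UNIV]) (use assms(5) in auto)
  moreover have "(\<lambda>(t::real, q). if q \<in> U then f (snd (t, q)) else 0) = (\<lambda>z. if snd z \<in> U then f (snd z) else 0)"
    by (auto simp: fun_eq_iff)
  ultimately show ?thesis by (simp only: smooth_fun_iff UNIV_Times_UNIV)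
qed

lemma fam_on_chart_fun:
  assumes "(U, \<phi>) \<in> A" "open S" "S \<subseteq> \<phi> ` U" "smooth_on S k"
  shows "fam_on A (UNIV \<times> (U \<inter> \<phi> -` S)) (\<lambda>z. k (\<phi> (snd z)))"
proof -
  have o: "open (UNIV \<times> S :: (real \<times> _) set)" using assms(2) by (auto intro: open_Times)
  have "smooth_on (UNIV \<times> S :: (real \<times> _) set) (\<lambda>z. k (snd z))"
    by (rule smooth_on_compose[OF o assms(2) smooth_on_snd[OF o smooth_on_id[OF o]] assms(4)]) auto
  from fam_on_chart[OF assms(1) o _ this] assms(3)
  have "fam_on A {(t, q). q \<in> U \<and> (t, \<phi> q) \<in> UNIV \<times> S} (\<lambda>(t, q). k (snd (t, \<phi> q)))" by auto
  moreover have "{(t, q). q \<in> U \<and> (t, \<phi> q) \<in> UNIV \<times> S} = (UNIV :: real set) \<times> (U \<inter> \<phi> -` S)" by auto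
  ultimately show ?thesis by (simp only: case_prod_unfold snd_conv)
qed

lemma smooth_fun_chart_support:
  assumes U: "(U, \<phi>) \<in> A" and K: "compact K" "K \<subseteq> \<phi> ` U" and k: "smooth_on (\<phi> ` U) k"
    "\<And>x. x \<in> \<phi> ` U - K \<Longrightarrow> k x = 0"
  shows "smooth_fun A (\<lambda>q. if q \<in> U then k (\<phi> q) else 0)"
proof -
  have fam: "fam_on A (UNIV \<times> U) (\<lambda>z. k (\<phi> (snd z)))"
    by (rule fam_on_subset[OF fam_on_chart_fun[OF U chart(2)[OF U] order_refl k(1)]]) auto
  show ?thesis
    using compact_chart_preimage[OF U K]
    by (intro smooth_fun_glue[OF chart(1)[OF U] _ _ fam]) (auto intro!: k(2))
qed

text \<open>A Euclidean bump in coordinates, extended by 0. The preimage K of a closed coordinate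
  ball is compact, hence closed because the space is Hausdorff, and this makes the extension
  smooth.\<close>

lemma bump_at:
  assumes "open N" "p \<in> N"
  obtains \<beta> W K where "smooth_fun A \<beta>" "open W" "p \<in> W" "W \<subseteq> K" "closed K" "K \<subseteq> N" "\<And>q. 0 \<le> \<beta> q"
    "\<And>q. q \<in> W \<Longrightarrow> \<beta> q = 1" "\<And>q. q \<notin> K \<Longrightarrow> \<beta> q = 0"
proof -
  obtain U \<phi> where U: "(U, \<phi>) \<in> A" "p \<in> U" using chart_at by blast
  have "open (\<phi> ` (U \<inter> N))" by (rule open_chart_image[OF U(1) assms(1)])
  moreover have "\<phi> p \<in> \<phi> ` (U \<inter> N)" using U assms by auto
  ultimately have "\<exists>e>0. cball (\<phi> p) e \<subseteq> \<phi> ` (U \<inter> N)"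
    by (rule open_contains_cball[THEN iffD1, rule_format])
  then obtain e where e: "e > 0" "cball (\<phi> p) e \<subseteq> \<phi> ` (U \<inter> N)" by blast
  \<comment> \<open>Half the radius, because the Euclidean bump spreads to twice the radius of the
    ball on which it equals 1.\<close>
  have "e / 2 > 0" using e by simp
  from bump_function_exists[OF this, of "\<phi> p"]
  obtain b where b: "smooth_on UNIV b" "\<forall>x. 0 \<le> b x" "\<forall>x\<in>ball (\<phi> p) (e / 2). b x = 1"
    "\<forall>x. x \<notin> cball (\<phi> p) (2 * (e / 2)) \<longrightarrow> b x = (0::real)"
    by (elim exE conjE)
  let ?K = "inv_into U \<phi> ` cball (\<phi> p) e"
  let ?W = "U \<inter> \<phi> -` ball (\<phi> p) (e/2)"
  have sub: "cball (\<phi> p) e \<subseteq> \<phi> ` U" using e by auto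
  note K = compact_chart_preimage[OF U(1) compact_cball sub]
  let ?b = "\<lambda>q. if q \<in> U then b (\<phi> q) else 0"
  have 1: "smooth_fun A ?b"
    by (rule smooth_fun_chart_support[OF U(1) compact_cball sub smooth_on_subset[OF b(1) subset_UNIV]])
      (use b(4) in auto)
  have 2: "open ?W" by (rule continuous_open_preimage[OF chart(4)[OF U(1)] chart(1)[OF U(1)] open_ball])
  have 3: "p \<in> ?W" using U e by auto
  have 4: "?W \<subseteq> ?K"
  proof
    fix q assume q: "q \<in> ?W"
    then have "dist (\<phi> p) (\<phi> q) < e / 2" by simp
    then have "\<phi> q \<in> cball (\<phi> p) e" using e(1) by (simp only: mem_cball)
    then show "q \<in> ?K" using K(4) q by simp
  qed
  have 5: "?K \<subseteq> N" using e(2) chart_inv[OF U(1)] by fastforce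
  have 6: "?b q = 0" if "q \<notin> ?K" for q using that K(4) b(4) by auto
  have 7: "0 \<le> ?b q" for q using b(2) by auto
  have 8: "?b q = 1" if "q \<in> ?W" for q using that b(3) by auto
  show ?thesis by (rule that[OF 1 2 3 4 K(3) 5 7 8 6])
qed

text \<open>Tangent vectors act on globally defined smooth functions. A function given near p, such
  as a coordinate, has to be replaced by a global one with the same germ before a derivation can be
  applied to it.\<close>

lemma smooth_extension:
  assumes "open N" "p \<in> N" "fam_on A (UNIV \<times> N) (\<lambda>z. f (snd z))"
  obtains g W where "smooth_fun A g" "open W" "p \<in> W" "W \<subseteq> N" "\<And>q. q \<in> W \<Longrightarrow> g q = f q"
proof -
  obtain \<beta> W K where c: "smooth_fun A \<beta>" "open W" "p \<in> W" "W \<subseteq> K" "closed K" "K \<subseteq> N" "\<And>q. (0::real) \<le> \<beta> q"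
    "\<And>q. q \<in> W \<Longrightarrow> \<beta> q = 1" "\<And>q. q \<notin> K \<Longrightarrow> \<beta> q = 0"
    using bump_at[OF assms(1,2)] by metis
  have o: "open (UNIV \<times> N :: (real \<times> 'a) set)" using assms by (simp add: open_Times)
  have "smooth_fun A (\<lambda>q. if q \<in> N then \<beta> q * f q else 0)"
    by (rule smooth_fun_glue[OF assms(1) c(5,6) fam_on_mult[OF o fam_on_snd[OF c(1)] assms(3)]]) (use c(9) in auto)
  then show ?thesis by (rule that[OF _ c(2,3)]) (use c in auto)
qed

subsection \<open>Smooth maps\<close>

lemma fam_on_family_map:
  assumes "open J" "smooth_family_map A J \<Psi>" "fam_on A (J \<times> UNIV) g"
  shows "fam_on A (J \<times> UNIV) (\<lambda>(t, q). g (t, \<Psi> t q))"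
proof (rule fam_onI)
  fix t0 q0 assume t0: "(t0, q0) \<in> J \<times> (UNIV :: 'a set)"
  obtain U \<phi> where U: "(U, \<phi>) \<in> A" "q0 \<in> U" using chart_at by blast
  obtain V \<psi> where V: "(V, \<psi>) \<in> A" "\<Psi> t0 q0 \<in> V" using chart_at by blast
  let ?N = "{(t, x). t \<in> J \<and> x \<in> \<phi> ` U \<and> \<Psi> t (inv_into U \<phi> x) \<in> V}"
  have s: "smooth_on ?N (\<lambda>(t, x). \<psi> (\<Psi> t (inv_into U \<phi> x)))"
    using assms(2) U V unfolding smooth_family_map_def by fastforce
  have oJ: "open (J \<times> (UNIV :: 'a set))" using assms(1) by (simp add: open_Times)
  have "continuous_on (J \<times> UNIV) (\<lambda>(t, p). \<Psi> t p)" using assms(2) by (simp add: smooth_family_map_def)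
  then have oW: "open ((J \<times> UNIV) \<inter> (\<lambda>(t, p). \<Psi> t p) -` V)"
    by (rule continuous_open_preimage[OF _ oJ chart(1)[OF V(1)]])
  have N: "?N = {(t, x). x \<in> \<phi> ` U \<and> (t, inv_into U \<phi> x) \<in> (J \<times> UNIV) \<inter> (\<lambda>(t, p). \<Psi> t p) -` V}" by auto
  have oN: "open ?N" unfolding N by (rule open_chart_dom[OF U(1) oW])
  let ?D = "{(t, x). x \<in> \<psi> ` V \<and> (t, inv_into V \<psi> x) \<in> J \<times> UNIV}"
  have oD: "open ?D" by (rule open_chart_dom[OF V(1) oJ])
  have "smooth_on ?N (\<lambda>z. (\<lambda>(t, x). g (t, inv_into V \<psi> x)) (fst z, (\<lambda>(t, x). \<psi> (\<Psi> t (inv_into U \<phi> x))) z))"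
    by (rule smooth_on_compose[OF oN oD smooth_on_Pair[OF oN smooth_on_fst[OF oN smooth_on_id[OF oN]] s] fam_onD[OF assms(3) V(1)]])
      auto
  then have sg: "smooth_on ?N (\<lambda>(t, x). (\<lambda>(t, q). g (t, \<Psi> t q)) (t, inv_into U \<phi> x))"
    by (rule smooth_on_cong[OF oN, rotated]) (auto simp: chart_inv[OF V(1)])
  have sub: "(t0, \<phi> q0) \<in> ?N" "?N \<subseteq> UNIV \<times> \<phi> ` U" using t0 U V chart_inv[OF U(1)] by auto
  show "\<exists>U \<phi> N. (U, \<phi>) \<in> A \<and> q0 \<in> U \<and> open N \<and> (t0, \<phi> q0) \<in> N \<and> N \<subseteq> UNIV \<times> \<phi> ` U \<and>
     smooth_on N (\<lambda>(t, x). (\<lambda>(t, q). g (t, \<Psi> t q)) (t, inv_into U \<phi> x))"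
    by (intro exI[of _ U] exI[of _ \<phi>] exI[of _ ?N] conjI U oN sub sg)
qed

text \<open>Smoothness can be tested on global smooth functions: the finitely many coordinates of a
  chart at the image point extend to such functions, and these recover the chart expression of the
  map on a smaller neighbourhood.\<close>

lemma smooth_family_mapI:
  assumes "open J" "continuous_on (J \<times> UNIV) (\<lambda>(t, p). \<Psi> t p)"
    "\<And>f. smooth_fun A f \<Longrightarrow> fam_on A (J \<times> UNIV) (\<lambda>(t, q). f (\<Psi> t q))"
  shows "smooth_family_map A J \<Psi>"
  unfolding smooth_family_map_def
proof (intro conjI assms(2), clarify)
  fix U \<phi> V \<psi> assume U: "(U, \<phi>) \<in> A" and V: "(V, \<psi>) \<in> A"
  have oJ: "open (J \<times> (UNIV :: 'a set))" using assms(1) by (simp add: open_Times)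
  show "smooth_on {(t, x). t \<in> J \<and> x \<in> \<phi> ` U \<and> \<Psi> t (inv_into U \<phi> x) \<in> V} (\<lambda>(t, x). \<psi> (\<Psi> t (inv_into U \<phi> x)))"
  proof (rule smooth_on_local)
    fix z0 assume "z0 \<in> {(t, x). t \<in> J \<and> x \<in> \<phi> ` U \<and> \<Psi> t (inv_into U \<phi> x) \<in> V}"
    then obtain t0 x0 where z0: "z0 = (t0, x0)" "t0 \<in> J" "x0 \<in> \<phi> ` U" "\<Psi> t0 (inv_into U \<phi> x0) \<in> V" by auto
    have oV: "open (UNIV \<times> V :: (real \<times> _) set)" using chart(1)[OF V] by (simp add: open_Times)
    have "\<exists>f W. smooth_fun A f \<and> open W \<and> \<Psi> t0 (inv_into U \<phi> x0) \<in> W \<and> W \<subseteq> V \<and> (\<forall>q\<in>W. f q = \<psi> q $ i)" for i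
    proof -
      have "smooth_on (\<psi> ` V) (\<lambda>x. x $ i)"
        by (intro smooth_on_vec_nth chart(2)[OF V] smooth_on_id)
      have "fam_on A (UNIV \<times> V) (\<lambda>z. \<psi> (snd z) $ i)"
        by (rule fam_on_subset[OF fam_on_chart_fun[OF V chart(2)[OF V] order_refl \<open>smooth_on (\<psi> ` V) (\<lambda>x. x $ i)\<close>]]) auto
      then show ?thesis
        using smooth_extension[OF chart(1)[OF V] z0(4), of "\<lambda>q. \<psi> q $ i"] by metis
    qed
    then obtain f W where f: "\<And>i. smooth_fun A (f i)" "\<And>i. open (W i)" "\<And>i. \<Psi> t0 (inv_into U \<phi> x0) \<in> W i"
      "\<And>i. W i \<subseteq> V" "\<And>i q. q \<in> W i \<Longrightarrow> f i q = \<psi> q $ i" by metis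
    define W' where "W' = (\<Inter>i. W i)"
    have oW': "open W'" unfolding W'_def by (rule open_INT) (use f in auto)
    let ?N = "{(t, x). x \<in> \<phi> ` U \<and> (t, inv_into U \<phi> x) \<in> (J \<times> UNIV) \<inter> (\<lambda>(t, p). \<Psi> t p) -` W'}"
    have oN: "open ?N"
      by (rule open_chart_dom[OF U continuous_open_preimage[OF assms(2) oJ oW']])
    have "smooth_on ?N (\<lambda>(t, x). \<psi> (\<Psi> t (inv_into U \<phi> x)))"
    proof (rule smooth_on_vec_lambda[OF oN])
      fix i
      show "smooth_on ?N (\<lambda>z. (case z of (t, x) \<Rightarrow> \<psi> (\<Psi> t (inv_into U \<phi> x))) $ i)"
        by (rule smooth_on_cong[OF oN _ smooth_on_subset[OF fam_onD[OF assms(3)[OF f(1)[of i]] U]]])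
          (use f(5)[of _ i] in \<open>auto simp: W'_def\<close>)
    qed
    moreover have "z0 \<in> ?N" using z0 f(3) by (auto simp: W'_def)
    ultimately show "\<exists>N. open N \<and> z0 \<in> N \<and> smooth_on N (\<lambda>(t, x). \<psi> (\<Psi> t (inv_into U \<phi> x)))"
      by (intro exI[of _ ?N] conjI oN)
  qed
qed

lemma smooth_map_slice:
  assumes "open J" "smooth_family_map A J \<Psi>" "t \<in> J" shows "smooth_map A A (\<Psi> t)"
  unfolding smooth_map_def
proof (intro conjI, goal_cases)
  case 1
  have c: "continuous_on (J \<times> UNIV) (\<lambda>(t, p). \<Psi> t p)" using assms(2) by (simp add: smooth_family_map_def)
  show ?case
    by (rule continuous_on_compose2[OF c continuous_on_Pair[OF continuous_on_const[of _ t] continuous_on_id],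
        unfolded prod.case]) (use assms(3) in auto)
next
  case 2
  show ?case
  proof clarify
    fix U \<phi> V \<psi> assume U: "(U, \<phi>) \<in> A" and V: "(V, \<psi>) \<in> A"
    let ?N = "{(t, x). t \<in> J \<and> x \<in> \<phi> ` U \<and> \<Psi> t (inv_into U \<phi> x) \<in> V}"
    have s: "smooth_on ?N (\<lambda>(t, x). \<psi> (\<Psi> t (inv_into U \<phi> x)))"
      using assms(2) U V unfolding smooth_family_map_def by fastforce
    have oJ: "open (J \<times> (UNIV :: 'a set))" using assms(1) by (simp add: open_Times)
    have c: "continuous_on (J \<times> UNIV) (\<lambda>(t, p). \<Psi> t p)" using assms(2) by (simp add: smooth_family_map_def)
    have "?N = {(t, x). x \<in> \<phi> ` U \<and> (t, inv_into U \<phi> x) \<in> (J \<times> UNIV) \<inter> (\<lambda>(t, p). \<Psi> t p) -` V}" by auto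
    then have oN: "open ?N"
      using open_chart_dom[OF U continuous_open_preimage[OF c oJ chart(1)[OF V]]] by simp
    have c1: "continuous_on UNIV (\<Psi> t)"
      by (rule continuous_on_compose2[OF c continuous_on_Pair[OF continuous_on_const[of _ t] continuous_on_id],
          unfolded prod.case]) (use assms(3) in auto)
    have o: "open (\<phi> ` (U \<inter> \<Psi> t -` V))"
      by (rule open_chart_image[OF U open_vimage[OF chart(1)[OF V] c1]])
    have "smooth_on (\<phi> ` (U \<inter> \<Psi> t -` V)) (\<lambda>x. (\<lambda>(t, x). \<psi> (\<Psi> t (inv_into U \<phi> x))) (t, x))"
      by (rule smooth_on_compose[OF o oN _ s])
        (use assms(3) o chart_inv[OF U] in \<open>auto intro!: smooth_on_Pair smooth_on_id\<close>)
    then show "smooth_on (\<phi> ` (U \<inter> \<Psi> t -` V)) (\<lambda>x. \<psi> (\<Psi> t (inv_into U \<phi> x)))" by simp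
  qed
qed

lemma smooth_mapI:
  assumes "continuous_on UNIV F" "\<And>f. smooth_fun A f \<Longrightarrow> smooth_fun A (\<lambda>q. f (F q))"
  shows "smooth_map A A F"
proof -
  have "smooth_family_map A UNIV (\<lambda>t. F)"
  proof (rule smooth_family_mapI)
    show "continuous_on (UNIV \<times> UNIV) (\<lambda>(t::real, p). F p)"
      unfolding case_prod_unfold by (rule continuous_on_compose2[OF assms(1)]) (auto intro!: continuous_intros)
    show "fam_on A (UNIV \<times> UNIV) (\<lambda>(t, q). f (F q))" if "smooth_fun A f" for f
      using assms(2)[OF that] by (simp add: smooth_fun_iff case_prod_unfold)
  qed simp
  from smooth_map_slice[OF open_UNIV this] show ?thesis by simp
qed

end

lemma smooth_fun_smooth_map:
  fixes A :: "('a::t2_space, 'n::finite) atlas" and B :: "('b::t2_space, 'm::finite) atlas"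
  assumes "smooth_atlas A" "smooth_atlas B" "smooth_map A B F" "smooth_fun B f"
  shows "smooth_fun A (\<lambda>q. f (F q))"
proof -
  interpret A: manifold A by standard (rule assms)
  interpret B: manifold B by standard (rule assms)
  show ?thesis unfolding A.smooth_fun_iff
  proof (rule A.fam_onI)
    fix t0 :: real and q0
    obtain U \<phi> where U: "(U, \<phi>) \<in> A" "q0 \<in> U" using A.chart_at by blast
    obtain V \<psi> where V: "(V, \<psi>) \<in> B" "F q0 \<in> V" using B.chart_at by blast
    let ?S = "\<phi> ` (U \<inter> F -` V)"
    have "open (F -` V)"
      using assms(3) B.chart(1)[OF V(1)] by (auto simp: smooth_map_def intro: open_vimage)
    then have oS: "open ?S" by (rule A.open_chart_image[OF U(1)])
    then have oS': "open (UNIV \<times> ?S :: (real \<times> _) set)" by (simp add: open_Times)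
    have s: "smooth_on ?S (\<lambda>x. \<psi> (F (inv_into U \<phi> x)))"
      using assms(3) U V unfolding smooth_map_def by fastforce
    have "smooth_on (\<psi> ` V) (\<lambda>y. f (inv_into V \<psi> y))" using assms(4) V by (auto simp: smooth_fun_def)
    from smooth_on_compose[OF oS B.chart(2)[OF V(1)] s this]
    have "smooth_on ?S (\<lambda>x. f (inv_into V \<psi> (\<psi> (F (inv_into U \<phi> x)))))"
      using A.chart_inv[OF U(1)] by force
    then have "smooth_on ?S (\<lambda>x. f (F (inv_into U \<phi> x)))"
      by (rule smooth_on_cong[OF oS, rotated]) (use A.chart_inv[OF U(1)] B.chart_inv[OF V(1)] in auto)
    from smooth_on_compose[OF oS' oS smooth_on_snd[OF oS' smooth_on_id[OF oS']] this]
    have sf: "smooth_on (UNIV \<times> ?S :: (real \<times> _) set) (\<lambda>(t, x). f (F (snd (t, inv_into U \<phi> x))))"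
      unfolding case_prod_unfold snd_conv by (rule meta_mp) auto
    have sub: "(t0, \<phi> q0) \<in> UNIV \<times> ?S" "UNIV \<times> ?S \<subseteq> UNIV \<times> \<phi> ` U" using U V by auto
    show "\<exists>U \<phi> N. (U, \<phi>) \<in> A \<and> q0 \<in> U \<and> open N \<and> (t0, \<phi> q0) \<in> N \<and> N \<subseteq> UNIV \<times> \<phi> ` U \<and>
       smooth_on N (\<lambda>(t, x). f (F (snd (t, inv_into U \<phi> x))))"
      by (intro exI[of _ U] exI[of _ \<phi>] exI[of _ "UNIV \<times> ?S"] conjI U oS' sub sf)
  qed
qed

section \<open>Derivations and local frames\<close>

lemma Basis_vec_real: "(Basis :: (real ^ 'n) set) = range (\<lambda>i. axis i 1)"
  by (auto simp: Basis_vec_def)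

lemma sum_Basis_vec: "(\<Sum>b\<in>(Basis :: (real ^ 'n) set). f b) = (\<Sum>i\<in>UNIV. f (axis i 1))"
  unfolding Basis_vec_real by (subst sum.reindex) (auto simp: inj_on_def axis_eq_axis)

context manifold
begin

section \<open>Calculus with derivations at a point\<close>

abbreviation T :: "'a \<Rightarrow> 'a tvec set" where "T \<equiv> tangent_space A"

lemma T_lin:
  "v \<in> T p \<Longrightarrow> smooth_fun A f \<Longrightarrow> smooth_fun A g \<Longrightarrow> v (\<lambda>q. a * f q + b * g q) = a * v f + b * v g"
  by (simp add: tangent_space_def)

lemma T_mult:
  "v \<in> T p \<Longrightarrow> smooth_fun A f \<Longrightarrow> smooth_fun A g \<Longrightarrow> v (\<lambda>q. f q * g q) = f p * v g + g p * v f"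
  by (simp add: tangent_space_def)

lemma T_nonsmooth: "v \<in> T p \<Longrightarrow> \<not> smooth_fun A f \<Longrightarrow> v f = 0"
  by (simp add: tangent_space_def)

lemma T_add: "v \<in> T p \<Longrightarrow> smooth_fun A f \<Longrightarrow> smooth_fun A g \<Longrightarrow> v (\<lambda>q. f q + g q) = v f + v g"
  using T_lin[of v p f g 1 1] by simp

lemma T_diff: "v \<in> T p \<Longrightarrow> smooth_fun A f \<Longrightarrow> smooth_fun A g \<Longrightarrow> v (\<lambda>q. f q - g q) = v f - v g"
  using T_lin[of v p f g 1 "-1"] by simp

lemma T_cmult: "v \<in> T p \<Longrightarrow> smooth_fun A f \<Longrightarrow> v (\<lambda>q. c * f q) = c * v f"
  using T_lin[of v p f f c 0] by simp

lemma T_minus: "v \<in> T p \<Longrightarrow> smooth_fun A f \<Longrightarrow> v (\<lambda>q. - f q) = - v f"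
  using T_cmult[of v p f "-1"] by simp

text \<open>Leibniz applied to 1 as the product of 1 with itself forces v(1) = v(1) + v(1).\<close>

lemma T_const: "v \<in> T p \<Longrightarrow> v (\<lambda>q. c) = 0"
  using T_cmult[of v p "\<lambda>q. 1" c] T_mult[of v p "\<lambda>q. 1" "\<lambda>q. 1"] by simp

lemma T_sum:
  assumes "v \<in> T p" "\<And>i. i \<in> I \<Longrightarrow> smooth_fun A (f i)"
  shows "v (\<lambda>q. \<Sum>i\<in>I. f i q) = (\<Sum>i\<in>I. v (f i))"
  using assms(2)
  by (induction I rule: infinite_finite_induct)
    (auto simp: T_const[OF assms(1)] T_add[OF assms(1)] smooth_fun_sum)

text \<open>For a bump \<beta> supported where f and g agree, the product of \<beta> and f - g
  vanishes identically; at p, where \<beta> = 1 and f = g, the Leibniz rule leaves v(f) -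
  v(g).\<close>

lemma T_local:
  assumes "v \<in> T p" "smooth_fun A f" "smooth_fun A g" "open N" "p \<in> N" "\<And>q. q \<in> N \<Longrightarrow> f q = g q"
  shows "v f = v g"
proof -
  obtain \<beta> W K where b: "smooth_fun A \<beta>" "p \<in> W" "K \<subseteq> N" "\<And>q. q \<in> W \<Longrightarrow> \<beta> q = (1::real)"
    "\<And>q. q \<notin> K \<Longrightarrow> \<beta> q = 0"
    using bump_at[OF assms(4,5)] by metis
  have "(\<lambda>q. \<beta> q * (f q - g q)) = (\<lambda>q. 0)" using b(3,5) assms(6) by fastforce
  then have "0 = v (\<lambda>q. \<beta> q * (f q - g q))" using T_const[OF assms(1), of 0] by simp
  also have "\<dots> = \<beta> p * (v f - v g) + (f p - g p) * v \<beta>"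
    using T_mult[OF assms(1) b(1) smooth_fun_diff[OF assms(2,3)]] T_diff[OF assms(1-3)] by simp
  finally show ?thesis using b(2,4) assms(5,6) by simp
qed

lemma T_comb: "v \<in> T p \<Longrightarrow> w \<in> T p \<Longrightarrow> (\<lambda>f. a * v f + b * w f) \<in> T p"
  unfolding tangent_space_def by (simp add: algebra_simps)

lemma T_zero: "(\<lambda>f. 0) \<in> T p"
  unfolding tangent_space_def by simp

lemma T_scale: "v \<in> T p \<Longrightarrow> (\<lambda>f. a * v f) \<in> T p"
  using T_comb[of v p v a 0] by simp

lemma T_minus_vec: "v \<in> T p \<Longrightarrow> w \<in> T p \<Longrightarrow> (\<lambda>f. v f - w f) \<in> T p"
  using T_comb[of v p w 1 "-1"] by simp

lemma T_sum_vec: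
  assumes "\<And>i. i \<in> I \<Longrightarrow> v i \<in> T p" shows "(\<lambda>f. \<Sum>i\<in>I. c i * v i f) \<in> T p"
  using assms
proof (induction I rule: infinite_finite_induct)
  case (insert x F)
  then show ?case using T_comb[of "v x" p _ "c x" 1] by simp
qed (auto intro: T_zero)

section \<open>Coordinate fields of a chart, and their span\<close>

definition coord_field :: "'a set \<Rightarrow> ('a \<Rightarrow> real ^ 'n) \<Rightarrow> 'n \<Rightarrow> 'a \<Rightarrow> 'a tvec" where
  "coord_field U \<phi> i q f = (if q \<in> U \<and> smooth_fun A f
     then frechet_derivative (\<lambda>x. f (inv_into U \<phi> x)) (at (\<phi> q)) (axis i 1) else 0)"

lemma chart_has_derivative:
  assumes "(U, \<phi>) \<in> A" "q \<in> U" "smooth_fun A f"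
  shows "((\<lambda>x. f (inv_into U \<phi> x)) has_derivative
    frechet_derivative (\<lambda>x. f (inv_into U \<phi> x)) (at (\<phi> q))) (at (\<phi> q))"
  by (rule smooth_on_has_derivative[of "\<phi> ` U"]) (use assms in \<open>auto simp: smooth_fun_def\<close>)

text \<open>Off the chart the field is set to 0, which is a derivation too, so the point q may be
  arbitrary.\<close>

lemma coord_field_tangent:
  assumes U: "(U, \<phi>) \<in> A" shows "coord_field U \<phi> i q \<in> T q"
proof -
  have 1: "coord_field U \<phi> i q (\<lambda>q. a * f q + b * g q) = a * coord_field U \<phi> i q f + b * coord_field U \<phi> i q g"
    if f: "smooth_fun A f" and g: "smooth_fun A g" for f g a b
  proof (cases "q \<in> U")
    case True
    note d = chart_has_derivative[OF U True]
    have "((\<lambda>x. a * f (inv_into U \<phi> x) + b * g (inv_into U \<phi> x)) has_derivative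
       (\<lambda>v. a * frechet_derivative (\<lambda>x. f (inv_into U \<phi> x)) (at (\<phi> q)) v +
            b * frechet_derivative (\<lambda>x. g (inv_into U \<phi> x)) (at (\<phi> q)) v)) (at (\<phi> q))"
      by (intro has_derivative_add has_derivative_mult_right d f g)
    from frechet_derivative_at[OF this, symmetric] show ?thesis
      using f g True by (simp add: coord_field_def smooth_fun_add smooth_fun_cmult)
  qed (simp add: coord_field_def)
  have 2: "coord_field U \<phi> i q (\<lambda>q. f q * g q) = f q * coord_field U \<phi> i q g + g q * coord_field U \<phi> i q f"
    if f: "smooth_fun A f" and g: "smooth_fun A g" for f g
  proof (cases "q \<in> U")
    case True
    note d = chart_has_derivative[OF U True]
    have "((\<lambda>x. f (inv_into U \<phi> x) * g (inv_into U \<phi> x)) has_derivative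
       (\<lambda>v. f (inv_into U \<phi> (\<phi> q)) * frechet_derivative (\<lambda>x. g (inv_into U \<phi> x)) (at (\<phi> q)) v +
            frechet_derivative (\<lambda>x. f (inv_into U \<phi> x)) (at (\<phi> q)) v * g (inv_into U \<phi> (\<phi> q)))) (at (\<phi> q))"
      by (intro has_derivative_mult d f g)
    from frechet_derivative_at[OF this, symmetric] show ?thesis
      using f g True by (simp add: coord_field_def smooth_fun_mult chart_inv[OF U])
  qed (simp add: coord_field_def)
  show ?thesis unfolding tangent_space_def using 1 2 by (auto simp: coord_field_def)
qed

text \<open>The partial derivative at fixed time is the derivative of the joint function of (t, x)
  in the direction (0, e_i), and the latter is smooth in (t, x).\<close>

lemma fam_on_coord_field:
  assumes U: "(U, \<phi>) \<in> A" and J: "open J" and g: "fam_on A (J \<times> UNIV) g"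
  shows "fam_on A (J \<times> U) (\<lambda>(t, q). coord_field U \<phi> i q (\<lambda>q. g (t, q)))"
proof -
  let ?g = "\<lambda>(t, x). g (t, inv_into U \<phi> x)"
  have o: "open (J \<times> \<phi> ` U)" using J chart(2)[OF U] by (rule open_Times)
  have oU: "open (J \<times> U)" using J chart(1)[OF U] by (rule open_Times)
  have s: "smooth_on (J \<times> \<phi> ` U) ?g"
    by (rule smooth_on_subset[OF fam_onD[OF g U]]) auto
  have "fam_on A {(t, q). q \<in> U \<and> (t, \<phi> q) \<in> J \<times> \<phi> ` U} (\<lambda>(t, q). frechet_derivative ?g (at (t, \<phi> q)) (0, axis i 1))"
    by (rule fam_on_chart[OF U o _ smooth_on_frechet_derivative[OF s]]) auto
  moreover have "{(t, q). q \<in> U \<and> (t, \<phi> q) \<in> J \<times> \<phi> ` U} = J \<times> U" by auto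
  ultimately have f: "fam_on A (J \<times> U) (\<lambda>(t, q). frechet_derivative ?g (at (t, \<phi> q)) (0, axis i 1))" by simp
  show ?thesis
  proof (rule fam_on_cong[OF oU _ f], clarify)
    fix t q assume t: "t \<in> J" and q: "q \<in> U"
    have "(?g has_derivative frechet_derivative ?g (at (t, \<phi> q))) (at (t, \<phi> q))"
      by (rule smooth_on_has_derivative[OF s]) (use t q in auto)
    then have "((\<lambda>x. ?g (t, x)) has_derivative (\<lambda>v. frechet_derivative ?g (at (t, \<phi> q)) (0, v))) (at (\<phi> q))"
      by (rule has_derivative_compose[where g="?g" and f="\<lambda>x. (t, x)", rotated]) (auto intro!: derivative_eq_intros)
    from frechet_derivative_at[OF this, symmetric]
    show "frechet_derivative ?g (at (t, \<phi> q)) (0, axis i 1) = coord_field U \<phi> i q (\<lambda>q. g (t, q))"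
      using q fam_on_slice[OF J g t] by (simp add: coord_field_def)
  qed
qed

text \<open>The classical argument that derivations are spanned by partial derivatives: Hadamard's
  lemma writes f near p as f(p) plus products of x_i - x_i(p) with smooth factors, and the Leibniz
  rule at p keeps only v(x_i) times the value of the factor, which is the i-th partial
  derivative.\<close>

lemma tangent_coord_expansion:
  assumes U: "(U, \<phi>) \<in> A" "p \<in> U" and x: "\<And>i. smooth_fun A (x i)"
    and N: "open N" "p \<in> N" "N \<subseteq> U" "\<And>i q. q \<in> N \<Longrightarrow> x i q = \<phi> q $ i" and v: "v \<in> T p"
  shows "v = (\<lambda>f. \<Sum>i\<in>UNIV. v (x i) * coord_field U \<phi> i p f)"
proof
  fix f
  show "v f = (\<Sum>i\<in>UNIV. v (x i) * coord_field U \<phi> i p f)"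
  proof (cases "smooth_fun A f")
    case False
    then show ?thesis using T_nonsmooth[OF v False] by (simp add: coord_field_def)
  next
    case True
    let ?f = "\<lambda>y. f (inv_into U \<phi> y)"
    have "\<phi> p \<in> \<phi> ` U" using U by auto
    then have "\<exists>r>0. ball (\<phi> p) r \<subseteq> \<phi> ` U"
      using chart(2)[OF U(1)] by (rule open_contains_ball[THEN iffD1, rule_format, rotated])
    then obtain r where r: "r > 0" "ball (\<phi> p) r \<subseteq> \<phi> ` U" by blast
    have sf: "smooth_on (ball (\<phi> p) r) ?f"
      by (rule smooth_on_subset[OF _ r(2)]) (use True U in \<open>auto simp: smooth_fun_def\<close>)
    obtain g where g: "\<And>b. smooth_on (ball (\<phi> p) r) (g b)"
      "\<And>y. y \<in> ball (\<phi> p) r \<Longrightarrow> ?f y = ?f (\<phi> p) + (\<Sum>b\<in>Basis. ((y - \<phi> p) \<bullet> b) * g b y)"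
      "\<And>b. g b (\<phi> p) = frechet_derivative ?f (at (\<phi> p)) b"
      by (rule Hadamard_space[OF sf r(1)]) (rule that)
    let ?B = "U \<inter> \<phi> -` ball (\<phi> p) r"
    have oB: "open ?B" by (rule continuous_open_preimage[OF chart(4)[OF U(1)] chart(1)[OF U(1)] open_ball])
    have pB: "p \<in> ?B" using U r by auto
    have "\<exists>G W. smooth_fun A G \<and> open W \<and> p \<in> W \<and> W \<subseteq> ?B \<and> (\<forall>q\<in>W. G q = g (axis i 1) (\<phi> q))" for i
      using smooth_extension[OF oB pB fam_on_chart_fun[OF U(1) open_ball r(2) g(1)], of "axis i 1"] by metis
    then obtain G W where G: "\<And>i. smooth_fun A (G i)" "\<And>i. open (W i)" "\<And>i. p \<in> W i" "\<And>i. W i \<subseteq> ?B"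
      "\<And>i q. q \<in> W i \<Longrightarrow> G i q = g (axis i 1) (\<phi> q)" by metis
    let ?N = "N \<inter> (\<Inter>i. W i)"
    have oN: "open ?N" using N(1) G(2) by (intro open_Int open_INT) auto
    have s1: "smooth_fun A (\<lambda>q. (x i q - x i p) * G i q)" for i
      by (intro smooth_fun_intros x G)
    have "v f = v (\<lambda>q. f p + (\<Sum>i\<in>UNIV. (x i q - x i p) * G i q))"
    proof (rule T_local[OF v True _ oN])
      show "smooth_fun A (\<lambda>q. f p + (\<Sum>i\<in>UNIV. (x i q - x i p) * G i q))"
        by (intro smooth_fun_add smooth_fun_const smooth_fun_sum s1)
      show "p \<in> ?N" using N G by auto
      fix q assume q: "q \<in> ?N"
      then have "q \<in> ?B" using G(4) by blast
      then have qB: "q \<in> U" "\<phi> q \<in> ball (\<phi> p) r" by auto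
      have "f q = f p + (\<Sum>i\<in>UNIV. ((\<phi> q - \<phi> p) \<bullet> axis i 1) * g (axis i 1) (\<phi> q))"
        using g(2)[OF qB(2)] chart_inv[OF U(1)] qB(1) U(2) by (simp add: sum_Basis_vec)
      also have "\<dots> = f p + (\<Sum>i\<in>UNIV. (x i q - x i p) * G i q)"
        using q N(2) N(4) G(5) by (intro arg_cong2[where f="(+)"] sum.cong) (auto simp: inner_axis)
      finally show "f q = f p + (\<Sum>i\<in>UNIV. (x i q - x i p) * G i q)" .
    qed
    also have "\<dots> = (\<Sum>i\<in>UNIV. v (\<lambda>q. (x i q - x i p) * G i q))"
      by (simp add: T_add[OF v] T_const[OF v] T_sum[OF v] smooth_fun_sum s1)
    also have "\<dots> = (\<Sum>i\<in>UNIV. v (x i) * G i p)"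
    proof (rule sum.cong)
      fix i
      have "v (\<lambda>q. x i q - x i p) = v (x i)"
        using T_diff[OF v x smooth_fun_const] T_const[OF v] by simp
      then show "v (\<lambda>q. (x i q - x i p) * G i q) = v (x i) * G i p"
        using T_mult[OF v smooth_fun_diff[OF x smooth_fun_const] G(1), of i "x i p" i] by simp
    qed simp
    also have "\<dots> = (\<Sum>i\<in>UNIV. v (x i) * coord_field U \<phi> i p f)"
      using G(3,5) g(3) U(2) True by (simp add: coord_field_def)
    finally show ?thesis .
  qed
qed

section \<open>Smooth vector fields and local frames\<close>

lemma sectionsI:
  "(\<And>p. X p \<in> T p \<inter> D p) \<Longrightarrow> (\<And>f. smooth_fun A f \<Longrightarrow> smooth_fun A (\<lambda>p. X p f)) \<Longrightarrow> X \<in> sections A D"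
  by (simp add: sections_def)

lemma sections_tangent: "X \<in> sections A D \<Longrightarrow> X p \<in> T p"
  and sections_in: "X \<in> sections A D \<Longrightarrow> X p \<in> D p"
  and sections_smooth: "X \<in> sections A D \<Longrightarrow> smooth_fun A f \<Longrightarrow> smooth_fun A (\<lambda>p. X p f)"
  by (auto simp: sections_def)

lemma sections_T: "X \<in> sections A D \<Longrightarrow> X \<in> sections A T"
  by (auto simp: sections_def)

lemma sections_comb:
  assumes "X \<in> sections A T" "Y \<in> sections A T" "smooth_fun A f" "smooth_fun A g"
  shows "(\<lambda>p h. f p * X p h + g p * Y p h) \<in> sections A T"
  by (rule sectionsI)
    (use assms in \<open>auto intro!: T_comb smooth_fun_intros dest: sections_tangent sections_smooth\<close>)

lemma sections_scale: "X \<in> sections A T \<Longrightarrow> smooth_fun A f \<Longrightarrow> (\<lambda>p h. f p * X p h) \<in> sections A T"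
  using sections_comb[of X X f "\<lambda>p. 0"] by simp

lemma sections_add:
  "X \<in> sections A T \<Longrightarrow> Y \<in> sections A T \<Longrightarrow> (\<lambda>p h. X p h + Y p h) \<in> sections A T"
  using sections_comb[of X Y "\<lambda>p. 1" "\<lambda>p. 1"] by simp

lemma sections_diff:
  "X \<in> sections A T \<Longrightarrow> Y \<in> sections A T \<Longrightarrow> (\<lambda>p h. X p h - Y p h) \<in> sections A T"
  using sections_comb[of X Y "\<lambda>p. 1" "\<lambda>p. - 1"] by simp

lemma sections_sum:
  assumes "\<And>i. i \<in> I \<Longrightarrow> X i \<in> sections A T" shows "(\<lambda>p h. \<Sum>i\<in>I. X i p h) \<in> sections A T"
  using assms
proof (induction I rule: infinite_finite_induct)
  case (insert x F)
  then show ?case using sections_add[of "X x" "\<lambda>p h. \<Sum>i\<in>F. X i p h"] by simp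
qed (auto intro!: sectionsI T_zero)

lemma sections_coord_field:
  assumes U: "(U, \<phi>) \<in> A" and b: "smooth_fun A \<beta>" "closed K" "K \<subseteq> U" "\<And>q. q \<notin> K \<Longrightarrow> \<beta> q = 0"
  shows "(\<lambda>q f. \<beta> q * coord_field U \<phi> i q f) \<in> sections A T"
proof (rule sectionsI)
  fix f assume f: "smooth_fun A f"
  have oU: "open (UNIV \<times> U :: (real \<times> _) set)" using chart(1)[OF U] by (simp add: open_Times)
  have "fam_on A (UNIV \<times> UNIV) (\<lambda>z. f (snd z))" using f by (simp add: smooth_fun_iff)
  from fam_on_coord_field[OF U open_UNIV this]
  have "fam_on A (UNIV \<times> U) (\<lambda>z. coord_field U \<phi> i (snd z) f)" by (simp add: case_prod_unfold)
  from smooth_fun_glue[OF chart(1)[OF U] b(2,3) fam_on_mult[OF oU fam_on_snd[OF b(1)] this]]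
  have "smooth_fun A (\<lambda>q. if q \<in> U then \<beta> q * coord_field U \<phi> i q f else 0)" using b(4) by auto
  then show "smooth_fun A (\<lambda>q. \<beta> q * coord_field U \<phi> i q f)"
    by (rule back_subst[where P="smooth_fun A"]) (use b in \<open>auto simp: fun_eq_iff coord_field_def\<close>)
qed (auto intro: T_scale coord_field_tangent[OF U])

text \<open>The coordinates become global functions through multiplication by the bump. On W, where
  the bump is 1, they agree with the chart, so tangent vectors expand in the coordinate fields
  there.\<close>

lemma chart_coordinates:
  obtains U \<phi> \<beta> W K x where "(U, \<phi>) \<in> A" "smooth_fun A \<beta>" "open W" "p \<in> W" "W \<subseteq> K" "closed K" "K \<subseteq> U"
    "\<And>q. q \<in> W \<Longrightarrow> \<beta> q = (1::real)" "\<And>q. q \<notin> K \<Longrightarrow> \<beta> q = 0" "\<And>i::'n. smooth_fun A (x i)"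
    "\<And>q v. q \<in> W \<Longrightarrow> v \<in> T q \<Longrightarrow> v = (\<lambda>f. \<Sum>i\<in>UNIV. v (x i) * coord_field U \<phi> i q f)"
proof -
  obtain U \<phi> where U: "(U, \<phi>) \<in> A" "p \<in> U" using chart_at by blast
  obtain \<beta> W K where b: "smooth_fun A \<beta>" "open W" "p \<in> W" "W \<subseteq> K" "closed K" "K \<subseteq> U"
    "\<And>q. q \<in> W \<Longrightarrow> \<beta> q = (1::real)" "\<And>q. q \<notin> K \<Longrightarrow> \<beta> q = 0"
    using bump_at[OF chart(1)[OF U(1)] U(2)] by metis
  define x where "x i q = (if q \<in> U then \<beta> q * \<phi> q $ i else 0)" for i q
  have oU: "open (UNIV \<times> U :: (real \<times> _) set)" using chart(1)[OF U(1)] by (simp add: open_Times)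
  have x: "smooth_fun A (x i)" for i
  proof -
    have "smooth_on (\<phi> ` U) (\<lambda>x. x $ i)"
      by (intro smooth_on_vec_nth chart(2)[OF U(1)] smooth_on_id)
    from fam_on_chart_fun[OF U(1) chart(2)[OF U(1)] order_refl this]
    have "fam_on A (UNIV \<times> U) (\<lambda>z. \<phi> (snd z) $ i)" by (rule fam_on_subset) auto
    from smooth_fun_glue[OF chart(1)[OF U(1)] b(5,6) fam_on_mult[OF oU fam_on_snd[OF b(1)] this]]
    show ?thesis unfolding x_def using b(8) by auto
  qed
  have xW: "x i q = \<phi> q $ i" if "q \<in> W" for i q
    using that b unfolding x_def by auto
  have WU: "W \<subseteq> U" using b(4,6) by auto
  show ?thesis
    by (rule that[OF U(1) b x tangent_coord_expansion[OF U(1) subsetD[OF WU] x b(2) _ WU xW]])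
qed

text \<open>A chart-free interface: global functions \<open>x i\<close> and global fields
  \<open>E i\<close> that are dual near p. The last clause records joint smoothness when a frame
  field acts on the slices of a time-dependent function; it yields the limits as t tends to 0 in the
  study of inverse isotopies.\<close>

lemma local_frame:
  obtains W x E where "open W" "p \<in> W" "\<And>i::'n. smooth_fun A (x i)" "\<And>i. E i \<in> sections A T"
    "\<And>q v. q \<in> W \<Longrightarrow> v \<in> T q \<Longrightarrow> v = (\<lambda>f. \<Sum>i\<in>UNIV. v (x i) * E i q f)"
    "\<And>J g i. open J \<Longrightarrow> fam_on A (J \<times> UNIV) g \<Longrightarrow> fam_on A (J \<times> W) (\<lambda>(t, q). E i q (\<lambda>q. g (t, q)))"
proof -
  obtain U \<phi> \<beta> W K x where U: "(U, \<phi>) \<in> A" and b: "smooth_fun A \<beta>" "open W" "p \<in> W" "W \<subseteq> K" "closed K" "K \<subseteq> U"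
    "\<And>q. q \<in> W \<Longrightarrow> \<beta> q = (1::real)" "\<And>q. q \<notin> K \<Longrightarrow> \<beta> q = 0" and x: "\<And>i::'n. smooth_fun A (x i)"
    and e: "\<And>q v. q \<in> W \<Longrightarrow> v \<in> T q \<Longrightarrow> v = (\<lambda>f. \<Sum>i\<in>UNIV. v (x i) * coord_field U \<phi> i q f)"
    by (rule chart_coordinates[of p]) (rule that)
  define E where "E i q f = \<beta> q * coord_field U \<phi> i q f" for i q f
  show ?thesis
  proof (rule that[OF b(2,3) x])
    show "E i \<in> sections A T" for i
      unfolding E_def by (rule sections_coord_field[OF U b(1,5,6,8)])
    show "v = (\<lambda>f. \<Sum>i\<in>UNIV. v (x i) * E i q f)" if q: "q \<in> W" and v: "v \<in> T q" for q v
      using e[OF q v] b(7)[OF q] unfolding E_def by simp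
    show "fam_on A (J \<times> W) (\<lambda>(t, q). E i q (\<lambda>q. g (t, q)))"
      if J: "open J" and g: "fam_on A (J \<times> UNIV) g" for J g i
    proof (rule fam_on_cong)
      show "open (J \<times> W)" using J b(2) by (rule open_Times)
      show "fam_on A (J \<times> W) (\<lambda>(t, q). coord_field U \<phi> i q (\<lambda>q. g (t, q)))"
        by (rule fam_on_subset[OF fam_on_coord_field[OF U J g]]) (use b in auto)
    qed (auto simp: E_def b(7))
  qed
qed

text \<open>Constant coefficients in a local frame suffice, as only the value at p matters. The
  definite description in \<open>ext_d1\<close> relies on such sections existing.\<close>

lemma section_through:
  assumes "v \<in> T p" obtains X where "X \<in> sections A T" "X p = v"
proof -
  obtain W x E where F: "p \<in> W" "\<And>i::'n. E i \<in> sections A T"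
    "\<And>q v. q \<in> W \<Longrightarrow> v \<in> T q \<Longrightarrow> v = (\<lambda>f. \<Sum>i\<in>UNIV. v (x i) * E i q f)"
    by (rule local_frame[of p]) (rule that)
  have "(\<lambda>q f. \<Sum>i\<in>UNIV. v (x i) * E i q f) \<in> sections A T"
    by (intro sections_sum sections_scale F smooth_fun_const)
  then show ?thesis by (rule that) (use F(3)[OF F(1) assms] in simp)
qed

subsection \<open>Lie brackets\<close>

lemma lie_bracket_section:
  assumes X: "X \<in> sections A T" and Y: "Y \<in> sections A T" shows "lie_bracket X Y \<in> sections A T"
proof (rule sectionsI)
  note XT = sections_tangent[OF X] and YT = sections_tangent[OF Y]
  note Xs = sections_smooth[OF X] and Ys = sections_smooth[OF Y]
  fix p
  have 1: "lie_bracket X Y p (\<lambda>q. a * f q + b * g q) = a * lie_bracket X Y p f + b * lie_bracket X Y p g"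
    if f: "smooth_fun A f" and g: "smooth_fun A g" for f g a b
  proof -
    have "(\<lambda>q. Y q (\<lambda>q. a * f q + b * g q)) = (\<lambda>q. a * Y q f + b * Y q g)"
      "(\<lambda>q. X q (\<lambda>q. a * f q + b * g q)) = (\<lambda>q. a * X q f + b * X q g)"
      using T_lin[OF XT f g] T_lin[OF YT f g] by auto
    then show ?thesis
      by (simp add: lie_bracket_def T_lin[OF XT Ys[OF f] Ys[OF g]] T_lin[OF YT Xs[OF f] Xs[OF g]] algebra_simps)
  qed
  have 2: "lie_bracket X Y p (\<lambda>q. f q * g q) = f p * lie_bracket X Y p g + g p * lie_bracket X Y p f"
    if f: "smooth_fun A f" and g: "smooth_fun A g" for f g
  proof -
    have e: "(\<lambda>q. Y q (\<lambda>q. f q * g q)) = (\<lambda>q. f q * Y q g + g q * Y q f)"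
      "(\<lambda>q. X q (\<lambda>q. f q * g q)) = (\<lambda>q. f q * X q g + g q * X q f)"
      using T_mult[OF XT f g] T_mult[OF YT f g] by auto
    show ?thesis
      unfolding lie_bracket_def e
      by (simp add: T_add[OF XT] T_add[OF YT] T_mult[OF XT] T_mult[OF YT] smooth_fun_mult f g Xs Ys algebra_simps)
  qed
  have 3: "lie_bracket X Y p f = 0" if f: "\<not> smooth_fun A f" for f
  proof -
    have "(\<lambda>q. Y q f) = (\<lambda>q. 0)" "(\<lambda>q. X q f) = (\<lambda>q. 0)"
      using T_nonsmooth[OF XT f] T_nonsmooth[OF YT f] by auto
    then show ?thesis by (simp add: lie_bracket_def T_const[OF XT] T_const[OF YT])
  qed
  show "lie_bracket X Y p \<in> T p \<inter> T p" unfolding tangent_space_def using 1 2 3 by auto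
next
  show "smooth_fun A (\<lambda>p. lie_bracket X Y p f)" if "smooth_fun A f" for f
    unfolding lie_bracket_def by (intro smooth_fun_diff sections_smooth[OF X] sections_smooth[OF Y] that)
qed

lemma lie_bracket_skew: "lie_bracket X Y p = (\<lambda>f. - lie_bracket Y X p f)"
  by (auto simp: lie_bracket_def)

lemma Jacobi:
  assumes X: "X \<in> sections A T" and Y: "Y \<in> sections A T" and Z: "Z \<in> sections A T"
  shows "lie_bracket (lie_bracket X Y) Z p =
    (\<lambda>f. lie_bracket X (lie_bracket Y Z) p f - lie_bracket Y (lie_bracket X Z) p f)"
proof
  fix f
  note s = sections_smooth[OF X] sections_smooth[OF Y] sections_smooth[OF Z]
  note t = sections_tangent[OF X] sections_tangent[OF Y] sections_tangent[OF Z]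
  show "lie_bracket (lie_bracket X Y) Z p f = lie_bracket X (lie_bracket Y Z) p f - lie_bracket Y (lie_bracket X Z) p f"
  proof (cases "smooth_fun A f")
    case True
    then show ?thesis
      by (simp add: lie_bracket_def T_diff[OF t(1)] T_diff[OF t(2)] T_diff[OF t(3)] s)
  next
    case False
    have J: "lie_bracket (lie_bracket X Y) Z \<in> sections A T" "lie_bracket X (lie_bracket Y Z) \<in> sections A T"
       "lie_bracket Y (lie_bracket X Z) \<in> sections A T"
      by (intro lie_bracket_section X Y Z)+
    show ?thesis by (simp add: T_nonsmooth[OF sections_tangent False, OF J(1)]
          T_nonsmooth[OF sections_tangent False, OF J(2)] T_nonsmooth[OF sections_tangent False, OF J(3)])
  qed
qed

subsection \<open>One-forms and their differential\<close>

lemma form_lin: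
  "\<omega> \<in> forms1 A D \<Longrightarrow> v \<in> D p \<Longrightarrow> w \<in> D p \<Longrightarrow> \<omega> p (\<lambda>f. a * v f + b * w f) = a * \<omega> p v + b * \<omega> p w"
  by (simp add: forms1_def)

lemma form_smooth: "\<omega> \<in> forms1 A D \<Longrightarrow> X \<in> sections A D \<Longrightarrow> smooth_fun A (\<lambda>p. \<omega> p (X p))"
  by (simp add: forms1_def)

lemma form_outside: "\<omega> \<in> forms1 A D \<Longrightarrow> v \<notin> D p \<Longrightarrow> \<omega> p v = 0"
  by (simp add: forms1_def)

lemma form_scale: "\<omega> \<in> forms1 A D \<Longrightarrow> v \<in> D p \<Longrightarrow> \<omega> p (\<lambda>f. a * v f) = a * \<omega> p v"
  using form_lin[of \<omega> D v p v a 0] by simp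

lemma form_add: "\<omega> \<in> forms1 A D \<Longrightarrow> v \<in> D p \<Longrightarrow> w \<in> D p \<Longrightarrow> \<omega> p (\<lambda>f. v f + w f) = \<omega> p v + \<omega> p w"
  using form_lin[of \<omega> D v p w 1 1] by simp

lemma form_diff: "\<omega> \<in> forms1 A D \<Longrightarrow> v \<in> D p \<Longrightarrow> w \<in> D p \<Longrightarrow> \<omega> p (\<lambda>f. v f - w f) = \<omega> p v - \<omega> p w"
  using form_lin[of \<omega> D v p w 1 "-1"] by simp

lemma form_minus: "\<omega> \<in> forms1 A D \<Longrightarrow> v \<in> D p \<Longrightarrow> \<omega> p (\<lambda>f. - v f) = - \<omega> p v"
  using form_scale[of \<omega> D v p "-1"] by simp

lemma form_zero: "\<omega> \<in> forms1 A T \<Longrightarrow> \<omega> p (\<lambda>f. 0) = 0"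
  using form_scale[of \<omega> T "\<lambda>f. 0" p 0] T_zero by simp

lemma form_sum:
  assumes "\<omega> \<in> forms1 A T" "\<And>i. i \<in> I \<Longrightarrow> v i \<in> T p"
  shows "\<omega> p (\<lambda>f. \<Sum>i\<in>I. c i * v i f) = (\<Sum>i\<in>I. c i * \<omega> p (v i))"
  using assms(2)
proof (induction I rule: infinite_finite_induct)
  case (insert x F)
  then show ?case
    using form_lin[OF assms(1), of "v x" p "\<lambda>f. \<Sum>i\<in>F. c i * v i f" "c x" 1] by (simp add: T_sum_vec)
qed (auto simp: form_zero[OF assms(1)])

definition koszul :: "'a form1 \<Rightarrow> ('a \<Rightarrow> 'a tvec) \<Rightarrow> ('a \<Rightarrow> 'a tvec) \<Rightarrow> 'a \<Rightarrow> real" where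
  "koszul \<omega> X Y p = X p (\<lambda>q. \<omega> q (Y q)) - Y p (\<lambda>q. \<omega> q (X q)) - \<omega> p (lie_bracket X Y p)"

lemma koszul_skew:
  assumes "\<omega> \<in> forms1 A T" "X \<in> sections A T" "Y \<in> sections A T"
  shows "koszul \<omega> Y X p = - koszul \<omega> X Y p"
  using form_minus[OF assms(1) sections_tangent[OF lie_bracket_section[OF assms(2,3)]]]
  by (simp add: koszul_def lie_bracket_skew[of Y X])

lemma koszul_comb:
  assumes w: "\<omega> \<in> forms1 A T" and X: "X \<in> sections A T" and X': "X' \<in> sections A T" and Y: "Y \<in> sections A T"
  shows "koszul \<omega> (\<lambda>p h. a * X p h + b * X' p h) Y p = a * koszul \<omega> X Y p + b * koszul \<omega> X' Y p"
proof -
  have "lie_bracket (\<lambda>p h. a * X p h + b * X' p h) Y p = (\<lambda>f. a * lie_bracket X Y p f + b * lie_bracket X' Y p f)"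
  proof
    fix f
    have Yf: "Y p (\<lambda>q. a * X q f + b * X' q f) = a * Y p (\<lambda>q. X q f) + b * Y p (\<lambda>q. X' q f)"
    proof (cases "smooth_fun A f")
      case True
      then show ?thesis
        using T_lin[OF sections_tangent[OF Y]] sections_smooth[OF X] sections_smooth[OF X'] by simp
    next
      case False
      then show ?thesis
        using T_nonsmooth[OF sections_tangent[OF X]] T_nonsmooth[OF sections_tangent[OF X']]
          T_const[OF sections_tangent[OF Y]] by simp
    qed
    show "lie_bracket (\<lambda>p h. a * X p h + b * X' p h) Y p f = a * lie_bracket X Y p f + b * lie_bracket X' Y p f"
      by (simp add: lie_bracket_def Yf algebra_simps)
  qed
  then have "\<omega> p (lie_bracket (\<lambda>p h. a * X p h + b * X' p h) Y p)
      = a * \<omega> p (lie_bracket X Y p) + b * \<omega> p (lie_bracket X' Y p)"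
    using form_lin[OF w sections_tangent[OF lie_bracket_section[OF X Y]] sections_tangent[OF lie_bracket_section[OF X' Y]]]
    by simp
  moreover have "(\<lambda>q. \<omega> q (\<lambda>h. a * X q h + b * X' q h)) = (\<lambda>q. a * \<omega> q (X q) + b * \<omega> q (X' q))"
    using form_lin[OF w sections_tangent[OF X] sections_tangent[OF X']] by auto
  ultimately show ?thesis
    using T_lin[OF sections_tangent[OF Y] form_smooth[OF w X] form_smooth[OF w X']]
    by (simp add: koszul_def algebra_simps)
qed

text \<open>In a local frame, X p = 0 removes every term without a derivative of the coefficients
  X(x_i). The remaining terms Y(X(x_i)) \<omega>(E_i) arise from Y(\<omega>(X)) and from
  \<omega>([X,Y]), and the two contributions cancel.\<close>

lemma koszul_tensorial:
  assumes w: "\<omega> \<in> forms1 A T" and X: "X \<in> sections A T" and Y: "Y \<in> sections A T" and 0: "X p = (\<lambda>f. 0)"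
  shows "koszul \<omega> X Y p = 0"
proof -
  obtain W x E where F: "open W" "p \<in> W" "\<And>i::'n. smooth_fun A (x i)" "\<And>i. E i \<in> sections A T"
    "\<And>q v. q \<in> W \<Longrightarrow> v \<in> T q \<Longrightarrow> v = (\<lambda>f. \<Sum>i\<in>UNIV. v (x i) * E i q f)"
    by (rule local_frame[of p]) (rule that)
  have exp: "\<omega> q v = (\<Sum>i\<in>UNIV. v (x i) * \<omega> q (E i q))" if "q \<in> W" "v \<in> T q" for q v
    using arg_cong[OF F(5)[OF that], of "\<omega> q"] form_sum[OF w sections_tangent[OF F(4)]] by (rule trans)
  note YT = sections_tangent[OF Y]
  have sm: "smooth_fun A (\<lambda>q. X q (x i))" "smooth_fun A (\<lambda>q. \<omega> q (E i q))" for i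
    using sections_smooth[OF X F(3)] form_smooth[OF w F(4)] by auto
  have "Y p (\<lambda>q. \<omega> q (X q)) = Y p (\<lambda>q. \<Sum>i\<in>UNIV. X q (x i) * \<omega> q (E i q))"
    by (rule T_local[OF YT form_smooth[OF w X] _ F(1,2)])
      (auto intro!: smooth_fun_sum smooth_fun_mult sm exp sections_tangent[OF X])
  also have "\<dots> = (\<Sum>i\<in>UNIV. Y p (\<lambda>q. X q (x i)) * \<omega> p (E i p))"
    by (simp add: T_sum[OF YT] T_mult[OF YT] smooth_fun_mult sm 0 mult.commute)
  finally have 1: "Y p (\<lambda>q. \<omega> q (X q)) = (\<Sum>i\<in>UNIV. Y p (\<lambda>q. X q (x i)) * \<omega> p (E i p))" .
  have "\<omega> p (lie_bracket X Y p) = (\<Sum>i\<in>UNIV. lie_bracket X Y p (x i) * \<omega> p (E i p))"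
    by (rule exp[OF F(2) sections_tangent[OF lie_bracket_section[OF X Y]]])
  also have "\<dots> = - (\<Sum>i\<in>UNIV. Y p (\<lambda>q. X q (x i)) * \<omega> p (E i p))"
    by (simp add: lie_bracket_def 0 sum_negf)
  finally show ?thesis using 1 by (simp add: koszul_def 0)
qed

text \<open>By linearity a difference of two sections with the same value at p falls under the
  tensorial case; skew symmetry carries this from the first argument to the second.\<close>

lemma koszul_cong:
  assumes w: "\<omega> \<in> forms1 A T" and X: "X \<in> sections A T" "X' \<in> sections A T" and Y: "Y \<in> sections A T" "Y' \<in> sections A T"
    and eq: "X p = X' p" "Y p = Y' p"
  shows "koszul \<omega> X Y p = koszul \<omega> X' Y' p"
proof -
  have *: "koszul \<omega> X Y p = koszul \<omega> X' Y p"
    if "X \<in> sections A T" "X' \<in> sections A T" "Y \<in> sections A T" "X p = X' p" for X X' Y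
    using koszul_tensorial[OF w sections_diff[OF that(1,2)] that(3), of p] that(4)
      koszul_comb[OF w that(1-3), of 1 "-1" p] by simp
  show ?thesis
    using *[OF X Y(1) eq(1)] *[OF Y X(2) eq(2)] koszul_skew[OF w X(2) Y(1), of p] koszul_skew[OF w X(2) Y(2), of p]
    by simp
qed

abbreviation "d1 \<equiv> ext_d1 A T"

text \<open>This settles the definite description once and for all: from here on the differential
  can be computed with any sections through the two vectors.\<close>

lemma ext_d1_eq:
  assumes w: "\<omega> \<in> forms1 A T" and X: "X \<in> sections A T" and Y: "Y \<in> sections A T"
  shows "d1 \<omega> p (X p) (Y p) = koszul \<omega> X Y p"
proof -
  have "(THE c. \<exists>X'\<in>sections A T. \<exists>Y'\<in>sections A T. X' p = X p \<and> Y' p = Y p \<and>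
      c = X' p (\<lambda>q. \<omega> q (Y' q)) - Y' p (\<lambda>q. \<omega> q (X' q)) - \<omega> p (lie_bracket X' Y' p)) = koszul \<omega> X Y p"
    unfolding koszul_def[symmetric]
  proof (rule the_equality)
    show "\<exists>X'\<in>sections A T. \<exists>Y'\<in>sections A T. X' p = X p \<and> Y' p = Y p \<and> koszul \<omega> X Y p = koszul \<omega> X' Y' p"
      using X Y by blast
    show "c = koszul \<omega> X Y p"
      if "\<exists>X'\<in>sections A T. \<exists>Y'\<in>sections A T. X' p = X p \<and> Y' p = Y p \<and> c = koszul \<omega> X' Y' p" for c
      using that koszul_cong[OF w _ X _ Y] by blast
  qed
  then show ?thesis using sections_tangent[OF X] sections_tangent[OF Y] by (simp add: ext_d1_def)
qed

lemma ext_d1_outside: "v \<notin> D p \<or> w \<notin> D p \<Longrightarrow> ext_d1 A D \<omega> p v w = 0"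
  by (auto simp: ext_d1_def)

lemma ext_d1_skew:
  assumes "\<omega> \<in> forms1 A T" "v \<in> T p" "w \<in> T p" shows "d1 \<omega> p w v = - d1 \<omega> p v w"
proof -
  obtain X Y where "X \<in> sections A T" "X p = v" "Y \<in> sections A T" "Y p = w"
    using section_through assms(2,3) by metis
  then show ?thesis using ext_d1_eq[OF assms(1)] koszul_skew[OF assms(1)] by metis
qed

lemma ext_d1_comb_left:
  assumes "\<omega> \<in> forms1 A T" "v \<in> T p" "v' \<in> T p" "w \<in> T p"
  shows "d1 \<omega> p (\<lambda>f. a * v f + b * v' f) w = a * d1 \<omega> p v w + b * d1 \<omega> p v' w"
proof -
  obtain X X' Y where X: "X \<in> sections A T" "X p = v" "X' \<in> sections A T" "X' p = v'" "Y \<in> sections A T" "Y p = w"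
    using section_through assms(2-4) by metis
  have "(\<lambda>p h. a * X p h + b * X' p h) \<in> sections A T"
    by (rule sections_comb) (use X in auto)
  from ext_d1_eq[OF assms(1) this X(5), of p]
  have "d1 \<omega> p (\<lambda>h. a * X p h + b * X' p h) (Y p) = a * d1 \<omega> p (X p) (Y p) + b * d1 \<omega> p (X' p) (Y p)"
    by (simp only: koszul_comb[OF assms(1) X(1,3,5)] ext_d1_eq[OF assms(1) X(1,5)] ext_d1_eq[OF assms(1) X(3,5)])
  then show ?thesis by (simp only: X)
qed

lemma ext_d1_comb_right:
  assumes "\<omega> \<in> forms1 A T" "v \<in> T p" "v' \<in> T p" "w \<in> T p"
  shows "d1 \<omega> p w (\<lambda>f. a * v f + b * v' f) = a * d1 \<omega> p w v + b * d1 \<omega> p w v'"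
  using ext_d1_comb_left[OF assms, of a b] ext_d1_skew[OF assms(1,2,4)] ext_d1_skew[OF assms(1,3,4)]
    ext_d1_skew[OF assms(1) T_comb[OF assms(2,3), of a b] assms(4)]
  by simp

lemma ext_d1_smooth:
  assumes "\<omega> \<in> forms1 A T" "X \<in> sections A T" "Y \<in> sections A T"
  shows "smooth_fun A (\<lambda>p. d1 \<omega> p (X p) (Y p))"
  unfolding ext_d1_eq[OF assms] koszul_def
  by (intro smooth_fun_diff sections_smooth[OF assms(2)] sections_smooth[OF assms(3)] form_smooth[OF assms(1)]
      lie_bracket_section assms)

end

section \<open>Pullbacks of one-forms\<close>

lemma differential_tangent:
  fixes A :: "('a::t2_space, 'n::finite) atlas" and B :: "('b::t2_space, 'm::finite) atlas"
  assumes "smooth_atlas A" "smooth_atlas B" "smooth_map A B F" "v \<in> tangent_space A p"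
  shows "differential B F v \<in> tangent_space B (F p)"
proof -
  interpret A: manifold A by standard (rule assms)
  interpret B: manifold B by standard (rule assms)
  note s = smooth_fun_smooth_map[OF assms(1-3)]
  show ?thesis
    unfolding tangent_space_def differential_def
    using A.T_lin[OF assms(4) s s] A.T_mult[OF assms(4) s s]
    by (auto simp: B.smooth_fun_add B.smooth_fun_cmult B.smooth_fun_mult)
qed

text \<open>Smoothness is the point. In a frame of the target around F(p), the pullback on X is the
  sum of X(x_i o F) times \<omega>(E_i) o F, and both factors are smooth.\<close>

lemma pullback_form:
  fixes A :: "('a::t2_space, 'n::finite) atlas" and B :: "('b::t2_space, 'm::finite) atlas"
  assumes "smooth_atlas A" "smooth_atlas B" "smooth_map A B F" and w: "\<omega> \<in> forms1 B (tangent_space B)"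
  shows "pullback1 A B F \<omega> \<in> forms1 A (tangent_space A)"
proof -
  interpret A: manifold A by standard (rule assms)
  interpret B: manifold B by standard (rule assms)
  note s = smooth_fun_smooth_map[OF assms(1-3)]
  note dT = differential_tangent[OF assms(1-3)]
  have lin: "differential B F (\<lambda>f. a * v f + b * u f) = (\<lambda>f. a * differential B F v f + b * differential B F u f)"
    for a b v u by (auto simp: differential_def)
  have "smooth_fun A (\<lambda>p. pullback1 A B F \<omega> p (X p))" if X: "X \<in> sections A A.T" for X
  proof (rule A.smooth_fun_local)
    fix p
    obtain W x E where f: "open W" "F p \<in> W" "\<And>i::'m. smooth_fun B (x i)" "\<And>i. E i \<in> sections B B.T"
      "\<And>q v. q \<in> W \<Longrightarrow> v \<in> B.T q \<Longrightarrow> v = (\<lambda>f. \<Sum>i\<in>UNIV. v (x i) * E i q f)"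
      by (rule B.local_frame[of "F p"]) (rule that)
    let ?g = "\<lambda>q. \<Sum>i\<in>UNIV. X q (\<lambda>q. x i (F q)) * \<omega> (F q) (E i (F q))"
    have "continuous_on UNIV F" using assms(3) by (simp add: smooth_map_def)
    then have "open (F -` W)" using f(1) by (rule open_vimage[rotated])
    moreover have "smooth_fun A ?g"
      by (intro A.smooth_fun_sum A.smooth_fun_mult A.sections_smooth[OF X] s f(3) s[OF B.form_smooth[OF w f(4)]])
    moreover have "pullback1 A B F \<omega> q (X q) = ?g q" if q: "q \<in> F -` W" for q
    proof -
      let ?v = "differential B F (X q)"
      have v: "?v \<in> B.T (F q)" by (rule dT[OF A.sections_tangent[OF X]])
      have "\<omega> (F q) ?v = \<omega> (F q) (\<lambda>f. \<Sum>i\<in>UNIV. ?v (x i) * E i (F q) f)"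
        by (rule arg_cong[OF f(5)[OF _ v]]) (use q in simp)
      also have "\<dots> = (\<Sum>i\<in>UNIV. ?v (x i) * \<omega> (F q) (E i (F q)))"
        by (rule B.form_sum[OF w B.sections_tangent[OF f(4)]])
      finally show ?thesis
        using A.sections_tangent[OF X] f(3) by (simp add: pullback1_def differential_def)
    qed
    ultimately show "\<exists>N g. open N \<and> p \<in> N \<and> smooth_fun A g \<and> (\<forall>q\<in>N. pullback1 A B F \<omega> q (X q) = g q)"
      using f(2) by (intro exI[of _ "F -` W"] exI[of _ ?g]) auto
  qed
  then show ?thesis
    unfolding forms1_def pullback1_def
    by (auto simp: lin A.T_comb B.form_lin[OF w dT dT])
qed

section \<open>The foliation of a coisotropic form\<close>

locale foliation = manifold A for A :: "('a::t2_space, 'n::finite) atlas" +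
  fixes lam :: "'a form1" and L :: "'a dist"
  assumes lam: "lam \<in> forms1 A (tangent_space A)"
    and cois: "coisotropic A lam"
    and nz: "nowhere_zero A lam"
    and line: "line_field A L"
    and trans: "transverse A L (ker_form A lam)"
begin

section \<open>The normalized transverse field and the splitting of the tangent spaces\<close>

abbreviation F :: "'a dist" where "F \<equiv> ker_form A lam"

lemma F_iff: "v \<in> F p \<longleftrightarrow> v \<in> T p \<and> lam p v = 0"
  by (simp add: ker_form_def)

text \<open>If \<lambda> vanished on a spanning vector of L at q, it would vanish on L + ker
  \<lambda>, which by transversality is the whole tangent space; but \<lambda> is nowhere
  zero.\<close>

lemma line_span:
  obtains U X where "open U" "p \<in> U" "X \<in> sections A T" "\<And>q. q \<in> U \<Longrightarrow> L q = {(\<lambda>f. c * X q f) | c. True}"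
    "\<And>q. q \<in> U \<Longrightarrow> lam q (X q) \<noteq> 0"
proof -
  obtain U X where U: "open U" "p \<in> U" "X \<in> sections A T" "\<forall>q\<in>U. X q \<noteq> (\<lambda>f. 0) \<and> L q = {(\<lambda>f. c * X q f) | c. True}"
    using line unfolding line_field_def by blast
  have "lam q (X q) \<noteq> 0" if q: "q \<in> U" for q
  proof
    assume 0: "lam q (X q) = 0"
    obtain v where v: "v \<in> T q" "lam q v \<noteq> 0" using nz by (auto simp: nowhere_zero_def)
    then obtain l w where lw: "l \<in> L q" "w \<in> F q" "v = (\<lambda>f. l f + w f)"
      using trans by (auto simp: transverse_def)
    then obtain c where c: "l = (\<lambda>f. c * X q f)" using U(4) q by auto
    have "l \<in> T q" "lam q l = 0"
      unfolding c using T_scale[OF sections_tangent[OF U(3)]] form_scale[OF lam sections_tangent[OF U(3)]] 0 by auto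
    then show False using v lw form_add[OF lam, of l q w] by (simp add: F_iff)
  qed
  then show ?thesis using that U by blast
qed

definition \<nu> :: "'a \<Rightarrow> 'a tvec" where
  "\<nu> p = (THE v. v \<in> L p \<and> lam p v = 1)"

lemma \<nu>_eq:
  assumes X: "X q \<in> T q" and L: "L q = {(\<lambda>f. c * X q f) | c. True}" "lam q (X q) \<noteq> 0"
  shows "\<nu> q = (\<lambda>f. X q f / lam q (X q))"
  unfolding \<nu>_def
proof (rule the_equality)
  show "(\<lambda>f. X q f / lam q (X q)) \<in> L q \<and> lam q (\<lambda>f. X q f / lam q (X q)) = 1"
    using form_scale[OF lam X, of "inverse (lam q (X q))"] L
    by (auto simp: divide_inverse mult.commute intro!: exI[of _ "inverse (lam q (X q))"])
  show "v = (\<lambda>f. X q f / lam q (X q))" if "v \<in> L q \<and> lam q v = 1" for v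
  proof -
    have "v \<in> {(\<lambda>f. c * X q f) | c. True}" using that L(1) by (simp only:)
    then obtain c where c: "v = (\<lambda>f. c * X q f)" by blast
    then have "c = inverse (lam q (X q))" using that form_scale[OF lam X, of c] L(2) by (simp add: field_simps)
    then show ?thesis using c by (simp add: divide_inverse mult.commute)
  qed
qed

text \<open>The local spanning fields of L are ambiguous up to scale. Dividing each by its
  \<lambda>-value removes the ambiguity, so the normalized fields agree on overlaps and form one
  global smooth field.\<close>

lemma \<nu>_section: "\<nu> \<in> sections A T"
  and lam_\<nu>: "lam p (\<nu> p) = 1"
  and L_span: "L p = {(\<lambda>f. c * \<nu> p f) | c. True}"
proof -
  have 1: "\<nu> p \<in> T p \<and> lam p (\<nu> p) = 1 \<and> L p = {(\<lambda>f. c * \<nu> p f) | c. True}" for p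
  proof -
    obtain U X where U: "open U" "p \<in> U" "X \<in> sections A T" "\<And>q. q \<in> U \<Longrightarrow> L q = {(\<lambda>f. c * X q f) | c. True}"
      "\<And>q. q \<in> U \<Longrightarrow> lam q (X q) \<noteq> 0"
      by (rule line_span[of p]) (rule that)
    note XT = sections_tangent[OF U(3), of p]
    have n: "\<nu> p = (\<lambda>f. inverse (lam p (X p)) * X p f)"
      using \<nu>_eq[of X p, OF XT U(4)[OF U(2)] U(5)[OF U(2)]] by (simp add: divide_inverse mult.commute)
    have e1: "(\<lambda>f. c * X p f) = (\<lambda>f. (c * lam p (X p)) * \<nu> p f)" for c
      using U(5)[OF U(2)] by (simp add: n mult.assoc[symmetric] fun_eq_iff)
    have e2: "(\<lambda>f. c * \<nu> p f) = (\<lambda>f. (c * inverse (lam p (X p))) * X p f)" for c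
      by (simp add: n mult.assoc)
    have "L p = {(\<lambda>f. c * \<nu> p f) | c. True}"
    proof (intro equalityI subsetI)
      fix v assume "v \<in> L p"
      then obtain c where "v = (\<lambda>f. c * X p f)" unfolding U(4)[OF U(2)] by blast
      then show "v \<in> {(\<lambda>f. c * \<nu> p f) | c. True}" unfolding e1 by blast
    next
      fix v assume "v \<in> {(\<lambda>f. c * \<nu> p f) | c. True}"
      then obtain c where "v = (\<lambda>f. c * \<nu> p f)" by blast
      then show "v \<in> L p" unfolding e2 U(4)[OF U(2)] by blast
    qed
    then show ?thesis
      using form_scale[OF lam XT, of "inverse (lam p (X p))"] T_scale[OF XT] U(5)[OF U(2)] by (simp add: n)
  qed
  show "\<nu> \<in> sections A T"
  proof (rule sectionsI)
    fix f assume f: "smooth_fun A f"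
    show "smooth_fun A (\<lambda>p. \<nu> p f)"
    proof (rule smooth_fun_local)
      fix p
      obtain U X where U: "open U" "p \<in> U" "X \<in> sections A T" "\<And>q. q \<in> U \<Longrightarrow> L q = {(\<lambda>f. c * X q f) | c. True}"
        "\<And>q. q \<in> U \<Longrightarrow> lam q (X q) \<noteq> 0"
        by (rule line_span[of p]) (rule that)
      have oU: "open (UNIV \<times> U :: (real \<times> 'a) set)" using U(1) by (simp add: open_Times)
      have "fam_on A (UNIV \<times> U) (\<lambda>z. X (snd z) f / lam (snd z) (X (snd z)))"
        by (rule fam_on_divide[OF oU fam_on_snd[OF sections_smooth[OF U(3) f]] fam_on_snd[OF form_smooth[OF lam U(3)]]])
          (use U(5) in auto)
      then obtain g W where g: "smooth_fun A g" "open W" "p \<in> W" "W \<subseteq> U"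
        "\<And>q. q \<in> W \<Longrightarrow> g q = X q f / lam q (X q)"
        by (rule smooth_extension[OF U(1,2), of "\<lambda>q. X q f / lam q (X q)"]) (rule that)
      moreover have "\<nu> q f = g q" if "q \<in> W" for q
        using \<nu>_eq[of X q, OF sections_tangent[OF U(3)] U(4) U(5)] g(4,5) that by auto
      ultimately show "\<exists>N g. open N \<and> p \<in> N \<and> smooth_fun A g \<and> (\<forall>q\<in>N. \<nu> q f = g q)" by blast
    qed
  qed (use 1 in simp)
  show "lam p (\<nu> p) = 1" "L p = {(\<lambda>f. c * \<nu> p f) | c. True}" using 1 by auto
qed

lemma \<nu>_tangent: "\<nu> p \<in> T p"
  by (rule sections_tangent[OF \<nu>_section])

definition pr :: "'a \<Rightarrow> 'a tvec \<Rightarrow> 'a tvec" where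
  "pr p v = (\<lambda>f. v f - lam p v * \<nu> p f)"

lemma pr_in: assumes "v \<in> T p" shows "pr p v \<in> F p" "pr p v \<in> T p" "lam p (pr p v) = 0"
proof -
  show t: "pr p v \<in> T p" unfolding pr_def by (intro T_minus_vec assms T_scale \<nu>_tangent)
  show l: "lam p (pr p v) = 0"
    unfolding pr_def
    using form_diff[OF lam assms T_scale[OF \<nu>_tangent], of "lam p v"] form_scale[OF lam \<nu>_tangent] lam_\<nu> by simp
  show "pr p v \<in> F p" using t l by (simp add: F_iff)
qed

lemma pr_id: "v \<in> F p \<Longrightarrow> pr p v = v"
  by (simp add: pr_def F_iff)

lemma pr_\<nu>: "pr p (\<nu> p) = (\<lambda>f. 0)"
  by (simp add: pr_def lam_\<nu>)

lemma pr_decomp: "v = (\<lambda>f. 1 * pr p v f + lam p v * \<nu> p f)"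
  by (simp add: pr_def)

lemma pr_comb:
  "v \<in> T p \<Longrightarrow> w \<in> T p \<Longrightarrow> pr p (\<lambda>f. a * v f + b * w f) = (\<lambda>f. a * pr p v f + b * pr p w f)"
  using form_lin[OF lam, of v p w a b] by (auto simp: pr_def algebra_simps)

lemma F_comb: "v \<in> F p \<Longrightarrow> w \<in> F p \<Longrightarrow> (\<lambda>f. a * v f + b * w f) \<in> F p"
  using form_lin[OF lam, of v p w a b] by (simp add: F_iff T_comb)

lemma F_T: "v \<in> F p \<Longrightarrow> v \<in> T p"
  by (simp add: F_iff)

lemma proj_along_eq:
  assumes v: "v \<in> T p" shows "proj_along L F p v = pr p v"
  unfolding proj_along_def
proof (rule the_equality)
  show "pr p v \<in> F p \<and> (\<lambda>f. v f - pr p v f) \<in> L p"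
    using pr_in[OF v] by (auto simp: L_span pr_def)
  fix w assume w: "w \<in> F p \<and> (\<lambda>f. v f - w f) \<in> L p"
  then obtain c where c: "(\<lambda>f. v f - w f) = (\<lambda>f. c * \<nu> p f)" by (auto simp: L_span)
  have "lam p (\<lambda>f. v f - w f) = lam p v" using form_diff[OF lam v] w by (simp add: F_iff)
  then have "c = lam p v" unfolding c using form_scale[OF lam \<nu>_tangent] lam_\<nu> by simp
  show "w = pr p v"
  proof
    fix f show "w f = pr p v f"
      using fun_cong[OF c, of f] \<open>c = lam p v\<close> by (simp add: pr_def)
  qed
qed

section \<open>Extended forms, integrability and the leafwise differential\<close>

abbreviation ext :: "'a form1 \<Rightarrow> 'a form1" where "ext \<equiv> extend1 A L F"

lemma ext_eq: "ext \<zeta> p v = (if v \<in> T p then \<zeta> p (pr p v) else 0)"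
  by (simp add: extend1_def proj_along_eq)

lemma ext_on_F: "v \<in> F p \<Longrightarrow> ext \<zeta> p v = \<zeta> p v"
  by (simp add: ext_eq F_T pr_id)

lemma section_pr: assumes "X \<in> sections A T" shows "(\<lambda>p. pr p (X p)) \<in> sections A F"
proof -
  have "(\<lambda>p. pr p (X p)) \<in> sections A T"
    unfolding pr_def by (intro sections_diff assms sections_scale \<nu>_section form_smooth[OF lam])
  then show ?thesis
    using pr_in(1)[OF sections_tangent[OF assms]] by (auto simp: sections_def)
qed

lemma F_section_through:
  assumes "v \<in> F p" obtains X where "X \<in> sections A F" "X p = v"
proof -
  obtain X where X: "X \<in> sections A T" "X p = v" using section_through[OF F_T[OF assms]] by metis
  show ?thesis by (rule that[OF section_pr[OF X(1)]]) (use X(2) pr_id[OF assms] in simp)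
qed

lemma lam_F_section: "X \<in> sections A F \<Longrightarrow> lam p (X p) = 0"
  using sections_in F_iff by blast

lemma ext_form: assumes z: "\<zeta> \<in> forms1 A F" shows "ext \<zeta> \<in> forms1 A T"
proof -
  have "smooth_fun A (\<lambda>p. ext \<zeta> p (X p))" if X: "X \<in> sections A T" for X
    using form_smooth[OF z section_pr[OF X]] sections_tangent[OF X] by (simp add: ext_eq)
  moreover have "ext \<zeta> p (\<lambda>f. a * v f + b * w f) = a * ext \<zeta> p v + b * ext \<zeta> p w"
    if v: "v \<in> T p" and w: "w \<in> T p" for p v w a b
    using form_lin[OF z pr_in(1)[OF v] pr_in(1)[OF w]] pr_comb[OF v w] v w T_comb[OF v w]
    by (simp add: ext_eq)
  moreover have "ext \<zeta> p v = 0" if "v \<notin> T p" for p v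
    using that by (simp add: ext_eq)
  ultimately show ?thesis unfolding forms1_def by blast
qed

lemma ext_\<nu>: "\<zeta> \<in> forms1 A F \<Longrightarrow> ext \<zeta> p (\<nu> p) = 0"
  using form_scale[of \<zeta> F "pr p (\<nu> p)" p 0] pr_in(1)[OF \<nu>_tangent]
  by (simp add: ext_eq \<nu>_tangent pr_\<nu>)

text \<open>Evaluating \<lambda> \<and> d\<lambda> = 0 on (\<nu>, u, v) leaves only the term
  \<lambda>(\<nu>) d\<lambda>(u, v).\<close>

lemma d1_lam_F: assumes "u \<in> F p" "v \<in> F p" shows "d1 lam p u v = 0"
proof -
  have "wedge12 lam (d1 lam) p (\<nu> p) u v = 0" using cois by (simp add: coisotropic_def)
  then show ?thesis using assms by (simp add: wedge12_def lam_\<nu> F_iff)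
qed

text \<open>Both arguments are split as \<open>pr\<close> plus a multiple of \<nu>; the term with
  \<nu> in both slots vanishes by skew symmetry.\<close>

lemma d1_decomp:
  assumes w: "\<omega> \<in> forms1 A T" and u: "u \<in> T p" and v: "v \<in> T p"
  shows "d1 \<omega> p u v = d1 \<omega> p (pr p u) (pr p v) + lam p v * d1 \<omega> p u (\<nu> p) - lam p u * d1 \<omega> p v (\<nu> p)"
proof -
  note n = \<nu>_tangent[of p] and pu = pr_in(2)[OF u] and pv = pr_in(2)[OF v]
  have sk: "d1 \<omega> p (\<nu> p) (\<nu> p) = 0" using ext_d1_skew[OF w n n] by simp
  have l: "d1 \<omega> p x y = d1 \<omega> p (pr p x) y + lam p x * d1 \<omega> p (\<nu> p) y" if "x \<in> T p" "y \<in> T p" for x y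
    using ext_d1_comb_left[OF w pr_in(2)[OF that(1)] n that(2), of 1 "lam p x"] pr_decomp[of x p] by simp
  have r: "d1 \<omega> p y x = d1 \<omega> p y (pr p x) + lam p x * d1 \<omega> p y (\<nu> p)" if "x \<in> T p" "y \<in> T p" for x y
    using ext_d1_comb_right[OF w pr_in(2)[OF that(1)] n that(2), of 1 "lam p x"] pr_decomp[of x p] by simp
  have "d1 \<omega> p u v = d1 \<omega> p (pr p u) (pr p v) + lam p v * d1 \<omega> p (pr p u) (\<nu> p)
      + lam p u * (d1 \<omega> p (\<nu> p) (pr p v) + lam p v * 0)"
    using l[OF u v] r[OF v pu] r[OF v n] sk by (simp add: algebra_simps)
  moreover have "d1 \<omega> p (pr p u) (\<nu> p) = d1 \<omega> p u (\<nu> p)" using l[OF u n] sk by simp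
  moreover have "d1 \<omega> p (\<nu> p) (pr p v) = - d1 \<omega> p v (\<nu> p)" using ext_d1_skew[OF w pv n] l[OF v n] sk by simp
  ultimately show ?thesis by (simp add: algebra_simps)
qed

text \<open>The easy half of Frobenius: on sections of the kernel the Koszul formula reduces to
  d\<lambda>(X,Y) = -\<lambda>([X,Y]), and the left side is 0 by coisotropy.\<close>

lemma F_involutive:
  assumes X: "X \<in> sections A F" and Y: "Y \<in> sections A F" shows "lie_bracket X Y \<in> sections A F"
proof -
  note XT = sections_T[OF X] and YT = sections_T[OF Y]
  have "lam p (lie_bracket X Y p) = 0" for p
  proof -
    have "koszul lam X Y p = 0"
      using ext_d1_eq[OF lam XT YT] d1_lam_F[OF sections_in[OF X] sections_in[OF Y]] by simp
    then show ?thesis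
      using T_const[OF sections_tangent[OF X]] T_const[OF sections_tangent[OF Y]]
      by (simp add: koszul_def lam_F_section[OF X] lam_F_section[OF Y])
  qed
  then show ?thesis
    using lie_bracket_section[OF XT YT] by (auto simp: sections_def F_iff)
qed

abbreviation "dF \<equiv> ext_d1 A F"

text \<open>A form and its extension agree along the leaves, and brackets of leafwise sections stay
  leafwise, so the two Koszul formulas have equal terms. The well-definedness of the leafwise
  differential is thus inherited from the ordinary one.\<close>

lemma dF_eq:
  assumes z: "\<zeta> \<in> forms1 A F" and v: "v \<in> F p" and w: "w \<in> F p"
  shows "dF \<zeta> p v w = d1 (ext \<zeta>) p v w"
proof -
  have k: "X p (\<lambda>q. \<zeta> q (Y q)) - Y p (\<lambda>q. \<zeta> q (X q)) - \<zeta> p (lie_bracket X Y p) = d1 (ext \<zeta>) p (X p) (Y p)"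
    if X: "X \<in> sections A F" and Y: "Y \<in> sections A F" for X Y
    unfolding ext_d1_eq[OF ext_form[OF z] sections_T[OF X] sections_T[OF Y]] koszul_def
    by (simp add: ext_on_F sections_in[OF X] sections_in[OF Y] sections_in[OF F_involutive[OF X Y]])
  have "(THE c. \<exists>X\<in>sections A F. \<exists>Y\<in>sections A F. X p = v \<and> Y p = w \<and>
      c = X p (\<lambda>q. \<zeta> q (Y q)) - Y p (\<lambda>q. \<zeta> q (X q)) - \<zeta> p (lie_bracket X Y p)) = d1 (ext \<zeta>) p v w"
  proof (rule the_equality)
    obtain X where X: "X \<in> sections A F" "X p = v" using F_section_through[OF v] by metis
    obtain Y where Y: "Y \<in> sections A F" "Y p = w" using F_section_through[OF w] by metis
    show "\<exists>X\<in>sections A F. \<exists>Y\<in>sections A F. X p = v \<and> Y p = w \<and>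
      d1 (ext \<zeta>) p v w = X p (\<lambda>q. \<zeta> q (Y q)) - Y p (\<lambda>q. \<zeta> q (X q)) - \<zeta> p (lie_bracket X Y p)"
      using k[OF X(1) Y(1)] X(2) Y(2) by (intro bexI[OF _ X(1)] bexI[OF _ Y(1)] conjI) simp_all
  next
    fix c assume "\<exists>X\<in>sections A F. \<exists>Y\<in>sections A F. X p = v \<and> Y p = w \<and>
      c = X p (\<lambda>q. \<zeta> q (Y q)) - Y p (\<lambda>q. \<zeta> q (X q)) - \<zeta> p (lie_bracket X Y p)"
    then show "c = d1 (ext \<zeta>) p v w"
    proof (elim bexE conjE)
      fix X Y assume X: "X \<in> sections A F" "X p = v" and Y: "Y \<in> sections A F" "Y p = w"
        and c: "c = X p (\<lambda>q. \<zeta> q (Y q)) - Y p (\<lambda>q. \<zeta> q (X q)) - \<zeta> p (lie_bracket X Y p)"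
      show ?thesis unfolding c k[OF X(1) Y(1)] by (simp only: X(2) Y(2))
    qed
  qed
  then show ?thesis using v w by (simp add: ext_d1_def)
qed

lemma dF_section:
  assumes z: "\<zeta> \<in> forms1 A F" and X: "X \<in> sections A F" and Y: "Y \<in> sections A F"
  shows "dF \<zeta> p (X p) (Y p) = X p (\<lambda>q. \<zeta> q (Y q)) - Y p (\<lambda>q. \<zeta> q (X q)) - \<zeta> p (lie_bracket X Y p)"
  unfolding dF_eq[OF z sections_in[OF X] sections_in[OF Y]]
    ext_d1_eq[OF ext_form[OF z] sections_T[OF X] sections_T[OF Y]] koszul_def
  by (simp add: ext_on_F sections_in[OF X] sections_in[OF Y] sections_in[OF F_involutive[OF X Y]])

subsection \<open>The twisting form\<close>

definition del :: "'a form1" where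
  "del p v = (if v \<in> T p then d1 lam p v (\<nu> p) else 0)"

lemma del_form: "del \<in> forms1 A T"
  unfolding forms1_def
  using ext_d1_comb_left[OF lam _ _ \<nu>_tangent] ext_d1_smooth[OF lam _ \<nu>_section]
  by (auto simp: del_def T_comb sections_tangent)

lemma d1_lam: "d1 lam = wedge11 del lam"
proof (intro ext)
  fix p v w
  show "d1 lam p v w = wedge11 del lam p v w"
  proof (cases "v \<in> T p \<and> w \<in> T p")
    case True
    then show ?thesis
      using d1_decomp[OF lam, of v p w] d1_lam_F[OF pr_in(1) pr_in(1), of v p w]
      by (simp add: wedge11_def del_def algebra_simps)
  next
    case False
    then show ?thesis by (auto simp: ext_d1_outside wedge11_def del_def form_outside[OF lam])
  qed
qed

lemma twist_form_eq: "twist_form A lam = restrict1 F del"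
  unfolding twist_form_def
proof (rule the_equality)
  show "\<exists>\<delta>\<in>forms1 A T. d1 lam = wedge11 \<delta> lam \<and> restrict1 F del = restrict1 F \<delta>"
    using del_form d1_lam by blast
  fix \<theta> assume "\<exists>\<delta>\<in>forms1 A T. d1 lam = wedge11 \<delta> lam \<and> \<theta> = restrict1 F \<delta>"
  then obtain \<delta> where d: "d1 lam = wedge11 \<delta> lam" "\<theta> = restrict1 F \<delta>" by blast
  have "\<delta> p v = del p v" if "v \<in> F p" for p v
  proof -
    \<comment> \<open>Inserting (v, \<nu>) with v in the kernel of \<lambda> isolates the value on
      v, so any two choices of \<delta> agree along the leaves.\<close>
    have "wedge11 \<delta> lam p v (\<nu> p) = wedge11 del lam p v (\<nu> p)" using d(1) d1_lam by simp
    then show ?thesis using that by (simp add: wedge11_def lam_\<nu> F_iff)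
  qed
  then show "\<theta> = restrict1 F del" unfolding d(2) by (auto simp: restrict1_def fun_eq_iff)
qed

abbreviation "\<theta> \<equiv> twist_form A lam"

lemma \<theta>_eq: "\<theta> p v = (if v \<in> F p then d1 lam p v (\<nu> p) else 0)"
  by (simp add: twist_form_eq restrict1_def del_def F_T)

lemma \<theta>_form: "\<theta> \<in> forms1 A F"
proof -
  have "smooth_fun A (\<lambda>p. del p (X p))" if "X \<in> sections A F" for X
    by (rule form_smooth[OF del_form sections_T[OF that]])
  then show ?thesis
    unfolding forms1_def twist_form_eq restrict1_def
    by (auto simp: F_comb form_lin[OF del_form F_T F_T] sections_in)
qed

text \<open>Up to sign this is the connection form of the Bott connection on the normal bundle of
  the foliation, in the frame given by \<nu>; its closedness is the flatness of that
  connection.\<close>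

lemma \<theta>_section: assumes X: "X \<in> sections A F" shows "\<theta> p (X p) = - lam p (lie_bracket X \<nu> p)"
  using ext_d1_eq[OF lam sections_T[OF X] \<nu>_section, of p] sections_in[OF X, of p]
    T_const[OF sections_tangent[OF X]] T_const[OF \<nu>_tangent]
  by (simp add: \<theta>_eq koszul_def lam_\<nu> lam_F_section[OF X])

text \<open>The Jacobi identity for \<open>X\<close>, \<open>Y\<close>, \<open>\<nu>\<close>, read transversally to the foliation.\<close>

lemma \<theta>_closed: assumes X: "X \<in> sections A F" and Y: "Y \<in> sections A F" shows "dF \<theta> p (X p) (Y p) = 0"
proof -
  note XT = sections_T[OF X] and YT = sections_T[OF Y] and N = \<nu>_section
  let ?b = "\<lambda>Z q. lam q (lie_bracket Z \<nu> q)"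
  \<comment> \<open>The transverse part of an iterated bracket, from d\<lambda> = \<delta> \<and>
    \<lambda>. Its product term is symmetric in Z and V, so it drops out of the difference formed by
    the Jacobi identity.\<close>
  have br: "lam p (lie_bracket Z (lie_bracket V \<nu>) p) = Z p (?b V) + ?b V p * ?b Z p"
    if Z: "Z \<in> sections A F" and V: "V \<in> sections A F" for Z V
  proof -
    note ZT = sections_T[OF Z] and VN = lie_bracket_section[OF sections_T[OF V] N]
    have "koszul lam Z (lie_bracket V \<nu>) p = wedge11 del lam p (Z p) (lie_bracket V \<nu> p)"
      using ext_d1_eq[OF lam ZT VN] d1_lam by simp
    also have "\<dots> = \<theta> p (Z p) * ?b V p"
      using lam_F_section[OF Z] sections_in[OF Z, of p] sections_tangent[OF Z, of p] by (simp add: wedge11_def del_def \<theta>_eq)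
    finally show ?thesis
      using T_const[OF sections_tangent[OF VN]] by (simp add: koszul_def lam_F_section[OF Z] \<theta>_section[OF Z] algebra_simps)
  qed
  have "lam p (lie_bracket (lie_bracket X Y) \<nu> p)
      = lam p (lie_bracket X (lie_bracket Y \<nu>) p) - lam p (lie_bracket Y (lie_bracket X \<nu>) p)"
    unfolding Jacobi[OF XT YT N]
    by (intro form_diff[OF lam] sections_tangent[OF lie_bracket_section] XT YT lie_bracket_section N)
  then have J: "?b (lie_bracket X Y) p = X p (?b Y) - Y p (?b X)"
    by (simp add: br X Y)
  have s: "smooth_fun A (?b Z)" if "Z \<in> sections A F" for Z
    by (rule form_smooth[OF lam lie_bracket_section[OF sections_T[OF that] N]])
  have "(\<lambda>q. \<theta> q (Z q)) = (\<lambda>q. - ?b Z q)" if "Z \<in> sections A F" for Z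
    using \<theta>_section[OF that] by auto
  then show ?thesis
    unfolding dF_section[OF \<theta>_form X Y]
    using J T_minus[OF sections_tangent[OF X] s[OF Y]] T_minus[OF sections_tangent[OF Y] s[OF X]]
    by (simp add: X Y \<theta>_section[OF F_involutive[OF X Y]])
qed

lemma twisted_d0_eq: "twisted_d0 A lam f p v = (if v \<in> F p then v f - \<theta> p v * f p else 0)"
  by (simp add: twisted_d0_def ext_d0_def \<theta>_eq)

lemma twisted_d0_form: assumes f: "smooth_fun A f" shows "twisted_d0 A lam f \<in> forms1 A F"
proof -
  have "smooth_fun A (\<lambda>p. X p f - \<theta> p (X p) * f p)" if X: "X \<in> sections A F" for X
    by (intro smooth_fun_diff smooth_fun_mult f sections_smooth[OF X f] form_smooth[OF \<theta>_form X])
  then show ?thesis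
    unfolding forms1_def
    by (auto simp: twisted_d0_eq F_comb form_lin[OF \<theta>_form] sections_in algebra_simps)
qed

lemma twisted_d1_iff:
  assumes "\<zeta> \<in> forms1 A F"
  shows "twisted_d1 A lam \<zeta> = (\<lambda>p v w. 0) \<longleftrightarrow> (\<forall>p. \<forall>v\<in>F p. \<forall>w\<in>F p. dF \<zeta> p v w = wedge11 \<theta> \<zeta> p v w)"
proof -
  have "twisted_d1 A lam \<zeta> p v w = 0" if "v \<notin> F p \<or> w \<notin> F p" for p v w
    using that form_outside[OF assms] form_outside[OF \<theta>_form]
    by (auto simp: twisted_d1_def ext_d1_outside wedge11_def)
  then show ?thesis by (fastforce simp: twisted_d1_def fun_eq_iff)
qed

text \<open>The square of the twisted differential is -f d\<theta>, as the terms mixing \<theta>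
  with derivatives of f cancel; and \<theta> is closed. This places gauge deformations among the
  infinitesimal ones.\<close>

lemma twisted_d1_d0: assumes f: "smooth_fun A f" shows "twisted_d1 A lam (twisted_d0 A lam f) = (\<lambda>p v w. 0)"
  unfolding twisted_d1_iff[OF twisted_d0_form[OF f]]
proof (intro allI ballI)
  fix p v w assume v: "v \<in> F p" and w: "w \<in> F p"
  obtain X where X: "X \<in> sections A F" "X p = v" using F_section_through[OF v] by metis
  obtain Y where Y: "Y \<in> sections A F" "Y p = w" using F_section_through[OF w] by metis
  let ?m = "twisted_d0 A lam f"
  have m: "?m q (Z q) = Z q f - \<theta> q (Z q) * f q" if "Z \<in> sections A F" for Z q
    using sections_in[OF that] by (simp add: twisted_d0_eq)
  have D: "W p (\<lambda>q. ?m q (Z q)) = W p (\<lambda>q. Z q f) - \<theta> p (Z p) * W p f - f p * W p (\<lambda>q. \<theta> q (Z q))"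
    if W: "W \<in> sections A F" and Z: "Z \<in> sections A F" for W Z
    using T_diff[OF sections_tangent[OF W] sections_smooth[OF Z f] smooth_fun_mult[OF form_smooth[OF \<theta>_form Z] f]]
      T_mult[OF sections_tangent[OF W] form_smooth[OF \<theta>_form Z] f]
    by (simp add: m[OF Z])
  have "dF ?m p (X p) (Y p) = \<theta> p (X p) * Y p f - \<theta> p (Y p) * X p f - f p * dF \<theta> p (X p) (Y p)"
    unfolding dF_section[OF twisted_d0_form[OF f] X(1) Y(1)] dF_section[OF \<theta>_form X(1) Y(1)]
      D[OF X(1) Y(1)] D[OF Y(1) X(1)] m[OF F_involutive[OF X(1) Y(1)]]
    by (simp add: lie_bracket_def algebra_simps)
  then show "dF ?m p v w = wedge11 \<theta> ?m p v w"
    using \<theta>_closed[OF X(1) Y(1), of p] X(2) Y(2) v w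
    by (simp add: wedge11_def twisted_d0_eq algebra_simps)
qed

subsection \<open>Linearized master equations\<close>

lemma form_comb:
  "\<omega> \<in> forms1 A D \<Longrightarrow> \<eta> \<in> forms1 A D \<Longrightarrow> (\<lambda>p v. a * \<omega> p v + b * \<eta> p v) \<in> forms1 A D"
  by (auto simp: forms1_def algebra_simps intro!: smooth_fun_add smooth_fun_cmult)

lemma d1_form_comb:
  assumes w: "\<omega> \<in> forms1 A T" and h: "\<eta> \<in> forms1 A T"
  shows "d1 (\<lambda>p v. a * \<omega> p v + b * \<eta> p v) p v w = a * d1 \<omega> p v w + b * d1 \<eta> p v w"
proof (cases "v \<in> T p \<and> w \<in> T p")
  case True
  then obtain X Y where X: "X \<in> sections A T" "X p = v" and Y: "Y \<in> sections A T" "Y p = w"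
    using section_through by metis
  have "koszul (\<lambda>p v. a * \<omega> p v + b * \<eta> p v) X Y p = a * koszul \<omega> X Y p + b * koszul \<eta> X Y p"
    using T_lin[OF sections_tangent[OF X(1)] form_smooth[OF w Y(1)] form_smooth[OF h Y(1)]]
      T_lin[OF sections_tangent[OF Y(1)] form_smooth[OF w X(1)] form_smooth[OF h X(1)]]
    by (simp add: koszul_def algebra_simps)
  then show ?thesis
    using ext_d1_eq[OF w X(1) Y(1), of p] ext_d1_eq[OF h X(1) Y(1), of p]
      ext_d1_eq[OF form_comb[OF w h] X(1) Y(1), of a b p] X(2) Y(2) by simp
qed (auto simp: ext_d1_outside)

lemma form_cmult: "\<omega> \<in> forms1 A D \<Longrightarrow> (\<lambda>p v. c * \<omega> p v) \<in> forms1 A D"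
  using form_comb[of \<omega> D \<omega> c 0] by simp

lemma d1_cmult: "\<omega> \<in> forms1 A T \<Longrightarrow> d1 (\<lambda>p v. c * \<omega> p v) p v w = c * d1 \<omega> p v w"
  using d1_form_comb[of \<omega> \<omega> c 0] by simp

lemma ext_comb: "ext (\<lambda>p v. a * \<zeta> p v + b * \<eta> p v) = (\<lambda>p v. a * ext \<zeta> p v + b * ext \<eta> p v)"
  by (auto simp: ext_eq fun_eq_iff)

lemma ext_cmult: "ext (\<lambda>p v. c * \<zeta> p v) = (\<lambda>p v. c * ext \<zeta> p v)"
  by (auto simp: ext_eq fun_eq_iff)

text \<open>The linear part of the first master map with its sign reversed, since
  \<open>master1\<close> subtracts the linear side of the equation.\<close>

definition lin_master :: "'a form1 \<Rightarrow> 'a form3" where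
  "lin_master \<zeta> p u v w = wedge12 (ext \<zeta>) (d1 lam) p u v w + wedge21 (d1 (ext \<zeta>)) lam p u v w"

text \<open>Along the ray t \<zeta> the first master map is t^2 times a constant minus t times
  \<open>lin_master\<close>, and the second is purely quadratic in t, so both derivatives at 0 can
  be read off.\<close>

lemma infinitesimal_iff:
  assumes z: "\<zeta> \<in> forms1 A F"
  shows "\<zeta> \<in> infinitesimal_deformations A lam L \<longleftrightarrow> (\<forall>p u v w. lin_master \<zeta> p u v w = 0)"
proof -
  have m1: "master1 A lam L (\<lambda>q x. t * \<zeta> q x) p u v w
      = t\<^sup>2 * wedge12 (ext \<zeta>) (d1 (ext \<zeta>)) p u v w - t * lin_master \<zeta> p u v w" for t p u v w
    by (simp add: master1_def Let_def ext_cmult d1_cmult[OF ext_form[OF z]] wedge12_def wedge21_def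
        lin_master_def power2_eq_square algebra_simps)
  have "dF (\<lambda>q x. t * \<zeta> q x) p v w = t * dF \<zeta> p v w" for t p v w
  proof (cases "v \<in> F p \<and> w \<in> F p")
    case True
    then show ?thesis
      by (simp add: dF_eq[OF z] dF_eq[OF form_cmult[OF z]] ext_cmult d1_cmult[OF ext_form[OF z]])
  qed (auto simp: ext_d1_outside)
  then have m2: "master2 A lam (\<lambda>q x. t * \<zeta> q x) p u v w = t\<^sup>2 * wedge12 \<zeta> (dF \<zeta>) p u v w" for t p u v w
    by (simp add: master2_def wedge12_def power2_eq_square algebra_simps)
  have D: "((\<lambda>t. t\<^sup>2 * a - t * b) has_real_derivative - b) (at 0)"
    "((\<lambda>t. t\<^sup>2 * a) has_real_derivative 0) (at 0)" for a b :: real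
    by (auto intro!: derivative_eq_intros)
  have "((\<lambda>t. t\<^sup>2 * a - t * b) has_real_derivative 0) (at 0) \<longleftrightarrow> b = 0" for a b :: real
    using D(1)[of a b] DERIV_unique by force
  then show ?thesis
    using z D(2) by (simp add: infinitesimal_deformations_def m1 m2)
qed

lemma lin_master_iff:
  assumes z: "\<zeta> \<in> forms1 A F"
  shows "(\<forall>p u v w. lin_master \<zeta> p u v w = 0) \<longleftrightarrow> twisted_d1 A lam \<zeta> = (\<lambda>p v w. 0)"
  unfolding twisted_d1_iff[OF z]
proof (intro iffI allI ballI)
  fix p v w assume 0: "\<forall>p u v w. lin_master \<zeta> p u v w = 0" and v: "v \<in> F p" and w: "w \<in> F p"
  \<comment> \<open>With \<nu> in the last slot the wedge with \<lambda> is stripped off: \<lambda>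
    is 1 on \<nu> and vanishes on v and w, and the extension of \<zeta> vanishes on \<nu>.\<close>
  have "lin_master \<zeta> p v w (\<nu> p) = 0" using 0 by blast
  then have "ext \<zeta> p v * \<theta> p w - ext \<zeta> p w * \<theta> p v + d1 (ext \<zeta>) p v w = 0"
    using v w ext_\<nu>[OF z] by (simp add: lin_master_def wedge12_def wedge21_def lam_\<nu> \<theta>_eq F_iff)
  then show "dF \<zeta> p v w = wedge11 \<theta> \<zeta> p v w"
    using v w by (simp add: dF_eq[OF z] ext_on_F wedge11_def algebra_simps)
next
  fix p u v w assume c: "\<forall>p. \<forall>v\<in>F p. \<forall>w\<in>F p. dF \<zeta> p v w = wedge11 \<theta> \<zeta> p v w"
  define k where "k v = d1 (ext \<zeta>) p v (\<nu> p)" for v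
  \<comment> \<open>On the full tangent space the leafwise equation becomes d\<zeta>' = \<delta>
    \<and> \<zeta>' + k \<and> \<lambda> for the extension \<zeta>'. The uncontrolled transverse
    part k disappears after wedging with \<lambda>.\<close>
  have dT: "d1 (ext \<zeta>) p x y = del p x * ext \<zeta> p y - del p y * ext \<zeta> p x + lam p y * k x - lam p x * k y"
    for x y
  proof (cases "x \<in> T p \<and> y \<in> T p")
    case True
    then have x: "x \<in> T p" and y: "y \<in> T p" by auto
    have dp: "\<theta> p (pr p x) = del p x" if "x \<in> T p" for x
    proof -
      have "d1 lam p (\<nu> p) (\<nu> p) = 0" using ext_d1_skew[OF lam \<nu>_tangent \<nu>_tangent] by simp
      then have "d1 lam p x (\<nu> p) = d1 lam p (pr p x) (\<nu> p)"
        using ext_d1_comb_left[OF lam pr_in(2)[OF that] \<nu>_tangent \<nu>_tangent, of 1 "lam p x"] pr_decomp[of x p] by simp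
      then show ?thesis using pr_in[OF that] that by (simp add: \<theta>_eq del_def)
    qed
    have "d1 (ext \<zeta>) p (pr p x) (pr p y) = wedge11 \<theta> \<zeta> p (pr p x) (pr p y)"
      using c pr_in(1)[OF x] pr_in(1)[OF y] dF_eq[OF z pr_in(1)[OF x] pr_in(1)[OF y]] by simp
    then show ?thesis
      using d1_decomp[OF ext_form[OF z] x y] x y by (simp add: wedge11_def ext_eq dp k_def)
  next
    case False
    then show ?thesis by (auto simp: ext_d1_outside del_def ext_eq form_outside[OF lam] k_def)
  qed
  show "lin_master \<zeta> p u v w = 0"
    unfolding lin_master_def wedge12_def wedge21_def d1_lam wedge11_def dT
    by (simp add: algebra_simps)
qed

theorem infinitesimal_deformations_eq:
  "infinitesimal_deformations A lam L = {\<zeta> \<in> forms1 A F. twisted_d1 A lam \<zeta> = (\<lambda>p v w. 0)}"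
proof (intro set_eqI)
  fix \<zeta>
  have "\<zeta> \<in> forms1 A F" if "\<zeta> \<in> infinitesimal_deformations A lam L"
    using that unfolding infinitesimal_deformations_def mem_Collect_eq by (rule conjunct1)
  then show "\<zeta> \<in> infinitesimal_deformations A lam L
      \<longleftrightarrow> \<zeta> \<in> {\<zeta> \<in> forms1 A F. twisted_d1 A lam \<zeta> = (\<lambda>p v w. 0)}"
    using infinitesimal_iff[of \<zeta>] lin_master_iff[of \<zeta>] by (simp only: mem_Collect_eq) argo
qed

lemma twisted_d1_kernel_subspace:
  "form_subspace {\<zeta> \<in> forms1 A F. twisted_d1 A lam \<zeta> = (\<lambda>p v w. 0)}"
  unfolding form_subspace_def
proof (intro conjI ballI allI)
  have "(\<lambda>p v. 0) \<in> forms1 A F" by (simp add: forms1_def)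
  moreover from d1_cmult[OF ext_form[OF this], of 0] have "dF (\<lambda>p v. 0) p v w = 0" if "v \<in> F p" "w \<in> F p" for p v w
    using dF_eq[OF calculation that] ext_cmult[of 0] by simp
  ultimately show "(\<lambda>p v. 0) \<in> {\<zeta> \<in> forms1 A F. twisted_d1 A lam \<zeta> = (\<lambda>p v w. 0)}"
    by (simp add: twisted_d1_iff wedge11_def)
next
  fix \<omega> \<eta> a b
  assume "\<omega> \<in> {\<zeta> \<in> forms1 A F. twisted_d1 A lam \<zeta> = (\<lambda>p v w. 0)}"
    and "\<eta> \<in> {\<zeta> \<in> forms1 A F. twisted_d1 A lam \<zeta> = (\<lambda>p v w. 0)}"
  then have w: "\<omega> \<in> forms1 A F" "\<forall>p. \<forall>v\<in>F p. \<forall>w\<in>F p. dF \<omega> p v w = wedge11 \<theta> \<omega> p v w"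
    and h: "\<eta> \<in> forms1 A F" "\<forall>p. \<forall>v\<in>F p. \<forall>w\<in>F p. dF \<eta> p v w = wedge11 \<theta> \<eta> p v w"
    using twisted_d1_iff by auto
  let ?c = "\<lambda>p v. a * \<omega> p v + b * \<eta> p v"
  have c: "?c \<in> forms1 A F" by (rule form_comb[OF w(1) h(1)])
  have "dF ?c p v w = wedge11 \<theta> ?c p v w" if "v \<in> F p" "w \<in> F p" for p v w
  proof -
    have "dF ?c p v w = a * dF \<omega> p v w + b * dF \<eta> p v w"
      by (simp add: dF_eq[OF c that] dF_eq[OF w(1) that] dF_eq[OF h(1) that] ext_comb
          d1_form_comb[OF ext_form[OF w(1)] ext_form[OF h(1)]])
    then show ?thesis using w(2) h(2) that by (simp add: wedge11_def algebra_simps)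
  qed
  then show "?c \<in> {\<zeta> \<in> forms1 A F. twisted_d1 A lam \<zeta> = (\<lambda>p v w. 0)}"
    using c by (simp add: twisted_d1_iff)
qed

lemma twisted_d0_image_subspace: "form_subspace {twisted_d0 A lam f | f. smooth_fun A f}"
  unfolding form_subspace_def
proof (intro conjI ballI allI)
  have "(\<lambda>p v. 0) = twisted_d0 A lam (\<lambda>q. 0)"
    by (auto simp: twisted_d0_eq fun_eq_iff T_const[OF F_T])
  then show "(\<lambda>p v. 0) \<in> {twisted_d0 A lam f | f. smooth_fun A f}" by blast
next
  fix \<omega> \<eta> a b
  assume "\<omega> \<in> {twisted_d0 A lam f | f. smooth_fun A f}" "\<eta> \<in> {twisted_d0 A lam f | f. smooth_fun A f}"
  then obtain f g where f: "smooth_fun A f" "\<omega> = twisted_d0 A lam f" and g: "smooth_fun A g" "\<eta> = twisted_d0 A lam g"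
    by blast
  have "(\<lambda>p v. a * \<omega> p v + b * \<eta> p v) = twisted_d0 A lam (\<lambda>q. a * f q + b * g q)"
    unfolding f(2) g(2)
    by (auto simp: twisted_d0_eq fun_eq_iff T_lin[OF F_T f(1) g(1)] algebra_simps)
  then show "(\<lambda>p v. a * \<omega> p v + b * \<eta> p v) \<in> {twisted_d0 A lam f | f. smooth_fun A f}"
    using smooth_fun_add[OF smooth_fun_cmult[OF f(1)] smooth_fun_cmult[OF g(1)]] by blast
qed

end

section \<open>First-order behaviour of an ambient isotopy\<close>

abbreviation bigt :: "nat \<Rightarrow> (real \<Rightarrow> real) set" where
  "bigt n \<equiv> O[at_right 0](\<lambda>t. t ^ n)"

lemma bigt_mult: "f \<in> bigt m \<Longrightarrow> g \<in> bigt n \<Longrightarrow> (\<lambda>t. f t * g t) \<in> bigt (m + n)"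
  unfolding power_add by (rule landau_o.big.mult)

lemma bigt_const: "(\<lambda>t. c) \<in> bigt 0"
  by (rule bigoI[where c="\<bar>c\<bar>"]) simp

lemma bigt_time: "(\<lambda>t. t) \<in> bigt 1"
  by simp

lemma bigt_cong: "f \<in> bigt n \<Longrightarrow> (\<forall>\<^sub>F t in at_right 0. f t = g t) \<Longrightarrow> g \<in> bigt n"
  using landau_o.big.in_cong by metis

lemma bigt_tendsto: assumes "(f \<longlongrightarrow> l) (at_right 0)" shows "f \<in> bigt 0"
  by (rule bigoI_tendsto[of _ _ l]) (use assms in auto)

lemma bigt_weaken: assumes "f \<in> bigt (Suc n)" shows "f \<in> bigt n"
proof -
  have "(\<lambda>t::real. t) \<in> O[at_right 0](\<lambda>t. 1)" by (rule bigoI_tendsto[of _ _ 0]) (auto intro!: tendsto_eq_intros)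
  then have "(\<lambda>t::real. t * t ^ n) \<in> O[at_right 0](\<lambda>t. 1 * t ^ n)" by (rule landau_o.big.mult) simp
  then show ?thesis using assms landau_o.big_trans by fastforce
qed

text \<open>One-sided, since isotopies are compared on [0,1] only. The error is O(t^2) rather than
  o(t), because the gauge relation demands a remainder of that order.\<close>

definition jet :: "(real \<Rightarrow> real) \<Rightarrow> real \<Rightarrow> real \<Rightarrow> bool" where
  "jet f a b \<longleftrightarrow> (\<lambda>t. f t - a - t * b) \<in> bigt 2"

lemma jet_cong: "jet f a b \<Longrightarrow> (\<forall>\<^sub>F t in at_right 0. f t = g t) \<Longrightarrow> jet g a b"
  unfolding jet_def by (erule bigt_cong) (auto elim: eventually_mono)

lemma jet_add: "jet f a b \<Longrightarrow> jet g c d \<Longrightarrow> jet (\<lambda>t. f t + g t) (a + c) (b + d)"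
  unfolding jet_def by (drule (1) sum_in_bigo(1)) (simp add: algebra_simps)

lemma jet_sum: "(\<And>i. i \<in> I \<Longrightarrow> jet (f i) (a i) (b i)) \<Longrightarrow> jet (\<lambda>t. \<Sum>i\<in>I. f i t) (\<Sum>i\<in>I. a i) (\<Sum>i\<in>I. b i)"
proof (induction I rule: infinite_finite_induct)
  case (insert x F)
  then show ?case using jet_add[of "f x"] by simp
qed (auto simp: jet_def)

text \<open>The linear parts contribute an extra t^2 b d, which joins the remainder; every other
  error term is an O(t^2) factor times a bounded one.\<close>

lemma jet_mult:
  assumes "jet f a b" "jet g c d" shows "jet (\<lambda>t. f t * g t) (a * c) (a * d + b * c)"
proof -
  let ?r = "\<lambda>t. f t - a - t * b" and ?s = "\<lambda>t. g t - c - t * d"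
  have r: "?r \<in> bigt 2" and s: "?s \<in> bigt 2" using assms by (auto simp: jet_def)
  have r0: "?r \<in> bigt 0" using bigt_weaken[OF bigt_weaken, of ?r 0] r by (simp add: numeral_2_eq_2)
  have a0: "(\<lambda>t. k + t * m) \<in> bigt 0" for k m
    by (rule bigt_tendsto[of _ "k + 0 * m"]) (intro tendsto_intros)
  have t2: "(\<lambda>t. t ^ 2 * (b * d)) \<in> bigt (2 + 0)" by (rule bigt_mult[OF _ bigt_const]) simp
  have "(\<lambda>t. ?r t * (c + t * d) + (a + t * b) * ?s t + ?r t * ?s t + t ^ 2 * (b * d)) \<in> bigt 2"
    by (intro sum_in_bigo bigt_mult[OF r a0, unfolded add_0_right] bigt_mult[OF a0 s, unfolded add_0_left]
        bigt_mult[OF r0 s, unfolded add_0_left] t2[unfolded add_0_right])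
  then show ?thesis unfolding jet_def
    by (rule bigt_cong) (simp add: algebra_simps power2_eq_square)
qed

lemma jet_tendsto: assumes "jet f 0 b" shows "((\<lambda>t. f t / t) \<longlongrightarrow> b) (at_right 0)"
proof -
  obtain c where c: "\<forall>\<^sub>F t in at_right 0. norm (f t - 0 - t * b) \<le> c * norm (t ^ 2 :: real)"
    using landau_o.bigE[OF assms[unfolded jet_def]] by metis
  have "((\<lambda>t. f t / t - b) \<longlongrightarrow> 0) (at_right 0)"
  proof (rule Lim_null_comparison)
    show "\<forall>\<^sub>F t in at_right 0. norm (f t / t - b) \<le> c * \<bar>t\<bar>"
      using c eventually_at_right_less[of 0]
    proof eventually_elim
      case (elim t)
      have "f t / t - b = (f t - 0 - t * b) / t" using elim by (simp add: field_simps)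
      then have "norm (f t / t - b) = norm (f t - 0 - t * b) / t" using elim by simp
      also have "\<dots> \<le> c * norm (t ^ 2) / t" using elim by (intro divide_right_mono) auto
      also have "\<dots> = c * \<bar>t\<bar>" using elim by (simp add: power2_eq_square)
      finally show ?case .
    qed
    show "((\<lambda>t. c * \<bar>t\<bar>) \<longlongrightarrow> 0) (at_right 0)" by (auto intro!: tendsto_eq_intros)
  qed
  then show ?thesis by (simp add: LIM_zero_iff)
qed

context manifold
begin

section \<open>Time dependence of isotopies, their generators and their inverses\<close>

lemma fam_on_chartsI:
  assumes "\<And>U \<phi>. (U, \<phi>) \<in> A \<Longrightarrow>
    smooth_on {(t, x). x \<in> \<phi> ` U \<and> (t, inv_into U \<phi> x) \<in> W} (\<lambda>(t, x). g (t, inv_into U \<phi> x))"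
  shows "fam_on A W g"
  using assms by (auto simp: fam_on_def)

lemma fam_on_time_quotient:
  assumes "fam_on A (ball 0 e \<times> UNIV) h"
  shows "fam_on A (ball 0 e \<times> UNIV) (\<lambda>(t, q). time_quotient (\<lambda>t. h (t, q)) t)"
proof (rule fam_on_chartsI)
  fix U \<phi> assume U: "(U, \<phi>) \<in> A"
  have eq: "{(t::real, x). x \<in> \<phi> ` U \<and> (t, inv_into U \<phi> x) \<in> ball 0 e \<times> UNIV} = ball 0 e \<times> \<phi> ` U" by auto
  have "smooth_on (ball 0 e \<times> \<phi> ` U) (\<lambda>(t, x). h (t, inv_into U \<phi> x))"
    using fam_onD[OF assms U] unfolding eq .
  from smooth_on_time_quotient[OF this chart(2)[OF U]]
  show "smooth_on {(t, x). x \<in> \<phi> ` U \<and> (t, inv_into U \<phi> x) \<in> ball 0 e \<times> UNIV}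
      (\<lambda>(t, x). case (t, inv_into U \<phi> x) of (t, q) \<Rightarrow> time_quotient (\<lambda>t. h (t, q)) t)"
    unfolding eq by simp
qed

text \<open>Caratheodory's criterion: the time quotient is the slope function, and it is continuous
  at 0.\<close>

lemma fam_on_time_derivative:
  assumes "e > 0" "fam_on A (ball 0 e \<times> UNIV) h"
  shows "((\<lambda>t. h (t, q)) has_real_derivative deriv (\<lambda>t. h (t, q)) 0) (at 0)"
proof -
  let ?H = "\<lambda>t. time_quotient (\<lambda>t. h (t, q)) t"
  have o: "open (ball 0 e \<times> (UNIV :: 'a set) :: (real \<times> 'a) set)" by (simp add: open_Times)
  have c: "continuous_on (ball 0 e) (\<lambda>t. (\<lambda>(t, q). time_quotient (\<lambda>t. h (t, q)) t) (t, q))"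
    by (rule continuous_on_compose2[OF fam_on_continuous[OF o fam_on_time_quotient[OF assms(2)]]])
      (auto intro!: continuous_intros)
  then have "isCont ?H 0" using assms(1) by (simp add: continuous_on_eq_continuous_at)
  then have "((\<lambda>t. h (t, q)) has_real_derivative ?H 0) (at 0)"
    unfolding CARAT_DERIV
  proof (intro exI[of _ ?H] conjI allI)
    show "h (z, q) - h (0, q) = ?H z * (z - 0)" for z
      using time_quotient[of "\<lambda>t. h (t, q)" z] by (simp only: diff_eq_eq mult.commute diff_zero add.commute)
    show "isCont ?H 0" by fact
    show "?H 0 = ?H 0" by (rule refl)
  qed
  then show ?thesis by (simp add: time_quotient_def)
qed

lemma isotopy_families:
  assumes "ambient_isotopy A \<psi>"
  obtains e where "e > 0" "\<And>f. smooth_fun A f \<Longrightarrow> fam_on A (ball 0 e \<times> UNIV) (\<lambda>(t, q). f (\<psi> t q))"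
    "continuous_on (ball 0 e \<times> UNIV) (\<lambda>(t, q). \<psi> t q)"
proof -
  obtain J where J: "open J" "{0..1} \<subseteq> J" "smooth_family_map A J \<psi>"
    using assms by (auto simp: ambient_isotopy_def)
  then have "0 \<in> J" by auto
  then obtain e where e: "e > 0" "ball 0 e \<subseteq> J" using J(1) openE by blast
  have sub: "ball 0 e \<times> UNIV \<subseteq> J \<times> (UNIV :: 'a set)" using e by auto
  have "fam_on A (ball 0 e \<times> UNIV) (\<lambda>(t, q). f (\<psi> t q))" if "smooth_fun A f" for f
    using fam_on_subset[OF fam_on_family_map[OF J(1,3) fam_on_snd[OF that]] sub] by simp
  moreover have "continuous_on (ball 0 e \<times> UNIV) (\<lambda>(t, q). \<psi> t q)"
    by (rule continuous_on_subset[OF _ sub]) (use J(3) in \<open>simp add: smooth_family_map_def\<close>)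
  ultimately show ?thesis using that e(1) by metis
qed

text \<open>The initial velocity, set to 0 on non-smooth functions to be a derivation in the sense
  of \<open>tangent_space\<close>. The derivative is two-sided because an isotopy is smooth on an
  open neighbourhood of [0,1].\<close>

definition generator :: "(real \<Rightarrow> 'a \<Rightarrow> 'a) \<Rightarrow> 'a \<Rightarrow> 'a tvec" where
  "generator \<psi> q f = (if smooth_fun A f then deriv (\<lambda>t. f (\<psi> t q)) 0 else 0)"

lemma generator_derivative:
  assumes "ambient_isotopy A \<psi>" "smooth_fun A f"
  shows "((\<lambda>t. f (\<psi> t q)) has_real_derivative generator \<psi> q f) (at 0)"
proof -
  obtain e where e: "e > 0" "\<And>f. smooth_fun A f \<Longrightarrow> fam_on A (ball 0 e \<times> UNIV) (\<lambda>(t, q). f (\<psi> t q))"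
    by (rule isotopy_families[OF assms(1)]) (rule that)
  from fam_on_time_derivative[OF e(1) e(2)[OF assms(2)], of q]
  show ?thesis using assms(2) by (simp add: generator_def)
qed

lemma generator_eqI:
  assumes "\<And>q f. smooth_fun A f \<Longrightarrow> ((\<lambda>t. f (\<psi> t q)) has_real_derivative X q f) (at 0)"
    "\<And>q f. \<not> smooth_fun A f \<Longrightarrow> X q f = 0"
  shows "generator \<psi> = X"
  using assms by (intro ext) (auto simp: generator_def DERIV_imp_deriv)

text \<open>Linearity and the Leibniz rule are those of the derivative in t, evaluated where \<psi>
  is the identity. Smoothness in the point holds because the generator is the slice at t = 0 of a
  smooth time quotient.\<close>

lemma generator_section:
  assumes iso: "ambient_isotopy A \<psi>" shows "generator \<psi> \<in> sections A T"
proof (rule sectionsI)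
  have 0: "\<psi> 0 = id" using iso by (simp add: ambient_isotopy_def)
  note d = generator_derivative[OF iso]
  fix p
  have "generator \<psi> p (\<lambda>q. a * f q + b * g q) = a * generator \<psi> p f + b * generator \<psi> p g"
    if f: "smooth_fun A f" and g: "smooth_fun A g" for f g a b
    by (rule DERIV_unique[OF d]) (auto intro!: derivative_eq_intros d f g smooth_fun_add smooth_fun_cmult)
  moreover have "generator \<psi> p (\<lambda>q. f q * g q) = f p * generator \<psi> p g + g p * generator \<psi> p f"
    if f: "smooth_fun A f" and g: "smooth_fun A g" for f g
    by (rule DERIV_unique[OF d])
      (auto intro!: derivative_eq_intros d f g smooth_fun_mult simp: 0 algebra_simps)
  ultimately show "generator \<psi> p \<in> T p \<inter> T p"
    unfolding tangent_space_def by (auto simp: generator_def)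
next
  fix f assume f: "smooth_fun A f"
  obtain e where e: "e > 0" "\<And>f. smooth_fun A f \<Longrightarrow> fam_on A (ball 0 e \<times> UNIV) (\<lambda>(t, q). f (\<psi> t q))"
    by (rule isotopy_families[OF iso]) (rule that)
  have "smooth_fun A (\<lambda>q. (\<lambda>(t, q). time_quotient (\<lambda>t. (\<lambda>(t, q). f (\<psi> t q)) (t, q)) t) (0, q))"
    by (rule fam_on_slice[OF open_ball fam_on_time_quotient[OF e(2)[OF f]]]) (use e(1) in simp)
  then show "smooth_fun A (\<lambda>p. generator \<psi> p f)" by (simp add: time_quotient_def generator_def f)
qed

lemma isotopy_diffeo:
  assumes "ambient_isotopy A \<psi>" "t \<in> {0..1}"
  shows "bij (\<psi> t)" "smooth_map A A (\<psi> t)" "smooth_map A A (inv (\<psi> t))"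
    "\<psi> t (inv (\<psi> t) q) = q" "inv (\<psi> t) (\<psi> t q) = q"
proof -
  show b: "bij (\<psi> t)" "smooth_map A A (\<psi> t)" "smooth_map A A (inv (\<psi> t))"
    using assms by (auto simp: ambient_isotopy_def diffeo_def)
  show "\<psi> t (inv (\<psi> t) q) = q" "inv (\<psi> t) (\<psi> t q) = q"
    using b(1) by (auto simp: bij_is_surj surj_f_inv_f bij_is_inj)
qed

lemma eventually_time: "\<forall>\<^sub>F t in at_right (0::real). t \<in> {0..1} \<and> t \<noteq> 0"
  by (rule eventually_mono[OF eventually_at_right_real[of 0 1]]) auto

text \<open>At t = 0 the compact complement of N is mapped to itself and misses p. By the tube lemma
  its image still misses p for all small t, so the preimage of p lies in N.\<close>

lemma inverse_isotopy_tendsto: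
  assumes comp: "compact (UNIV :: 'a set)" and iso: "ambient_isotopy A \<psi>" and N: "open N" "p \<in> N"
  shows "\<forall>\<^sub>F t in at_right 0. inv (\<psi> t) p \<in> N"
proof -
  obtain e where e: "e > 0" "continuous_on (ball 0 e \<times> UNIV) (\<lambda>(t, q). \<psi> t q)"
    by (rule isotopy_families[OF iso]) (rule that)
  have 0: "\<psi> 0 = id" using iso by (simp add: ambient_isotopy_def)
  have K: "compact (- N)" using comp N(1) by (metis closed_Compl compact_Int_closed Int_UNIV_left)
  let ?O = "(ball 0 e \<times> UNIV) \<inter> (\<lambda>(t, q). \<psi> t q) -` (- {p})"
  have oB: "open (ball (0::real) e \<times> (UNIV :: 'a set))" by (simp add: open_Times)
  have "open (- {p})" by (rule open_Compl) simp
  then have "open ?O" by (rule continuous_open_preimage[OF e(2) oB])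
  moreover have "{0} \<times> - N \<subseteq> ?O" using e N 0 by auto
  ultimately obtain X0 where X: "0 \<in> X0" "open X0" "X0 \<times> - N \<subseteq> ?O"
    using Elementary_Topology.tube_lemma[OF K] by metis
  have "\<forall>\<^sub>F t in at_right 0. t \<in> X0"
    using eventually_at_in_open'[OF X(2,1)] by (rule filter_leD[OF at_le, rotated]) simp
  then show ?thesis using eventually_time
  proof eventually_elim
    case (elim t)
    show "inv (\<psi> t) p \<in> N"
    proof (rule ccontr)
      assume "inv (\<psi> t) p \<notin> N"
      then have "(t, inv (\<psi> t) p) \<in> ?O" using X(3) elim by auto
      then show False using isotopy_diffeo(4)[OF iso, of t p] elim by auto
    qed
  qed
qed

lemma time_quotient_family: "h (t, q) = h (0, q) + t * (\<lambda>(t, q). time_quotient (\<lambda>t. h (t, q)) t) (t, q)"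
  using time_quotient[of "\<lambda>t. h (t, q)" t] by simp

text \<open>Here \<open>w\<^sub>t\<close> is the image of \<open>v\<close> under \<open>\<psi>\<^sub>t\<inverse>\<close>, based at \<open>y\<^sub>t = \<psi>\<^sub>t\<inverse>(p)\<close>.  Writing
  \<open>f \<circ> \<psi>\<^sub>t = f + t F\<^sub>t\<close> turns into \<open>w\<^sub>t f = v f - t w\<^sub>t F\<^sub>t\<close>, an implicit equation which first bounds
  the coordinates of \<open>w\<^sub>t\<close> and then yields their expansion, so that no smoothness of \<open>\<psi>\<^sub>t\<inverse>\<close> in
  \<open>t\<close> is needed.\<close>

lemma inverse_isotopy_jets:
  assumes comp: "compact (UNIV :: 'a set)" and iso: "ambient_isotopy A \<psi>" and v: "v \<in> T p" and f: "smooth_fun A f"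
  shows "jet (\<lambda>t. f (inv (\<psi> t) p)) (f p) (- generator \<psi> p f)"
    and "jet (\<lambda>t. differential A (inv (\<psi> t)) v f) (v f) (- v (\<lambda>q. generator \<psi> q f))"
proof -
  define y where "y t = inv (\<psi> t) p" for t
  define w where "w t = differential A (inv (\<psi> t)) v" for t
  obtain e where e: "e > 0" "\<And>f. smooth_fun A f \<Longrightarrow> fam_on A (ball 0 e \<times> UNIV) (\<lambda>(t, q). f (\<psi> t q))"
    by (rule isotopy_families[OF iso]) (rule that)
  define Q where "Q h = (\<lambda>(t::real, q::'a). time_quotient (\<lambda>t. h (t, q)) t)" for h
  define \<Psi> where "\<Psi> f = (\<lambda>(t, q). f (\<psi> t q) :: real)" for f
  define fam where "fam h \<longleftrightarrow> fam_on A (ball 0 e \<times> UNIV) h" for h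
  have Q: "h (t, q) = h (0, q) + t * Q h (t, q)" for h t q
    unfolding Q_def by (rule time_quotient_family)
  have famQ: "fam (Q h)" if "fam h" for h
    using fam_on_time_quotient that unfolding Q_def fam_def by simp
  have fam\<Psi>: "fam (\<Psi> f)" if "smooth_fun A f" for f
    using e(2)[OF that] by (simp add: fam_def \<Psi>_def)
  have slice: "smooth_fun A (\<lambda>q. h (t, q))" if "fam h" "t \<in> ball 0 e" for h t
    using fam_on_slice[OF open_ball _ that(2)] that(1) unfolding fam_def by blast
  have \<psi>0: "\<psi> 0 = id" using iso by (simp add: ambient_isotopy_def)
  have gen: "generator \<psi> q f = Q (\<Psi> f) (0, q)" if "smooth_fun A f" for f q
    using that by (simp add: generator_def Q_def \<Psi>_def time_quotient_def)
  obtain W x E where F: "open W" "p \<in> W" "\<And>i::'n. smooth_fun A (x i)" "\<And>i. E i \<in> sections A T"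
    "\<And>q v. q \<in> W \<Longrightarrow> v \<in> T q \<Longrightarrow> v = (\<lambda>f. \<Sum>i\<in>UNIV. v (x i) * E i q f)"
    "\<And>J g i. open J \<Longrightarrow> fam_on A (J \<times> UNIV) g \<Longrightarrow> fam_on A (J \<times> W) (\<lambda>(t, q). E i q (\<lambda>q. g (t, q)))"
    by (rule local_frame[of p]) (rule that)
  define good where "good t \<longleftrightarrow> t \<in> {0..1} \<and> t \<noteq> 0 \<and> t \<in> ball 0 e \<and> y t \<in> W" for t
  have evb: "\<forall>\<^sub>F t in at_right (0::real). t \<in> ball 0 e"
    by (rule eventually_mono[OF eventually_at_right_real[OF e(1)]]) auto
  have ev: "\<forall>\<^sub>F t in at_right 0. good t"
    using eventually_time evb inverse_isotopy_tendsto[OF comp iso F(1,2)]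
    by eventually_elim (simp add: good_def y_def)
  have yW: "((\<lambda>t. y t) \<longlongrightarrow> p) (at_right 0)"
    by (rule topological_tendstoI) (simp add: y_def inverse_isotopy_tendsto[OF comp iso])
  have lim: "((\<lambda>t. h (t, y t)) \<longlongrightarrow> h (0, p)) (at_right 0)" if "fam_on A (ball 0 e \<times> V) h" "open V" "p \<in> V" for h V
  proof -
    have o: "open (ball 0 e \<times> V)" using that(2) by (simp add: open_Times)
    have "(0, p) \<in> ball 0 e \<times> V" using e(1) that(3) by simp
    then have "isCont h (0, p)"
      by (rule bspec[OF fam_on_continuous[OF o that(1), unfolded continuous_on_eq_continuous_at[OF o]]])
    then show ?thesis
      by (rule isCont_tendsto_compose) (intro tendsto_Pair yW tendsto_ident_at)
  qed
  have bnd: "(\<lambda>t. h (t, y t)) \<in> bigt 0" if "fam h" for h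
    using bigt_tendsto[OF lim[of UNIV h]] that by (simp add: fam_def)
  \<comment> \<open>Since \<psi> at time t sends y_t to p, the expansion of f o \<psi>_t at y_t
    expresses f(p) through f(y_t).\<close>
  have point: "f (y t) = f p - t * Q (\<Psi> f) (t, y t)" if "t \<in> {0..1}" for f t
    using Q[of "\<Psi> f" t "y t"] isotopy_diffeo(4)[OF iso that] by (simp add: \<Psi>_def y_def \<psi>0)
  have point1: "(\<lambda>t. f (y t) - f p) \<in> bigt 1" if "smooth_fun A f" for f
  proof -
    have "(\<lambda>t. - 1 * t * Q (\<Psi> f) (t, y t)) \<in> bigt (0 + 1 + 0)"
      by (intro bigt_mult bigt_const bigt_time bnd famQ fam\<Psi> that)
    then have "(\<lambda>t. - 1 * t * Q (\<Psi> f) (t, y t)) \<in> bigt 1" by simp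
    then show ?thesis
      by (rule bigt_cong) (rule eventually_mono[OF ev], simp add: good_def point)
  qed
  have fam1: "(\<lambda>t. h (t, y t) - h (0, p)) \<in> bigt 1" if h: "fam h" for h
  proof -
    have "smooth_fun A (\<lambda>q. h (0, q))" using slice[OF h] e(1) by simp
    from point1[OF this] have "(\<lambda>t. h (0, y t) - h (0, p)) \<in> bigt 1" .
    moreover have "(\<lambda>t. t * Q h (t, y t)) \<in> bigt 1"
      by (rule bigt_mult[OF bigt_time bnd, unfolded add_0_right]) (intro famQ h)
    ultimately have "(\<lambda>t. (h (0, y t) - h (0, p)) + t * Q h (t, y t)) \<in> bigt 1"
      by (rule sum_in_bigo(1))
    then show ?thesis
      by (rule bigt_cong) (rule always_eventually, subst (4) Q, simp)
  qed
  have wT: "w t \<in> T (y t)" if "t \<in> {0..1}" for t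
    unfolding w_def y_def by (rule differential_tangent[OF atlas atlas isotopy_diffeo(3)[OF iso that] v])
  have vec: "w t f = v f - t * w t (\<lambda>q. Q (\<Psi> f) (t, q))" if t: "good t" and f: "smooth_fun A f" for f t
  proof -
    have t01: "t \<in> {0..1}" and te: "t \<in> ball 0 e" using t by (auto simp: good_def)
    have s: "smooth_fun A (\<lambda>q. f (\<psi> t q))" "smooth_fun A (\<lambda>q. Q (\<Psi> f) (t, q))"
      using slice[OF fam\<Psi>[OF f] te] slice[OF famQ[OF fam\<Psi>[OF f]] te] by (auto simp: \<Psi>_def)
    have "w t (\<lambda>q. f (\<psi> t q)) = v f"
      using s(1) isotopy_diffeo(4)[OF iso t01] by (simp add: w_def differential_def)
    moreover have "(\<lambda>q. f (\<psi> t q)) = (\<lambda>q. f q + t * Q (\<Psi> f) (t, q))"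
      using Q[of "\<Psi> f" t] by (simp add: \<Psi>_def \<psi>0)
    ultimately have "v f = w t (\<lambda>q. f q + t * Q (\<Psi> f) (t, q))" by simp
    also have "\<dots> = w t f + t * w t (\<lambda>q. Q (\<Psi> f) (t, q))"
      by (simp add: T_add[OF wT[OF t01]] T_cmult[OF wT[OF t01]] s(2) f smooth_fun_cmult)
    finally show ?thesis by simp
  qed
  have wE: "w t g = (\<Sum>j\<in>UNIV. w t (x j) * E j (y t) g)" if "good t" for t g
    using fun_cong[OF F(5)[of "y t" "w t"], of g] wT[of t] that by (simp add: good_def)
  have limE: "((\<lambda>t. E j (y t) (\<lambda>q. h (t, q))) \<longlongrightarrow> E j p (\<lambda>q. h (0, q))) (at_right 0)" if "fam h" for h j
    using lim[OF F(6)[OF open_ball that[unfolded fam_def]] F(1,2)] by simp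
  define c where "c i j t = E j (y t) (\<lambda>q. Q (\<Psi> (x i)) (t, q))" for i j t
  \<comment> \<open>With n the sum of the absolute coordinates of w_t, the implicit equation gives n
    <= |v| + t C n. As C has a limit, t C < 1/2 for small t, and the last term can be absorbed: n <=
    2 |v|.\<close>
  define C where "C t = (\<Sum>i\<in>UNIV. \<Sum>j\<in>UNIV. \<bar>c i j t\<bar>)" for t
  define n where "n t = (\<Sum>i\<in>UNIV. \<bar>w t (x i)\<bar>)" for t
  have "((\<lambda>t. t * C t) \<longlongrightarrow> 0 * (\<Sum>i\<in>UNIV. \<Sum>j\<in>UNIV. \<bar>E j p (\<lambda>q. Q (\<Psi> (x i)) (0, q))\<bar>)) (at_right 0)"
    unfolding C_def c_def
    by (intro tendsto_mult tendsto_sum tendsto_rabs limE famQ fam\<Psi> F(3) tendsto_ident_at)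
  then have "((\<lambda>t. t * C t) \<longlongrightarrow> 0) (at_right 0)" by simp
  then have evC: "\<forall>\<^sub>F t in at_right 0. t * C t < 1 / 2"
    by (rule order_tendstoD) simp
  have nbnd: "n t \<le> 2 * (\<Sum>i\<in>UNIV. \<bar>v (x i)\<bar>)" if t: "good t" "t * C t < 1 / 2" for t
  proof -
    have t0: "t \<ge> 0" using t by (simp add: good_def)
    have "\<bar>w t (x i)\<bar> \<le> \<bar>v (x i)\<bar> + t * (\<Sum>j\<in>UNIV. n t * \<bar>c i j t\<bar>)" for i
    proof -
      have "\<bar>w t (\<lambda>q. Q (\<Psi> (x i)) (t, q))\<bar> \<le> (\<Sum>j\<in>UNIV. \<bar>w t (x j) * c i j t\<bar>)"
        unfolding wE[OF t(1), of "\<lambda>q. Q (\<Psi> (x i)) (t, q)"] c_def by (rule sum_abs)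
      also have "\<dots> \<le> (\<Sum>j\<in>UNIV. n t * \<bar>c i j t\<bar>)"
      proof (rule sum_mono)
        fix j
        have "\<bar>w t (x j)\<bar> \<le> n t" unfolding n_def by (rule member_le_sum) auto
        then show "\<bar>w t (x j) * c i j t\<bar> \<le> n t * \<bar>c i j t\<bar>" by (simp add: abs_mult mult_right_mono)
      qed
      finally have "t * \<bar>w t (\<lambda>q. Q (\<Psi> (x i)) (t, q))\<bar> \<le> t * (\<Sum>j\<in>UNIV. n t * \<bar>c i j t\<bar>)"
        using t0 by (rule mult_left_mono)
      moreover have "\<bar>w t (x i)\<bar> \<le> \<bar>v (x i)\<bar> + t * \<bar>w t (\<lambda>q. Q (\<Psi> (x i)) (t, q))\<bar>"
        unfolding vec[OF t(1) F(3)] using t0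
        by (metis abs_mult abs_of_nonneg abs_triangle_ineq4)
      ultimately show ?thesis by linarith
    qed
    then have "n t \<le> (\<Sum>i\<in>UNIV. \<bar>v (x i)\<bar> + t * (\<Sum>j\<in>UNIV. n t * \<bar>c i j t\<bar>))"
      unfolding n_def by (intro sum_mono) (simp add: n_def)
    also have "\<dots> = (\<Sum>i\<in>UNIV. \<bar>v (x i)\<bar>) + (t * C t) * n t"
      by (simp add: sum.distrib sum_distrib_left[symmetric] C_def mult_ac)
    also have "\<dots> \<le> (\<Sum>i\<in>UNIV. \<bar>v (x i)\<bar>) + 1 / 2 * n t"
      using t(2) by (intro add_left_mono mult_right_mono) (auto simp: n_def sum_nonneg)
    finally show ?thesis by simp
  qed
  have x0: "(\<lambda>t. w t (x i)) \<in> bigt 0" for i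
  proof (rule bigoI[where c="2 * (\<Sum>i\<in>UNIV. \<bar>v (x i)\<bar>)"])
    show "\<forall>\<^sub>F t in at_right 0. norm (w t (x i)) \<le> 2 * (\<Sum>i\<in>UNIV. \<bar>v (x i)\<bar>) * norm (t ^ 0 :: real)"
      using ev evC
    proof eventually_elim
      case (elim t)
      have "\<bar>w t (x i)\<bar> \<le> n t" unfolding n_def by (rule member_le_sum) auto
      then show ?case using nbnd[OF elim] by simp
    qed
  qed
  have w0: "(\<lambda>t. w t (\<lambda>q. h (t, q))) \<in> bigt 0" if "fam h" for h
  proof -
    have "(\<lambda>t. w t (x j) * E j (y t) (\<lambda>q. h (t, q))) \<in> bigt (0 + 0)" for j
      by (rule bigt_mult[OF x0 bigt_tendsto[OF limE[OF that]]])
    then have "(\<lambda>t. \<Sum>j\<in>UNIV. w t (x j) * E j (y t) (\<lambda>q. h (t, q))) \<in> bigt 0"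
      by (intro big_sum_in_bigo) simp
    then show ?thesis
      by (rule bigt_cong) (rule eventually_mono[OF ev], simp add: wE[symmetric])
  qed
  have w1: "(\<lambda>t. w t f - v f) \<in> bigt 1" if f: "smooth_fun A f" for f
  proof -
    have "(\<lambda>t. - 1 * t * w t (\<lambda>q. Q (\<Psi> f) (t, q))) \<in> bigt (0 + 1 + 0)"
      by (intro bigt_mult bigt_const bigt_time w0 famQ fam\<Psi> f)
    then have "(\<lambda>t. - 1 * t * w t (\<lambda>q. Q (\<Psi> f) (t, q))) \<in> bigt 1" by simp
    then show ?thesis
      by (rule bigt_cong) (rule eventually_mono[OF ev], simp add: vec f)
  qed
  have wfam1: "(\<lambda>t. w t (\<lambda>q. h (t, q)) - v (\<lambda>q. h (0, q))) \<in> bigt 1" if h: "fam h" for h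
  proof -
    have s0: "smooth_fun A (\<lambda>q. h (0, q))" using slice[OF h] e(1) by simp
    have "(\<lambda>t. t * w t (\<lambda>q. Q h (t, q))) \<in> bigt 1"
      by (rule bigt_mult[OF bigt_time w0, unfolded add_0_right]) (intro famQ h)
    from sum_in_bigo(1)[OF w1[OF s0] this]
    have "(\<lambda>t. (w t (\<lambda>q. h (0, q)) - v (\<lambda>q. h (0, q))) + t * w t (\<lambda>q. Q h (t, q))) \<in> bigt 1" .
    then show ?thesis
    proof (rule bigt_cong, intro eventually_mono[OF ev])
      fix t assume t: "good t"
      then have t01: "t \<in> {0..1}" and te: "t \<in> ball 0 e" by (auto simp: good_def)
      have "w t (\<lambda>q. h (t, q)) = w t (\<lambda>q. h (0, q) + t * Q h (t, q))"
        by (rule arg_cong[of _ _ "w t"]) (rule ext, rule Q)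
      also have "\<dots> = w t (\<lambda>q. h (0, q)) + t * w t (\<lambda>q. Q h (t, q))"
        by (simp add: T_add[OF wT[OF t01]] T_cmult[OF wT[OF t01]] s0 slice[OF famQ[OF h] te] smooth_fun_cmult)
      finally show "w t (\<lambda>q. h (0, q)) - v (\<lambda>q. h (0, q)) + t * w t (\<lambda>q. Q h (t, q))
          = w t (\<lambda>q. h (t, q)) - v (\<lambda>q. h (0, q))" by simp
    qed
  qed
  \<comment> \<open>The implicit equations are used a second time: the factor multiplying t is by
    now known up to O(t), so the error improves to O(t^2).\<close>
  have "(\<lambda>t. - 1 * t * (Q (\<Psi> f) (t, y t) - Q (\<Psi> f) (0, p))) \<in> bigt (0 + 1 + 1)"
    by (intro bigt_mult bigt_const bigt_time fam1 famQ fam\<Psi> f)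
  then have "(\<lambda>t. - 1 * t * (Q (\<Psi> f) (t, y t) - Q (\<Psi> f) (0, p))) \<in> bigt 2" by (simp add: numeral_2_eq_2)
  then have "jet (\<lambda>t. f (y t)) (f p) (- generator \<psi> p f)"
    unfolding jet_def
    by (rule bigt_cong) (rule eventually_mono[OF ev], simp add: good_def point gen f algebra_simps)
  then show "jet (\<lambda>t. f (inv (\<psi> t) p)) (f p) (- generator \<psi> p f)" by (simp add: y_def)
  have "(\<lambda>t. - 1 * t * (w t (\<lambda>q. Q (\<Psi> f) (t, q)) - v (\<lambda>q. Q (\<Psi> f) (0, q)))) \<in> bigt (0 + 1 + 1)"
    by (intro bigt_mult bigt_const bigt_time wfam1 famQ fam\<Psi> f)
  then have "(\<lambda>t. - 1 * t * (w t (\<lambda>q. Q (\<Psi> f) (t, q)) - v (\<lambda>q. Q (\<Psi> f) (0, q)))) \<in> bigt 2" by (simp add: numeral_2_eq_2)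
  then have "jet (\<lambda>t. w t f) (v f) (- v (\<lambda>q. generator \<psi> q f))"
    unfolding jet_def
    by (rule bigt_cong) (rule eventually_mono[OF ev], simp add: vec gen f algebra_simps)
  then show "jet (\<lambda>t. differential A (inv (\<psi> t)) v f) (v f) (- v (\<lambda>q. generator \<psi> q f))" by (simp add: w_def)
qed

text \<open>Cartan's formula for the Lie derivative.\<close>

definition lie :: "('a \<Rightarrow> 'a tvec) \<Rightarrow> 'a form1 \<Rightarrow> 'a form1" where
  "lie X \<omega> p v = d1 \<omega> p (X p) v + v (\<lambda>q. \<omega> q (X q))"

text \<open>In a local frame the pullback is a finite sum of coordinates of the transported vector
  times coefficients at the moved base point. Both factors have known expansions, and the product
  rule assembles them into -L_X \<omega>.\<close>

lemma pullback_jet: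
  assumes comp: "compact (UNIV :: 'a set)" and iso: "ambient_isotopy A \<psi>"
    and w: "\<omega> \<in> forms1 A T" and v: "v \<in> T p"
  shows "jet (\<lambda>t. pullback1 A A (inv (\<psi> t)) \<omega> p v) (\<omega> p v) (- lie (generator \<psi>) \<omega> p v)"
proof -
  let ?X = "generator \<psi>"
  note X = generator_section[OF iso]
  obtain W x E where F: "open W" "p \<in> W" "\<And>i::'n. smooth_fun A (x i)" "\<And>i. E i \<in> sections A T"
    "\<And>q v. q \<in> W \<Longrightarrow> v \<in> T q \<Longrightarrow> v = (\<lambda>f. \<Sum>i\<in>UNIV. v (x i) * E i q f)"
    by (rule local_frame[of p]) (rule that)
  define l where "l i q = \<omega> q (E i q)" for i q
  have l: "smooth_fun A (l i)" for i unfolding l_def by (rule form_smooth[OF w F(4)])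
  have exp: "\<omega> q u = (\<Sum>i\<in>UNIV. u (x i) * l i q)" if "q \<in> W" "u \<in> T q" for q u
    unfolding l_def
    using arg_cong[OF F(5)[OF that], of "\<omega> q"] form_sum[OF w sections_tangent[OF F(4)]] by (rule trans)
  let ?w = "\<lambda>t. differential A (inv (\<psi> t)) v"
  have j: "jet (\<lambda>t. \<Sum>i\<in>UNIV. ?w t (x i) * l i (inv (\<psi> t) p)) (\<Sum>i\<in>UNIV. v (x i) * l i p)
     (\<Sum>i\<in>UNIV. v (x i) * - ?X p (l i) + - v (\<lambda>q. ?X q (x i)) * l i p)"
    by (intro jet_sum jet_mult inverse_isotopy_jets[OF comp iso v] F(3) l)
  have "\<forall>\<^sub>F t in at_right 0. (\<Sum>i\<in>UNIV. ?w t (x i) * l i (inv (\<psi> t) p)) = pullback1 A A (inv (\<psi> t)) \<omega> p v"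
    using eventually_time inverse_isotopy_tendsto[OF comp iso F(1,2)]
  proof eventually_elim
    case (elim t)
    then have "?w t \<in> T (inv (\<psi> t) p)"
      using differential_tangent[OF atlas atlas isotopy_diffeo(3)[OF iso] v] by blast
    then show ?case using exp[of "inv (\<psi> t) p" "?w t"] elim v by (simp add: pullback1_def)
  qed
  note j2 = jet_cong[OF j this]
  obtain V where V: "V \<in> sections A T" "V p = v" using section_through[OF v] by metis
  note XT = sections_tangent[OF X, of p] and br = lie_bracket_section[OF X V(1)]
  have "d1 \<omega> p (?X p) v = koszul \<omega> ?X V p" using ext_d1_eq[OF w X V(1), of p] V(2) by simp
  then have "lie ?X \<omega> p v = ?X p (\<lambda>q. \<omega> q (V q)) - \<omega> p (lie_bracket ?X V p)"
    by (simp add: lie_def koszul_def V(2))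
  also have "?X p (\<lambda>q. \<omega> q (V q)) = ?X p (\<lambda>q. \<Sum>i\<in>UNIV. V q (x i) * l i q)"
    by (rule T_local[OF XT form_smooth[OF w V(1)] _ F(1,2)])
      (auto intro!: smooth_fun_sum smooth_fun_mult l sections_smooth[OF V(1)] F(3) exp sections_tangent[OF V(1)])
  also have "\<dots> = (\<Sum>i\<in>UNIV. v (x i) * ?X p (l i) + l i p * ?X p (\<lambda>q. V q (x i)))"
    by (simp add: T_sum[OF XT] T_mult[OF XT] smooth_fun_mult l sections_smooth[OF V(1)] F(3) V(2))
  also have "\<omega> p (lie_bracket ?X V p) = (\<Sum>i\<in>UNIV. lie_bracket ?X V p (x i) * l i p)"
    by (rule exp[OF F(2) sections_tangent[OF br]])
  also have "\<dots> = (\<Sum>i\<in>UNIV. (?X p (\<lambda>q. V q (x i)) - v (\<lambda>q. ?X q (x i))) * l i p)"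
    by (simp add: lie_bracket_def V(2))
  \<comment> \<open>The terms with X(V(x_i)) occur both in X(\<omega>(V)) and in \<omega>([X,V]) and
    cancel, so the auxiliary extension V of v disappears.\<close>
  finally have "- lie ?X \<omega> p v = (\<Sum>i\<in>UNIV. v (x i) * - ?X p (l i) + - v (\<lambda>q. ?X q (x i)) * l i p)"
    by (simp add: sum_subtractf[symmetric] sum_negf[symmetric] algebra_simps)
  then show ?thesis using j2 exp[OF F(2) v] by simp
qed

end

section \<open>Isotopies with prescribed generator\<close>

text \<open>Off K the derivative is 0, and on K each directional derivative is continuous, hence
  bounded; the operator norm is at most the sum over basis vectors.\<close>

lemma compact_support_derivative_bound:
  fixes k :: "'a::euclidean_space \<Rightarrow> real"
  assumes k: "smooth_on UNIV k" and K: "compact K" "\<And>x. x \<notin> K \<Longrightarrow> k x = 0"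
  obtains B where "B > 0" "\<And>x. onorm (frechet_derivative k (at x)) \<le> B"
proof -
  have d: "(k has_derivative frechet_derivative k (at x)) (at x)" for x
    by (rule smooth_on_has_derivative[OF k]) simp
  have off: "frechet_derivative k (at x) = (\<lambda>v. 0)" if "x \<notin> K" for x
  proof -
    have o: "open (- K)" using compact_imp_closed[OF K(1)] by (rule open_Compl)
    have "((\<lambda>x. 0) has_derivative (\<lambda>v. 0)) (at x)" by simp
    then have "(k has_derivative (\<lambda>v. 0)) (at x)"
      by (rule has_derivative_transform_within_open[OF _ o]) (use that K(2) in auto)
    then show ?thesis by (rule frechet_derivative_at[symmetric])
  qed
  have "\<exists>M. \<forall>x. norm (frechet_derivative k (at x) b) \<le> M" for b
  proof -
    have "compact ((\<lambda>x. frechet_derivative k (at x) b) ` K)"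
      by (rule compact_continuous_image[OF continuous_on_subset[OF smooth_on_imp_continuous_on[OF
              smooth_on_frechet_derivative[OF k]] subset_UNIV] K(1)])
    then obtain M where M: "\<forall>y\<in>(\<lambda>x. frechet_derivative k (at x) b) ` K. norm y \<le> M"
      using compact_imp_bounded bounded_iff by metis
    have "norm (frechet_derivative k (at x) b) \<le> max M 0" for x
      using M off[of x] by (cases "x \<in> K") auto
    then show ?thesis by blast
  qed
  then obtain M where M: "\<And>b x. norm (frechet_derivative k (at x) b) \<le> M b" by metis
  have "onorm (frechet_derivative k (at x)) \<le> 1 + (\<Sum>b\<in>Basis. M b)" for x
  proof -
    have "onorm (frechet_derivative k (at x)) \<le> (\<Sum>b\<in>Basis. norm (frechet_derivative k (at x) b))"
      by (rule onorm_componentwise[OF has_derivative_bounded_linear[OF d]])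
    also have "\<dots> \<le> (\<Sum>b\<in>Basis. M b)" by (rule sum_mono) (rule M)
    finally show ?thesis by simp
  qed
  moreover have "(\<Sum>b\<in>Basis. M b) \<ge> 0"
    by (rule sum_nonneg) (use M norm_ge_zero order_trans in blast)
  then have "1 + (\<Sum>b\<in>Basis. M b) > 0" by simp
  ultimately show ?thesis using that by blast
qed

text \<open>A perturbation of the identity in one fixed direction: its derivative has an explicit
  inverse (the Sherman--Morrison formula), which makes the smoothness of the inverse map immediate.\<close>

lemma shear_inverse:
  fixes k :: "'a::euclidean_space \<Rightarrow> real"
  assumes k: "smooth_on UNIV k" and B: "\<And>x. onorm (frechet_derivative k (at x)) \<le> B"
    and s: "\<bar>s\<bar> * B \<le> 1 / 2" and e: "norm e = 1"
  obtains G where "smooth_on UNIV G" "\<And>x. G (x + (s * k x) *\<^sub>R e) = x" "\<And>y. G y + (s * k (G y)) *\<^sub>R e = y"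
proof -
  define D where "D x = frechet_derivative k (at x)" for x
  have d: "(k has_derivative D x) (at x)" for x
    unfolding D_def by (rule smooth_on_has_derivative[OF k]) simp
  have lip: "norm ((s * k x) *\<^sub>R e - (s * k y) *\<^sub>R e) \<le> 1 / 2 * norm (x - y)" for x y
  proof -
    have "norm (k x - k y) \<le> B * norm (x - y)"
      by (rule differentiable_bound[of UNIV k D]) (use d B in \<open>auto simp: D_def\<close>)
    then have "\<bar>s\<bar> * \<bar>k x - k y\<bar> \<le> \<bar>s\<bar> * (B * norm (x - y))" by (intro mult_left_mono) auto
    also have "\<dots> \<le> 1 / 2 * norm (x - y)"
      unfolding mult.assoc[symmetric] using s by (intro mult_right_mono) auto
    also have "\<bar>s\<bar> * \<bar>k x - k y\<bar> = norm ((s * k x) *\<^sub>R e - (s * k y) *\<^sub>R e)"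
      by (simp add: scaleR_diff_left[symmetric] e right_diff_distrib[symmetric] abs_mult)
    finally show ?thesis .
  qed
  \<comment> \<open>The bound on s makes x -> y - s k(x) e a contraction with constant 1/2; its
    fixed point is the preimage of y.\<close>
  have "\<exists>!x. y - (s * k x) *\<^sub>R e = x" for y
  proof (rule banach_fix_type[of "1 / 2"], simp, simp, intro allI)
    fix a b
    have "(y - (s * k a) *\<^sub>R e) - (y - (s * k b) *\<^sub>R e) = - ((s * k a) *\<^sub>R e - (s * k b) *\<^sub>R e)" by simp
    then show "dist (y - (s * k a) *\<^sub>R e) (y - (s * k b) *\<^sub>R e) \<le> 1 / 2 * dist a b"
      unfolding dist_norm using lip[of a b] by (simp only: norm_minus_cancel)
  qed
  then obtain G where G: "\<And>y. y - (s * k (G y)) *\<^sub>R e = G y" "\<And>x y. y - (s * k x) *\<^sub>R e = x \<Longrightarrow> x = G y"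
    by metis
  have G1: "G y + (s * k (G y)) *\<^sub>R e = y" for y using G(1)[of y] by (metis diff_add_cancel)
  have G2: "G (x + (s * k x) *\<^sub>R e) = x" for x using G(2)[of "x + (s * k x) *\<^sub>R e" x] by simp
  have Glip: "norm (G y - G z) \<le> 2 * norm (y - z)" for y z
  proof -
    have "G y - G z = (y - z) - ((s * k (G y)) *\<^sub>R e - (s * k (G z)) *\<^sub>R e)"
      using G1[of y] G1[of z] by (simp add: algebra_simps)
    then have "norm (G y - G z) \<le> norm (y - z) + norm ((s * k (G y)) *\<^sub>R e - (s * k (G z)) *\<^sub>R e)"
      by (metis norm_triangle_ineq4)
    then show ?thesis using lip[of "G y" "G z"] by linarith
  qed
  have Gcont: "continuous_on UNIV G"
  proof (rule continuous_at_imp_continuous_on, rule ballI)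
    fix y
    have "((\<lambda>z. G z - G y) \<longlongrightarrow> 0) (at y)"
    proof (rule Lim_null_comparison)
      show "\<forall>\<^sub>F z in at y. norm (G z - G y) \<le> 2 * norm (z - y)" using Glip by simp
      show "((\<lambda>z. 2 * norm (z - y)) \<longlongrightarrow> 0) (at y)" by (auto intro!: tendsto_eq_intros)
    qed
    then show "isCont G y" by (simp add: isCont_def LIM_zero_iff)
  qed
  have pos: "1 + s * D x e > 0" for x
  proof -
    have "norm (D x e) \<le> onorm (D x) * norm e" by (rule onorm[OF has_derivative_bounded_linear[OF d]])
    then have "\<bar>D x e\<bar> \<le> B" using B[of x] e by (simp add: D_def)
    then have "\<bar>s\<bar> * \<bar>D x e\<bar> \<le> \<bar>s\<bar> * B" by (intro mult_left_mono) auto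
    then have "\<bar>s * D x e\<bar> \<le> 1 / 2" using s by (simp add: abs_mult)
    then show ?thesis by linarith
  qed
  \<comment> \<open>The derivative v -> v + s D(v) e is a rank-one perturbation of the identity; its
    inverse subtracts this multiple of e, whose denominator has just been shown positive.\<close>
  define m where "m v x = s * D x v / (1 + s * D x e)" for v x
  have ms: "smooth_on UNIV (m v)" for v
    unfolding m_def D_def
  proof (rule smooth_on_divide)
    show "smooth_on UNIV (\<lambda>x. s * frechet_derivative k (at x) v)"
      "smooth_on UNIV (\<lambda>x. 1 + s * frechet_derivative k (at x) e)"
      by (intro smooth_on_add smooth_on_mult smooth_on_const smooth_on_frechet_derivative[OF k] open_UNIV)+
    show "1 + s * frechet_derivative k (at x) e \<noteq> 0" for x
      using pos[of x] by (simp add: D_def)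
  qed simp
  have Gd: "(G has_derivative (\<lambda>v. v - m v (G y) *\<^sub>R e)) (at y)" for y
  proof (rule has_derivative_inverse_basic[where f="\<lambda>x. x + (s * k x) *\<^sub>R e" and T=UNIV])
    have lD: "linear (D x)" for x by (rule has_derivative_linear[OF d])
    show "((\<lambda>x. x + (s * k x) *\<^sub>R e) has_derivative (\<lambda>v. v + (s * D (G y) v) *\<^sub>R e)) (at (G y))"
      by (auto intro!: derivative_eq_intros d)
    have "linear (\<lambda>v. v - m v (G y) *\<^sub>R e)"
      by (rule linearI)
        (simp_all add: m_def linear_add[OF lD] linear_cmul[OF lD] add_divide_distrib algebra_simps)
    then show "bounded_linear (\<lambda>v. v - m v (G y) *\<^sub>R e)" by (simp add: linear_conv_bounded_linear)
    show "(\<lambda>v. v - m v (G y) *\<^sub>R e) \<circ> (\<lambda>v. v + (s * D (G y) v) *\<^sub>R e) = id"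
    proof
      fix v
      have "D (G y) (v + (s * D (G y) v) *\<^sub>R e) = D (G y) v * (1 + s * D (G y) e)"
        by (simp add: linear_add[OF lD] linear_cmul[OF lD] algebra_simps)
      then have "m (v + (s * D (G y) v) *\<^sub>R e) (G y) = s * D (G y) v"
        using pos[of "G y"] by (simp add: m_def)
      then show "((\<lambda>v. v - m v (G y) *\<^sub>R e) \<circ> (\<lambda>v. v + (s * D (G y) v) *\<^sub>R e)) v = id v" by simp
    qed
    show "isCont G y" using Gcont by (simp add: continuous_on_eq_continuous_at)
  qed (use G1 in auto)
  \<comment> \<open>Bootstrapping: the derivative of G is a smooth function composed with G, so if G
    is C^j then so is its derivative, and G is C^(j+1).\<close>
  have "smooth_on UNIV G"
    unfolding smooth_on_def
  proof
    fix j show "Ck_on j UNIV G"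
    proof (induction j)
      case 0 then show ?case using Gcont by simp
    next
      case (Suc j)
      show ?case
      proof (rule Ck_on_SucI[OF open_UNIV Gd])
        show "Ck_on j UNIV (\<lambda>y. v - m v (G y) *\<^sub>R e)" for v
        proof -
          have "Ck_on j UNIV (\<lambda>y. m v (G y))"
            by (rule Ck_on_compose[OF open_UNIV open_UNIV Suc smooth_onD[OF ms]]) simp
          from Ck_on_bounded_linear[OF bounded_linear_scaleR_left open_UNIV this, of "- e"]
          have "Ck_on j UNIV (\<lambda>y. v + m v (G y) *\<^sub>R (- e))" by (intro Ck_on_add) auto
          then show ?thesis by simp
        qed
      qed
    qed
  qed
  then show ?thesis by (rule that) (rule G2, rule G1)
qed

text \<open>A point of S sent outside S would have a fixed point as its image, against injectivity.
  Hence a shear supported in a chart image preserves that image.\<close>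

lemma inj_fixed_outside:
  assumes "inj H" "\<And>x. x \<notin> K \<Longrightarrow> H x = x" "K \<subseteq> S" "x \<in> S" shows "H x \<in> S"
proof (rule ccontr)
  assume *: "H x \<notin> S"
  then have "H (H x) = H x" using assms(2,3) by blast
  then show False using assms(1,4) * by (metis injD)
qed

context manifold
begin

section \<open>Isotopies supported in a single chart\<close>

definition chart_lift :: "'a set \<Rightarrow> ('a \<Rightarrow> real ^ 'n) \<Rightarrow> (real ^ 'n \<Rightarrow> real ^ 'n) \<Rightarrow> 'a \<Rightarrow> 'a" where
  "chart_lift U \<phi> H q = (if q \<in> U then inv_into U \<phi> (H (\<phi> q)) else q)"

lemma chart_lift_inverse:
  assumes U: "(U, \<phi>) \<in> A" and H: "\<And>x. x \<in> \<phi> ` U \<Longrightarrow> H x \<in> \<phi> ` U" and G: "\<And>x. G (H x) = x"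
  shows "chart_lift U \<phi> G (chart_lift U \<phi> H q) = q"
proof (cases "q \<in> U")
  case True
  then have "H (\<phi> q) \<in> \<phi> ` U" using H by blast
  then show ?thesis
    using True by (simp add: chart_lift_def chart_inv_mem f_inv_into_f G chart_inv[OF U])
qed (simp add: chart_lift_def)

text \<open>The chart domain and the complement of the compact support are open and cover the
  manifold: the lift is given by the chart on the first and is the identity on the second.\<close>

lemma chart_lift_family:
  assumes U: "(U, \<phi>) \<in> A" and K: "compact K" "K \<subseteq> \<phi> ` U" and J: "open J"
    and s: "smooth_on (J \<times> UNIV) (\<lambda>(t, x). H t x)"
    and inj: "\<And>t. t \<in> J \<Longrightarrow> inj (H t)" and fx: "\<And>t x. t \<in> J \<Longrightarrow> x \<notin> K \<Longrightarrow> H t x = x"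
  shows "smooth_family_map A J (\<lambda>t. chart_lift U \<phi> (H t))"
proof (rule smooth_family_mapI[OF J])
  note C = compact_chart_preimage[OF U K]
  let ?K = "inv_into U \<phi> ` K"
  have H: "H t x \<in> \<phi> ` U" if "t \<in> J" "x \<in> \<phi> ` U" for t x
    by (rule inj_fixed_outside[OF inj[OF that(1)] fx[OF that(1)] K(2) that(2)])
  have out: "chart_lift U \<phi> (H t) q = q" if "t \<in> J" "q \<notin> ?K" for t q
    using that C(4)[of q] fx[OF that(1), of "\<phi> q"] chart_inv[OF U] by (auto simp: chart_lift_def)
  have o1: "open (J \<times> U)" using J chart(1)[OF U] by (rule open_Times)
  have o2: "open (J \<times> - ?K)" using J C(3) by (intro open_Times) auto
  have cU: "continuous_on (J \<times> U) (\<lambda>z. \<phi> (snd z))"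
    by (rule continuous_on_compose2[OF chart(4)[OF U]]) (auto intro!: continuous_intros)
  have cH: "continuous_on (J \<times> U) (\<lambda>z. (\<lambda>(t, x). H t x) (fst z, \<phi> (snd z)))"
    by (rule continuous_on_compose2[OF smooth_on_imp_continuous_on[OF s]])
      (auto intro!: continuous_intros cU)
  have c1: "continuous_on (J \<times> U) (\<lambda>(t, p). chart_lift U \<phi> (H t) p)"
  proof (rule continuous_on_eq)
    show "continuous_on (J \<times> U) (\<lambda>z. inv_into U \<phi> ((\<lambda>(t, x). H t x) (fst z, \<phi> (snd z))))"
      by (rule continuous_on_compose2[OF chart(5)[OF U] cH]) (auto intro: H)
  qed (auto simp: chart_lift_def)
  have c2: "continuous_on (J \<times> - ?K) (\<lambda>(t, p). chart_lift U \<phi> (H t) p)"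
    by (rule continuous_on_eq[OF continuous_on_snd[OF continuous_on_id]]) (auto simp: out)
  have "J \<times> UNIV = J \<times> U \<union> J \<times> - ?K" using C(2) by auto
  then show "continuous_on (J \<times> UNIV) (\<lambda>(t, p). chart_lift U \<phi> (H t) p)"
    using continuous_on_open_Un[OF o1 o2 c1 c2] by simp
  fix f assume f: "smooth_fun A f"
  have oJ: "open (J \<times> \<phi> ` U)" using J chart(2)[OF U] by (rule open_Times)
  have "smooth_on (\<phi> ` U) (\<lambda>x. f (inv_into U \<phi> x))" using f U by (auto simp: smooth_fun_def)
  from smooth_on_compose[OF oJ chart(2)[OF U] smooth_on_subset[OF s] this]
  have "smooth_on (J \<times> \<phi> ` U) (\<lambda>z. f (inv_into U \<phi> (case z of (t, x) \<Rightarrow> H t x)))"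
    using H by fastforce
  from fam_on_chart[OF U oJ _ this]
  have "fam_on A {(t, q). q \<in> U \<and> (t, \<phi> q) \<in> J \<times> \<phi> ` U} (\<lambda>(t, q). f (inv_into U \<phi> (H t (\<phi> q))))" by auto
  moreover have "{(t, q). q \<in> U \<and> (t, \<phi> q) \<in> J \<times> \<phi> ` U} = J \<times> U" by auto
  ultimately have g: "fam_on A (J \<times> U) (\<lambda>(t, q). f (inv_into U \<phi> (H t (\<phi> q))))" by (simp only:)
  have "fam_on A (J \<times> UNIV) (\<lambda>(t, q). if q \<in> U then (\<lambda>(t, q). f (inv_into U \<phi> (H t (\<phi> q)))) (t, q) else f (snd (t, q)))"
  proof (rule fam_on_glue[OF chart(1)[OF U] C(3,2) g fam_on_snd[OF f] J])
    fix t q assume t: "t \<in> J" and q: "q \<in> U - ?K"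
    then show "(\<lambda>(t, q). f (inv_into U \<phi> (H t (\<phi> q)))) (t, q) = f (snd (t, q))"
      using out[OF t, of q] by (simp add: chart_lift_def)
  qed
  then show "fam_on A (J \<times> UNIV) (\<lambda>(t, q). f (chart_lift U \<phi> (H t) q))"
    by (rule back_subst[where P="fam_on A (J \<times> UNIV)"]) (auto simp: chart_lift_def fun_eq_iff)
qed

text \<open>Shears of Euclidean space in the i-th coordinate direction with profile a, transported
  by the chart. They fix everything off a compact subset of the chart image, so they extend over the
  manifold by the identity.\<close>

lemma chart_isotopy:
  assumes comp: "compact (UNIV :: 'a set)" and U: "(U, \<phi>) \<in> A" and a: "smooth_fun A a"
    and K: "closed K" "K \<subseteq> U" "\<And>q. q \<notin> K \<Longrightarrow> a q = 0"
  shows "\<exists>\<psi>. ambient_isotopy A \<psi> \<and> generator \<psi> = (\<lambda>q f. a q * coord_field U \<phi> i q f)"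
proof -
  define k where "k x = (if x \<in> \<phi> ` U then a (inv_into U \<phi> x) else 0)" for x
  let ?K = "\<phi> ` K"
  let ?e = "axis i 1 :: real ^ 'n"
  have "compact K" using comp K(1) by (metis Int_UNIV_left compact_Int_closed)
  then have cK: "compact ?K"
    using compact_continuous_image[OF continuous_on_subset[OF chart(4)[OF U] K(2)]] by blast
  have sub: "?K \<subseteq> \<phi> ` U" using K(2) by auto
  have k0: "k x = 0" if "x \<notin> ?K" for x
  proof (cases "x \<in> \<phi> ` U")
    case True
    then have "inv_into U \<phi> x \<notin> K" using that f_inv_into_f[OF True] by (metis imageI)
    then show ?thesis using K(3) by (simp add: k_def)
  qed (simp add: k_def)
  have k: "smooth_on UNIV k"
  proof (rule smooth_on_local)
    fix x
    have "smooth_on (\<phi> ` U) (\<lambda>x. a (inv_into U \<phi> x))" using a U by (auto simp: smooth_fun_def)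
    then have 1: "smooth_on (\<phi> ` U) k"
      by (rule smooth_on_cong[OF chart(2)[OF U], rotated]) (simp add: k_def)
    have o: "open (- ?K)" using compact_imp_closed[OF cK] by (rule open_Compl)
    have 2: "smooth_on (- ?K) k"
      by (rule smooth_on_cong[OF o _ smooth_on_const[of _ 0]]) (simp add: k0)
    show "\<exists>N. open N \<and> x \<in> N \<and> smooth_on N k"
    proof (cases "x \<in> \<phi> ` U")
      case True then show ?thesis using 1 chart(2)[OF U] by (intro exI[of _ "\<phi> ` U"]) simp
    next
      case False then show ?thesis using 2 o sub by (intro exI[of _ "- ?K"]) blast
    qed
  qed
  obtain B where B: "B > 0" "\<And>x. onorm (frechet_derivative k (at x)) \<le> B"
    by (rule compact_support_derivative_bound[OF k cK k0]) (assumption, rule that)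
  \<comment> \<open>A reparametrized time with slope 1 at 0, which leaves the generator unchanged,
    and with |\<tau>| B <= 1/2 at all times because 2 B |t| <= 1 + B^2 t^2. Every shear is thus
    invertible, however large the profile a.\<close>
  define \<tau> where "\<tau> t = t / (1 + B\<^sup>2 * t\<^sup>2)" for t :: real
  have den: "1 + B\<^sup>2 * t\<^sup>2 > 0" for t :: real by (smt (verit) zero_le_mult_iff zero_le_power2)
  have \<tau>B: "\<bar>\<tau> t\<bar> * B \<le> 1 / 2" for t
  proof -
    have "0 \<le> (1 - B * \<bar>t\<bar>)\<^sup>2" by simp
    then have "2 * (\<bar>t\<bar> * B) \<le> 1 + B\<^sup>2 * t\<^sup>2" by (simp add: power2_eq_square algebra_simps)
    then have "\<bar>t\<bar> * B \<le> 1 / 2 * (1 + B\<^sup>2 * t\<^sup>2)" by (simp add: mult_ac)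
    then have "\<bar>t\<bar> * B / (1 + B\<^sup>2 * t\<^sup>2) \<le> 1 / 2" by (simp only: pos_divide_le_eq[OF den])
    moreover have "\<bar>\<tau> t\<bar> = \<bar>t\<bar> / (1 + B\<^sup>2 * t\<^sup>2)" using den[of t] by (simp add: \<tau>_def abs_divide)
    ultimately show ?thesis by simp
  qed
  define H where "H t x = x + (\<tau> t * k x) *\<^sub>R ?e" for t x
  define \<psi> where "\<psi> t = chart_lift U \<phi> (H t)" for t
  have "\<exists>G. smooth_on UNIV G \<and> (\<forall>x. G (H t x) = x) \<and> (\<forall>y. H t (G y) = y)" for t
    unfolding H_def
    by (rule shear_inverse[OF k B(2) \<tau>B, of ?e t]) (simp, blast)
  then obtain G where G: "\<And>t. smooth_on UNIV (G t)" "\<And>t x. G t (H t x) = x" "\<And>t y. H t (G t y) = y" by metis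
  have injH: "inj (H t)" and injG: "inj (G t)" for t
    by (rule inj_on_inverseI, rule G)+
  have Hf: "H t x = x" if "x \<notin> ?K" for t x using k0[OF that] by (simp add: H_def)
  have Gf: "G t x = x" if "x \<notin> ?K" for t x using G(2)[of t x] Hf[OF that, of t] by simp
  have "smooth_on UNIV (\<lambda>z::real \<times> (real ^ 'n). fst z)" "smooth_on UNIV (\<lambda>z::real \<times> (real ^ 'n). snd z)"
    by (intro smooth_on_fst smooth_on_snd smooth_on_id open_UNIV)+
  note p = this
  have "smooth_on UNIV (\<lambda>z::real \<times> (real ^ 'n). fst z / (1 + B\<^sup>2 * (fst z * fst z)))"
    by (rule smooth_on_divide)
      (use den in \<open>auto intro!: smooth_on_add smooth_on_mult p simp: power2_eq_square less_imp_neq[THEN not_sym]\<close>)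
  moreover have "smooth_on UNIV (\<lambda>z::real \<times> (real ^ 'n). k (snd z))"
    by (rule smooth_on_compose[OF _ _ p(2) k]) auto
  ultimately have "smooth_on UNIV (\<lambda>z. snd z + (fst z / (1 + B\<^sup>2 * (fst z * fst z)) * k (snd z)) *\<^sub>R ?e)"
    by (intro smooth_on_add smooth_on_scaleR smooth_on_mult smooth_on_const p open_UNIV)
  then have Hs: "smooth_on (UNIV \<times> UNIV) (\<lambda>(t, x). H t x)"
    by (simp add: H_def \<tau>_def case_prod_unfold power2_eq_square)
  have fam: "smooth_family_map A UNIV \<psi>"
    unfolding \<psi>_def by (rule chart_lift_family[OF U cK sub open_UNIV Hs injH Hf])
  have mapG: "smooth_map A A (chart_lift U \<phi> (G t))" for t
  proof -
    have "smooth_on (UNIV \<times> UNIV) (\<lambda>z::real \<times> (real ^ 'n). G t (snd z))"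
      using smooth_on_compose[OF _ _ p(2) G(1)[of t]] by simp
    then have "smooth_on (UNIV \<times> UNIV) (\<lambda>(s::real, x). G t x)" by (simp add: case_prod_unfold)
    from smooth_map_slice[OF open_UNIV chart_lift_family[OF U cK sub open_UNIV this injG Gf] UNIV_I]
    show ?thesis .
  qed
  have HU: "H t x \<in> \<phi> ` U" and GU: "G t x \<in> \<phi> ` U" if "x \<in> \<phi> ` U" for t x
    using inj_fixed_outside[OF injH Hf sub that] inj_fixed_outside[OF injG Gf sub that] by auto
  have i1: "chart_lift U \<phi> (G t) (\<psi> t q) = q" for t q
    unfolding \<psi>_def by (rule chart_lift_inverse[OF U HU G(2)])
  have i2: "\<psi> t (chart_lift U \<phi> (G t) q) = q" for t q
    unfolding \<psi>_def by (rule chart_lift_inverse[OF U GU G(3)])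
  have bij: "bij (\<psi> t)" for t
    by (rule o_bij[of "chart_lift U \<phi> (G t)"]) (auto simp: fun_eq_iff i1 i2)
  have inv: "inv (\<psi> t) = chart_lift U \<phi> (G t)" for t
    by (rule inv_equality) (auto simp: i1 i2)
  have \<psi>0: "\<psi> 0 = id"
    by (auto simp: \<psi>_def chart_lift_def H_def \<tau>_def chart_inv[OF U] fun_eq_iff)
  have "diffeo A (\<psi> t)" for t
    unfolding diffeo_def inv using bij mapG smooth_map_slice[OF open_UNIV fam UNIV_I] by blast
  then have "ambient_isotopy A \<psi>"
    unfolding ambient_isotopy_def using \<psi>0 fam by blast
  moreover have "generator \<psi> = (\<lambda>q f. a q * coord_field U \<phi> i q f)"
  proof (rule generator_eqI)
    fix q f assume f: "smooth_fun A f"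
    show "((\<lambda>t. f (\<psi> t q)) has_real_derivative a q * coord_field U \<phi> i q f) (at 0)"
    proof (cases "q \<in> U")
      case True
      let ?f = "\<lambda>x. f (inv_into U \<phi> x)"
      let ?D = "frechet_derivative ?f (at (\<phi> q))"
      have kq: "k (\<phi> q) = a q" using True by (simp add: k_def chart_inv[OF U])
      have "(\<tau> has_real_derivative 1) (at 0)"
        unfolding \<tau>_def by (auto intro!: derivative_eq_intros)
      moreover have "(*) (1::real) = (\<lambda>h. h)" by auto
      ultimately have "(\<tau> has_derivative (\<lambda>h. h)) (at 0)" by (simp only: has_field_derivative_def)
      then have d1: "((\<lambda>t. H t (\<phi> q)) has_derivative (\<lambda>h. (h * a q) *\<^sub>R ?e)) (at 0)"
        unfolding H_def kq by (auto intro!: derivative_eq_intros)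
      have H0: "H 0 (\<phi> q) = \<phi> q" by (simp add: H_def \<tau>_def)
      have dD: "(?f has_derivative ?D) (at (H 0 (\<phi> q)))"
        unfolding H0 by (rule chart_has_derivative[OF U True f])
      have "((\<lambda>t. ?f (H t (\<phi> q))) has_derivative (\<lambda>h. ?D ((h * a q) *\<^sub>R ?e))) (at 0)"
        by (rule has_derivative_compose[where g="?f" and f="\<lambda>t. H t (\<phi> q)", OF d1 dD])
      moreover have "(\<lambda>h. ?D ((h * a q) *\<^sub>R ?e)) = (*) (a q * coord_field U \<phi> i q f)"
      proof
        show "?D ((h * a q) *\<^sub>R ?e) = a q * coord_field U \<phi> i q f * h" for h
          using linear_cmul[OF has_derivative_linear[OF dD], of "h * a q" ?e] True f by (simp add: coord_field_def)
      qed
      moreover have "(\<lambda>t. ?f (H t (\<phi> q))) = (\<lambda>t. f (\<psi> t q))" using True by (simp add: \<psi>_def chart_lift_def)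
      ultimately show ?thesis by (simp only: has_field_derivative_def)
    next
      case False
      then show ?thesis by (simp add: \<psi>_def chart_lift_def coord_field_def)
    qed
  qed (simp add: coord_field_def)
  ultimately show ?thesis by blast
qed

section \<open>Composition of isotopies and passage from charts to the whole manifold\<close>

lemma smooth_family_map_subset:
  assumes "smooth_family_map A J \<Psi>" "J' \<subseteq> J" shows "smooth_family_map A J' \<Psi>"
proof -
  have "J' \<times> UNIV \<subseteq> J \<times> (UNIV :: 'a set)" using assms(2) by auto
  moreover have "smooth_on {(t, x). t \<in> J' \<and> x \<in> \<phi> ` U \<and> \<Psi> t (inv_into U \<phi> x) \<in> V} (\<lambda>(t, x). \<psi> (\<Psi> t (inv_into U \<phi> x)))"
    if "(U, \<phi>) \<in> A" "(V, \<psi>) \<in> A" for U \<phi> V \<psi>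
  proof (rule smooth_on_subset)
    show "smooth_on {(t, x). t \<in> J \<and> x \<in> \<phi> ` U \<and> \<Psi> t (inv_into U \<phi> x) \<in> V} (\<lambda>(t, x). \<psi> (\<Psi> t (inv_into U \<phi> x)))"
      using assms(1) that unfolding smooth_family_map_def by fastforce
  qed (use assms(2) in auto)
  ultimately show ?thesis
    using assms(1) continuous_on_subset unfolding smooth_family_map_def by blast
qed

text \<open>Writing f o \<psi>_t = f + t Q_t and evaluating at \<eta>_t(q) gives t Q_t(\<eta>_t(q))
  + f(\<eta>_t(q)). The first summand has derivative Q_0(q) at t = 0, the second the generator of
  \<eta>; no chain rule on the manifold is needed.\<close>

lemma isotopy_compose:
  assumes \<psi>: "ambient_isotopy A \<psi>" and \<eta>: "ambient_isotopy A \<eta>"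
  shows "ambient_isotopy A (\<lambda>t. \<psi> t \<circ> \<eta> t)"
    and "generator (\<lambda>t. \<psi> t \<circ> \<eta> t) = (\<lambda>q f. generator \<psi> q f + generator \<eta> q f)"
proof -
  obtain J1 J2 where J: "open J1" "{0..1} \<subseteq> J1" "smooth_family_map A J1 \<psi>"
    "open J2" "{0..1} \<subseteq> J2" "smooth_family_map A J2 \<eta>"
    using assms by (auto simp: ambient_isotopy_def)
  define J where "J = J1 \<inter> J2"
  have oJ: "open J" and subJ: "{0..1} \<subseteq> J" using J by (auto simp: J_def)
  have f1: "smooth_family_map A J \<psi>" and f2: "smooth_family_map A J \<eta>"
    using smooth_family_map_subset J by (auto simp: J_def)
  have c: "continuous_on (J \<times> UNIV) (\<lambda>z. \<psi> (fst z) (snd z))" "continuous_on (J \<times> UNIV) (\<lambda>z. \<eta> (fst z) (snd z))"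
    using f1 f2 by (auto simp: smooth_family_map_def case_prod_unfold)
  have fam: "smooth_family_map A J (\<lambda>t. \<psi> t \<circ> \<eta> t)"
  proof (rule smooth_family_mapI[OF oJ])
    have "continuous_on (J \<times> UNIV) (\<lambda>z. (\<lambda>z. \<psi> (fst z) (snd z)) (fst z, \<eta> (fst z) (snd z)))"
      by (rule continuous_on_compose2[OF c(1)]) (auto intro!: continuous_intros c(2))
    then show "continuous_on (J \<times> UNIV) (\<lambda>(t, p). (\<psi> t \<circ> \<eta> t) p)" by (simp add: case_prod_unfold)
    fix f assume f: "smooth_fun A f"
    from fam_on_family_map[OF oJ f2 fam_on_family_map[OF oJ f1 fam_on_snd[OF f]]]
    show "fam_on A (J \<times> UNIV) (\<lambda>(t, q). f ((\<psi> t \<circ> \<eta> t) q))" by simp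
  qed
  have "diffeo A (\<psi> t \<circ> \<eta> t)" if t: "t \<in> {0..1}" for t
  proof -
    note d1 = isotopy_diffeo[OF \<psi> t] and d2 = isotopy_diffeo[OF \<eta> t]
    have comp: "smooth_map A A (F \<circ> G)" if F: "smooth_map A A F" and G: "smooth_map A A G" for F G
    proof (rule smooth_mapI)
      show "continuous_on UNIV (F \<circ> G)"
        using F G continuous_on_compose[of UNIV G F] continuous_on_subset by (force simp: smooth_map_def)
      show "smooth_fun A (\<lambda>q. f ((F \<circ> G) q))" if "smooth_fun A f" for f
        using smooth_fun_smooth_map[OF atlas atlas G smooth_fun_smooth_map[OF atlas atlas F that]] by simp
    qed
    show ?thesis
      unfolding diffeo_def o_inv_distrib[OF d1(1) d2(1)]
      using comp d1(2,3) d2(2,3) bij_comp[OF d2(1) d1(1)] by blast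
  qed
  moreover have "\<psi> 0 \<circ> \<eta> 0 = id" using assms by (simp add: ambient_isotopy_def)
  ultimately show iso: "ambient_isotopy A (\<lambda>t. \<psi> t \<circ> \<eta> t)"
    unfolding ambient_isotopy_def using oJ subJ fam by blast
  have 0: "\<psi> 0 = id" "\<eta> 0 = id" using assms by (auto simp: ambient_isotopy_def)
  show "generator (\<lambda>t. \<psi> t \<circ> \<eta> t) = (\<lambda>q f. generator \<psi> q f + generator \<eta> q f)"
  proof (rule generator_eqI)
    fix q f assume f: "smooth_fun A f"
    have "0 \<in> J" using subJ by auto
    then obtain e where e: "e > 0" "ball 0 e \<subseteq> J" using oJ openE by blast
    have sube: "ball 0 e \<times> UNIV \<subseteq> J \<times> (UNIV :: 'a set)" using e by auto
    let ?h = "\<lambda>(t, q). f (\<psi> t q)"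
    let ?Q = "\<lambda>(t, q). time_quotient (\<lambda>t. ?h (t, q)) t"
    have "fam_on A (J \<times> UNIV) ?h" using fam_on_family_map[OF oJ f1 fam_on_snd[OF f]] by simp
    then have "fam_on A (ball 0 e \<times> UNIV) ?h" using sube by (rule fam_on_subset)
    from fam_on_time_quotient[OF this] have Q: "fam_on A (ball 0 e \<times> UNIV) ?Q" .
    have "fam_on A (ball 0 e \<times> UNIV) (\<lambda>(t, q). ?Q (t, \<eta> t q))"
      by (rule fam_on_family_map[OF open_ball smooth_family_map_subset[OF f2 e(2)] Q])
    then have "continuous_on (ball 0 e \<times> UNIV) (\<lambda>(t, q). ?Q (t, \<eta> t q))"
      by (rule fam_on_continuous[rotated]) (simp add: open_Times)
    then have "continuous_on (ball 0 e) (\<lambda>t. (\<lambda>(t, q). ?Q (t, \<eta> t q)) (t, q))"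
      by (rule continuous_on_compose2) (auto intro!: continuous_intros)
    then have cont: "isCont (\<lambda>t. ?Q (t, \<eta> t q)) 0" using e(1) by (simp add: continuous_on_eq_continuous_at)
    have Q0: "?Q (0, \<eta> 0 q) = generator \<psi> q f" by (simp add: 0 time_quotient_def generator_def f)
    have "((\<lambda>t. t * ?Q (t, \<eta> t q)) has_real_derivative generator \<psi> q f) (at 0)"
      unfolding CARAT_DERIV
    proof (intro exI[of _ "\<lambda>t. ?Q (t, \<eta> t q)"] conjI allI)
      show "z * ?Q (z, \<eta> z q) - 0 * ?Q (0, \<eta> 0 q) = ?Q (z, \<eta> z q) * (z - 0)" for z
        by (simp only: mult_zero_left diff_zero mult.commute)
    qed (rule cont, rule Q0)
    from DERIV_add[OF this generator_derivative[OF \<eta> f]]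
    have "((\<lambda>t. t * ?Q (t, \<eta> t q) + f (\<eta> t q)) has_real_derivative generator \<psi> q f + generator \<eta> q f) (at 0)" .
    moreover have "t * ?Q (t, \<eta> t q) + f (\<eta> t q) = f ((\<psi> t \<circ> \<eta> t) q)" for t
      using time_quotient_family[of ?h t "\<eta> t q"] by (simp add: 0)
    ultimately show "((\<lambda>t. f ((\<psi> t \<circ> \<eta> t) q)) has_real_derivative generator \<psi> q f + generator \<eta> q f) (at 0)"
      by (simp only:)
  qed (simp add: generator_def)
qed

text \<open>To first order, composition adds velocities, so finitely many isotopies compose to one
  with the sum of the generators, whatever the order of the factors.\<close>

lemma isotopy_sum:
  assumes "finite I" "\<And>i. i \<in> I \<Longrightarrow> \<exists>\<psi>. ambient_isotopy A \<psi> \<and> generator \<psi> = X i"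
  shows "\<exists>\<psi>. ambient_isotopy A \<psi> \<and> generator \<psi> = (\<lambda>q f. \<Sum>i\<in>I. X i q f)"
  using assms
proof (induction I rule: finite_induct)
  case empty
  have "smooth_family_map A UNIV (\<lambda>t. id)"
  proof (rule smooth_family_mapI)
    show "continuous_on (UNIV \<times> UNIV) (\<lambda>(t::real, p::'a). id p)"
      by (simp add: case_prod_unfold continuous_on_snd continuous_on_id)
    show "fam_on A (UNIV \<times> UNIV) (\<lambda>(t, q). f (id q))" if "smooth_fun A f" for f
      using fam_on_snd[OF that, of UNIV] by (simp add: case_prod_unfold)
  qed simp
  moreover from smooth_map_slice[OF open_UNIV this UNIV_I] have "diffeo A id" by (simp add: diffeo_def)
  ultimately have "ambient_isotopy A (\<lambda>t. id)" unfolding ambient_isotopy_def by blast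
  moreover have "generator (\<lambda>t. id) = (\<lambda>q f. \<Sum>i\<in>{}. X i q f)"
    by (rule generator_eqI) auto
  ultimately show ?case by blast
next
  case (insert j I)
  obtain \<psi> where 1: "ambient_isotopy A \<psi>" "generator \<psi> = X j" using insert.prems by blast
  obtain \<eta> where 2: "ambient_isotopy A \<eta>" "generator \<eta> = (\<lambda>q f. \<Sum>i\<in>I. X i q f)"
    using insert.IH insert.prems by blast
  have eq: "(\<lambda>q f. \<Sum>i\<in>insert j I. X i q f) = (\<lambda>q f. generator \<psi> q f + generator \<eta> q f)"
    using insert.hyps by (simp add: 1 2)
  show ?case
    unfolding eq by (intro exI[of _ "\<lambda>t. \<psi> t \<circ> \<eta> t"] conjI isotopy_compose[OF 1(1) 2(1)])
qed

text \<open>Near p the cut-off field is a finite sum of coordinate fields with supported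
  coefficients, one shear isotopy for each. The free factor c leaves room for the weights of a
  partition of unity.\<close>

lemma local_isotopy_with_generator:
  assumes comp: "compact (UNIV :: 'a set)" and X: "X \<in> sections A T"
  obtains \<beta> N where "smooth_fun A \<beta>" "open N" "p \<in> N" "\<And>q. 0 \<le> \<beta> q" "\<And>q. q \<in> N \<Longrightarrow> \<beta> q = (1::real)"
    "\<And>c. smooth_fun A c \<Longrightarrow> \<exists>\<psi>. ambient_isotopy A \<psi> \<and> generator \<psi> = (\<lambda>q f. c q * \<beta> q * X q f)"
proof -
  obtain U \<phi> W K' x where U: "(U, \<phi>) \<in> A" and W: "open W" "p \<in> W" "W \<subseteq> K'" "K' \<subseteq> U" and x: "\<And>i::'n. smooth_fun A (x i)"
    and e: "\<And>q v. q \<in> W \<Longrightarrow> v \<in> T q \<Longrightarrow> v = (\<lambda>f. \<Sum>i\<in>UNIV. v (x i) * coord_field U \<phi> i q f)"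
    by (rule chart_coordinates[of p]) (rule that)
  obtain \<beta> N K where b: "smooth_fun A \<beta>" "open N" "p \<in> N" "N \<subseteq> K" "closed K" "K \<subseteq> W" "\<And>q. 0 \<le> \<beta> q"
    "\<And>q. q \<in> N \<Longrightarrow> \<beta> q = (1::real)" "\<And>q. q \<notin> K \<Longrightarrow> \<beta> q = 0"
    by (rule bump_at[OF W(1,2)]) (rule that)
  have KU: "K \<subseteq> U" using b(6) W(3,4) by blast
  show ?thesis
  proof (rule that[OF b(1-3,7,8)])
    fix c assume c: "smooth_fun A c"
    define a where "a i q = c q * \<beta> q * X q (x i)" for i q
    have as: "smooth_fun A (a i)" for i
      unfolding a_def by (intro smooth_fun_mult c b(1) sections_smooth[OF X] x)
    have a0: "a i q = 0" if "q \<notin> K" for i q using b(9)[OF that] by (simp add: a_def)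
    have "(\<lambda>q f. \<Sum>i\<in>UNIV. a i q * coord_field U \<phi> i q f) = (\<lambda>q f. c q * \<beta> q * X q f)"
    proof (intro ext)
      fix q f
      show "(\<Sum>i\<in>UNIV. a i q * coord_field U \<phi> i q f) = c q * \<beta> q * X q f"
      proof (cases "q \<in> K")
        case True
        then have "q \<in> W" using b(6) by blast
        from fun_cong[OF e[OF this sections_tangent[OF X]], of f] show ?thesis
          by (simp add: a_def sum_distrib_left mult.assoc)
      next
        case False then show ?thesis by (simp add: a0 b(9))
      qed
    qed
    moreover have "\<exists>\<psi>. ambient_isotopy A \<psi> \<and> generator \<psi> = (\<lambda>q f. \<Sum>i\<in>UNIV. a i q * coord_field U \<phi> i q f)"
      by (rule isotopy_sum[OF finite chart_isotopy[OF comp U as b(5) KU a0]])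
    ultimately show "\<exists>\<psi>. ambient_isotopy A \<psi> \<and> generator \<psi> = (\<lambda>q f. c q * \<beta> q * X q f)" by simp
  qed
qed

text \<open>Finitely many of the sets where a local bump equals 1 cover the compact manifold.
  Dividing the bumps by their positive sum S gives a partition of unity, and composing the
  corresponding isotopies adds the pieces up to X.\<close>

lemma isotopy_with_generator:
  assumes comp: "compact (UNIV :: 'a set)" and X: "X \<in> sections A T"
  shows "\<exists>\<psi>. ambient_isotopy A \<psi> \<and> generator \<psi> = X"
proof -
  define good where "good p \<beta> N \<longleftrightarrow> smooth_fun A \<beta> \<and> open N \<and> p \<in> N \<and> (\<forall>q. 0 \<le> \<beta> q) \<and> (\<forall>q\<in>N. \<beta> q = (1::real)) \<and>
    (\<forall>c. smooth_fun A c \<longrightarrow> (\<exists>\<psi>. ambient_isotopy A \<psi> \<and> generator \<psi> = (\<lambda>q f. c q * \<beta> q * X q f)))" for p \<beta> N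
  have "\<exists>\<beta> N. good p \<beta> N" for p
    by (rule local_isotopy_with_generator[OF comp X, of p]) (unfold good_def, blast)
  then obtain \<beta> N where g: "\<And>p. good p (\<beta> p) (N p)" by metis
  have b: "smooth_fun A (\<beta> p)" "open (N p)" "p \<in> N p" "0 \<le> \<beta> p q" "q \<in> N p \<Longrightarrow> \<beta> p q = 1" for p q
    using g[of p] by (auto simp: good_def)
  have iso: "\<exists>\<psi>. ambient_isotopy A \<psi> \<and> generator \<psi> = (\<lambda>q f. c q * \<beta> p q * X q f)" if "smooth_fun A c" for p c
    by (rule g[of p, unfolded good_def, THEN conjunct2, THEN conjunct2, THEN conjunct2, THEN conjunct2,
          THEN conjunct2, THEN spec, THEN mp, OF that])
  have "UNIV \<subseteq> (\<Union>p\<in>UNIV. N p)" using b(3) by blast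
  then obtain P where P: "finite P" "(UNIV :: 'a set) \<subseteq> (\<Union>p\<in>P. N p)"
    by (rule compactE_image[OF comp b(2)]) (rule that)
  define S where "S q = (\<Sum>p\<in>P. \<beta> p q)" for q
  have S: "S q > 0" for q
  proof -
    obtain p where p: "p \<in> P" "q \<in> N p" using P(2) by blast
    have "\<beta> p q \<le> S q" unfolding S_def by (rule member_le_sum) (use p P(1) b(4) in auto)
    then show ?thesis using b(5)[OF p(2)] by simp
  qed
  have "smooth_fun A S" unfolding S_def by (intro smooth_fun_sum b)
  then have s: "smooth_fun A (\<lambda>q. 1 / S q)"
    by (rule smooth_fun_divide[OF smooth_fun_const]) (use S less_imp_neq[THEN not_sym] in blast)
  have "\<exists>\<psi>. ambient_isotopy A \<psi> \<and> generator \<psi> = (\<lambda>q f. \<Sum>p\<in>P. 1 / S q * \<beta> p q * X q f)"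
    by (rule isotopy_sum[OF P(1) iso[OF s]])
  moreover have "(\<lambda>q f. \<Sum>p\<in>P. 1 / S q * \<beta> p q * X q f) = X"
  proof (intro ext)
    fix q f
    have "(\<Sum>p\<in>P. 1 / S q * \<beta> p q * X q f) = 1 / S q * S q * X q f"
      by (simp only: S_def[of q] sum_distrib_left sum_distrib_right)
    then show "(\<Sum>p\<in>P. 1 / S q * \<beta> p q * X q f) = X q f" using S[of q] by simp
  qed
  ultimately show ?thesis by simp
qed

end

section \<open>Gauge equivalences\<close>

context foliation
begin

text \<open>On a leafwise v, where \<lambda>(v) = 0, the identity d\<lambda> = \<delta> \<and>
  \<lambda> gives d\<lambda>(X, v) = -\<delta>(v) \<lambda>(X). Together with v(\<lambda>(X)) from
  Cartan's formula this is a twisted differential.\<close>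

lemma lie_F:
  assumes "X \<in> sections A T" "v \<in> F p"
  shows "lie X lam p v = - twisted_d0 A lam (\<lambda>q. - lam q (X q)) p v"
proof -
  have "v (\<lambda>q. - lam q (X q)) = - v (\<lambda>q. lam q (X q))"
    by (rule T_minus[OF F_T[OF assms(2)] form_smooth[OF lam assms(1)]])
  moreover have "\<theta> p v = del p v" using assms(2) by (simp add: \<theta>_eq del_def F_T)
  moreover have "d1 lam p (X p) v = - del p v * lam p (X p)"
    using assms(2) unfolding d1_lam by (simp add: wedge11_def F_iff)
  ultimately show ?thesis
    using assms(2) by (simp add: lie_def twisted_d0_eq)
qed

text \<open>On a leafwise vector \<lambda> vanishes, so both sides of the gauge relation can be
  divided by t. As t tends to 0 from the right, g tends to 1, one side tends to \<mu> and the other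
  to -L_X \<lambda>.\<close>

lemma gauge_subset:
  assumes comp: "compact (UNIV :: 'a set)" and mu: "\<mu> \<in> gauge_deformations A lam L"
  shows "\<exists>f. smooth_fun A f \<and> \<mu> = twisted_d0 A lam f"
proof -
  obtain \<psi> g r J where m: "\<mu> \<in> forms1 A F" and iso: "ambient_isotopy A \<psi>"
    and J: "open J" "{0..1} \<subseteq> J" "smooth_family_fun A J g" and g0: "g 0 = (\<lambda>p. 1)"
    and eq': "\<forall>t\<in>{0..1}. \<forall>p. \<forall>v\<in>T p.
      pullback1 A A (inv (\<psi> t)) lam p v = g t p * (lam p v + t * ext \<mu> p v + r t p v)"
    and r': "\<forall>p. \<forall>v\<in>T p. (\<lambda>t. r t p v) \<in> bigt 2"
    using mu unfolding gauge_deformations_def mem_Collect_eq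
    by (elim conjE exE) (rule that; assumption)
  note eq = eq'[rule_format] and r = r'[rule_format]
  let ?X = "generator \<psi>"
  note X = generator_section[OF iso]
  let ?f = "\<lambda>q. - lam q (?X q)"
  have f: "smooth_fun A ?f" by (intro smooth_fun_minus form_smooth[OF lam X])
  have "\<mu> p v = twisted_d0 A lam ?f p v" for p v
  proof (cases "v \<in> F p")
    case True
    have vT: "v \<in> T p" and l0: "lam p v = 0" using True by (auto simp: F_iff)
    have "jet (\<lambda>t. pullback1 A A (inv (\<psi> t)) lam p v) 0 (- lie ?X lam p v)"
      using pullback_jet[OF comp iso lam vT] l0 by simp
    then have 1: "((\<lambda>t. pullback1 A A (inv (\<psi> t)) lam p v / t) \<longlongrightarrow> - lie ?X lam p v) (at_right 0)"
      by (rule jet_tendsto)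
    have oJ: "open (J \<times> (UNIV :: 'a set))" using J(1) by (simp add: open_Times)
    have "continuous_on (J \<times> UNIV) (\<lambda>(t, q). g t q)"
      by (rule fam_on_continuous[OF oJ]) (use J(3) smooth_family_fun_iff in blast)
    then have "continuous_on J (\<lambda>t. (\<lambda>(t, q). g t q) (t, p))"
      by (rule continuous_on_compose2) (auto intro!: continuous_intros)
    moreover have "0 \<in> J" using J(2) by auto
    ultimately have "isCont (\<lambda>t. g t p) 0" using J(1) by (simp add: continuous_on_eq_continuous_at)
    then have "((\<lambda>t. g t p) \<longlongrightarrow> 1) (at 0)" using g0 by (simp add: isCont_def)
    then have gl: "((\<lambda>t. g t p) \<longlongrightarrow> 1) (at_right 0)" by (rule filterlim_mono[OF _ order_refl at_le]) simp
    have "jet (\<lambda>t. t * \<mu> p v + r t p v) 0 (\<mu> p v)"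
      unfolding jet_def using r[OF vT] by simp
    from tendsto_mult[OF gl jet_tendsto[OF this]]
    have 2: "((\<lambda>t. g t p * ((t * \<mu> p v + r t p v) / t)) \<longlongrightarrow> \<mu> p v) (at_right 0)" by simp
    have "\<forall>\<^sub>F t in at_right 0. g t p * ((t * \<mu> p v + r t p v) / t) = pullback1 A A (inv (\<psi> t)) lam p v / t"
      using eventually_time by eventually_elim (simp add: eq vT l0 ext_on_F[OF True])
    from Lim_transform_eventually[OF 2 this] 1 have "\<mu> p v = - lie ?X lam p v"
      by (intro tendsto_unique[OF trivial_limit_at_right_real])
    then show ?thesis using lie_F[OF X True] by simp
  next
    case False
    then show ?thesis by (simp add: form_outside[OF m] twisted_d0_eq)
  qed
  then show ?thesis using f by (intro exI[of _ ?f]) auto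
qed

lemma jet_exp: "jet (\<lambda>t. exp (t * c)) 1 c"
proof -
  \<comment> \<open>From exp(-x) >= 1 - x one gets exp x <= 1 / (1 - x), hence exp x - 1 - x <= x^2
    / (1 - x); the bound x < 1/2 produces the constant 2.\<close>
  have b: "\<bar>exp x - 1 - x\<bar> \<le> 2 * x\<^sup>2" if "x < 1 / 2" for x :: real
  proof -
    have "exp x * (1 - x) \<le> exp x * exp (- x)"
      using exp_ge_add_one_self[of "- x"] by (intro mult_left_mono) auto
    also have "\<dots> = 1" by (simp add: exp_minus)
    finally have "exp x \<le> 1 / (1 - x)" using that by (simp add: pos_le_divide_eq)
    then have "exp x - 1 - x \<le> x\<^sup>2 / (1 - x)" using that by (simp add: field_simps power2_eq_square)
    also have "\<dots> \<le> x\<^sup>2 / (1 / 2)" using that by (intro divide_left_mono) auto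
    finally have "exp x - 1 - x \<le> 2 * x\<^sup>2" by simp
    then show ?thesis using exp_ge_add_one_self[of x] by linarith
  qed
  have "((\<lambda>t. t * c) \<longlongrightarrow> 0 * c) (at_right 0)" by (intro tendsto_intros)
  then have "\<forall>\<^sub>F t in at_right 0. t * c < 1 / 2" by (intro order_tendstoD) auto
  then have "\<forall>\<^sub>F t in at_right 0. norm (exp (t * c) - 1 - t * c) \<le> (2 * c\<^sup>2) * norm (t\<^sup>2)"
  proof eventually_elim
    case (elim t)
    show ?case using b[OF elim] by (simp add: power_mult_distrib mult_ac)
  qed
  then show ?thesis unfolding jet_def by (rule bigoI)
qed

lemma lie_decomp:
  assumes X: "X \<in> sections A T" and v: "v \<in> T p"
  shows "lie X lam p v = lie X lam p (pr p v) + lam p v * lie X lam p (\<nu> p)"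
proof -
  have "d1 lam p (X p) v = d1 lam p (X p) (pr p v) + lam p v * d1 lam p (X p) (\<nu> p)"
    using ext_d1_comb_right[OF lam pr_in(2)[OF v] \<nu>_tangent sections_tangent[OF X], of 1 "lam p v"] pr_decomp[of v p]
    by simp
  then show ?thesis by (simp add: lie_def pr_def algebra_simps)
qed

lemma gauge_superset:
  assumes comp: "compact (UNIV :: 'a set)" and f: "smooth_fun A f"
  shows "twisted_d0 A lam f \<in> gauge_deformations A lam L"
proof -
  let ?X = "\<lambda>p h. - f p * \<nu> p h"
  let ?m = "twisted_d0 A lam f"
  have X: "?X \<in> sections A T" by (rule sections_scale[OF \<nu>_section smooth_fun_minus[OF f]])
  have lX: "lam q (?X q) = - f q" for q using form_scale[OF lam \<nu>_tangent, of q "- f q"] by (simp add: lam_\<nu>)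
  obtain \<psi> where iso: "ambient_isotopy A \<psi>" and gen: "generator \<psi> = ?X"
    using isotopy_with_generator[OF comp X] by blast
  \<comment> \<open>The value of -L_X \<lambda> on \<nu>, which no extended tangential form can
    match. Taking \<open>g\<close> exponential in it gives a factor that is 1 at t = 0 and never
    vanishes.\<close>
  define k where "k p = - lie ?X lam p (\<nu> p)" for p
  have k: "smooth_fun A k"
    unfolding k_def lie_def
    by (intro smooth_fun_minus smooth_fun_add ext_d1_smooth[OF lam X \<nu>_section]
        sections_smooth[OF \<nu>_section form_smooth[OF lam X]])
  define g where "g t p = exp (t * k p)" for t p
  \<comment> \<open>The remainder is obtained by solving the required relation for it, so that the
    relation holds identically; what has to be proved is the order O(t^2).\<close>
  define r where "r t p v = pullback1 A A (inv (\<psi> t)) lam p v / g t p - lam p v - t * ext ?m p v" for t p v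
  have gs: "smooth_family_fun A UNIV g"
  proof -
    have "fam_on A UNIV (\<lambda>z. fst z * k (snd z))"
      by (intro fam_on_mult open_UNIV fam_on_snd k fam_on_time[where k="\<lambda>t. t" and J=UNIV]) (auto intro: smooth_on_id)
    then have "fam_on A UNIV (\<lambda>z. exp (fst z * k (snd z)))"
      by (rule fam_on_compose_real[OF open_UNIV _ smooth_on_exp open_UNIV]) simp
    then show ?thesis by (simp add: smooth_family_fun_iff g_def case_prod_unfold)
  qed
  have e: "ext ?m p v = - lie ?X lam p v - k p * lam p v" if v: "v \<in> T p" for p v
  proof -
    have "ext ?m p v = ?m p (pr p v)" using v by (simp add: ext_eq)
    also have "\<dots> = - lie ?X lam p (pr p v)" using lie_F[OF X pr_in(1)[OF v]] by (simp only: lX minus_minus)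
    also have "\<dots> = - lie ?X lam p v - k p * lam p v" using lie_decomp[OF X v] by (simp add: k_def)
    finally show ?thesis .
  qed
  have r2: "(\<lambda>t. r t p v) \<in> bigt 2" if v: "v \<in> T p" for p v
  proof -
    \<comment> \<open>Division by \<open>g\<close> is multiplication by exp(-t k), whose first-order
      term removes the \<nu>-component of -L_X \<lambda>.\<close>
    have "jet (\<lambda>t. pullback1 A A (inv (\<psi> t)) lam p v * exp (t * - k p)) (lam p v * 1) (lam p v * - k p + - lie ?X lam p v * 1)"
      using jet_mult[OF pullback_jet[OF comp iso lam v] jet_exp, of "- k p"] by (simp only: gen)
    moreover have "lam p v * - k p + - lie ?X lam p v * 1 = ext ?m p v" using e[OF v] by simp
    moreover have "pullback1 A A (inv (\<psi> t)) lam p v * exp (t * - k p) = pullback1 A A (inv (\<psi> t)) lam p v / g t p" for t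
      by (simp add: g_def exp_minus divide_inverse)
    ultimately have "jet (\<lambda>t. pullback1 A A (inv (\<psi> t)) lam p v / g t p) (lam p v) (ext ?m p v)"
      by (simp only: mult_1_right)
    then show ?thesis unfolding jet_def r_def .
  qed
  have "pullback1 A A (inv (\<psi> t)) lam p v = g t p * (lam p v + t * ext ?m p v + r t p v)" for t p v
    by (simp add: r_def g_def)
  moreover have "g 0 = (\<lambda>p. 1)" "g t p \<noteq> 0" for t p by (auto simp: g_def)
  ultimately show ?thesis
    unfolding gauge_deformations_def
    using twisted_d0_form[OF f] iso gs r2
    by (intro CollectI conjI exI[of _ \<psi>] exI[of _ g] exI[of _ r] exI[of _ UNIV]) auto
qed

theorem gauge_deformations_eq:
  assumes "compact (UNIV :: 'a set)"
  shows "gauge_deformations A lam L = {twisted_d0 A lam f | f. smooth_fun A f}"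
  using gauge_subset[OF assms] gauge_superset[OF assms] by blast

end

text \<open>The set of cosets in \<open>form_quotient\<close> is a vector space quotient for nested
  subspaces; the first three conjuncts ensure that the fourth speaks of one.\<close>

theorem corollary1p13:
  fixes n :: nat
    and B :: "('m::{t2_space, second_countable_topology}, 'k::finite) atlas"
    and A :: "('y::{t2_space, second_countable_topology}, 'd::finite) atlas"
    and \<alpha> :: "'m form1" and \<iota> :: "'y \<Rightarrow> 'm"
    and lam :: "'y form1" and L :: "'y dist"
  assumes dim_M: "CARD('k) = 2 * n + 1"
    and M: "smooth_atlas B" "contact_form B \<alpha>"
    and dim_Y: "CARD('d) = n + 1"
    and Y: "smooth_atlas A" "compact (UNIV :: 'y set)" "orientable A"
    and sub: "smooth_embedding A B \<iota>"
    and lam: "lam = pullback1 A B \<iota> \<alpha>"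
    and coisotropic: "coisotropic A lam"
    and nonsingular: "nowhere_zero A lam"
    and L: "line_field A L" "transverse A L (ker_form A lam)"
  shows "form_subspace (infinitesimal_deformations A lam L) \<and>
         form_subspace (gauge_deformations A lam L) \<and>
         gauge_deformations A lam L \<subseteq> infinitesimal_deformations A lam L \<and>
         form_quotient (infinitesimal_deformations A lam L) (gauge_deformations A lam L)
           = H1_tw A lam"
proof -
  have "smooth_map A B \<iota>" using sub by (simp add: smooth_embedding_def)
  moreover have "\<alpha> \<in> forms1 B (tangent_space B)" using M(2) by (simp add: contact_form_def)
  ultimately have lam_form: "lam \<in> forms1 A (tangent_space A)"
    unfolding lam by (rule pullback_form[OF Y(1) M(1)])
  interpret foliation A lam L
    by unfold_locales (rule Y(1) lam_form coisotropic nonsingular L)+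
  note inf = infinitesimal_deformations_eq and gauge = gauge_deformations_eq[OF Y(2)]
  have "gauge_deformations A lam L \<subseteq> infinitesimal_deformations A lam L"
    unfolding inf gauge using twisted_d0_form twisted_d1_d0 by auto
  moreover have "form_quotient (infinitesimal_deformations A lam L) (gauge_deformations A lam L) = H1_tw A lam"
    unfolding inf gauge H1_tw_def ..
  ultimately show ?thesis
    using twisted_d1_kernel_subspace twisted_d0_image_subspace inf gauge by simp
qed

end
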